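(* Let $A$ be a bounded self-adjoint (symmetric) positive operator in a real Hilbert space $\mathcal{H}$, with spectral bounds $m=\inf_{\|x\|=1}(Ax,x)$ and $M=\sup_{\|x\|=1}(Ax,x)$ such that $0<m<M<\infty$. Let $y\in\mathcal{H}$ and $f(x)=\frac12(Ax,x)-(x,y)$. Apply a $P$-gradient algorithm for the minimisation of $f$, initialized at $x_0$, with iterates $x_k$ and renormalised gradients $z_k=z(x_k)$. Assume that $z_0$ is such that for any $\epsilon$ with $0<\epsilon<(M-m)/2$, $$(E_{m+\epsilon}z_0,z_0)>0\quad\text{and}\quad(E_{M-\epsilon}z_0,z_0)<1,$$ with $(E_\lambda)$ the spectral family of projections associated with $A$. Then there exist a number $p\in(0,1)$, depending on $z_0$, and vectors $u_n,v_n\in\mathcal{H}$ ($n\geq0$) such that for all $k\ge0$ $$z_{2k}=\sqrt{p}\,u_{2k}+\sqrt{1-p}\,v_{2k},\qquad z_{2k+1}=\sqrt{1-p}\,u_{2k+1}-\sqrt{p}\,v_{2k+1},$$ with $\|u_n\|=\|v_n\|=1$ for all $n$, and $\|Au_n-mu_n\|\to0$, $\|Av_n-Mv_n\|\to0$ as $n\to\infty$.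
   Context: $(\cdot,\cdot)$ is the inner product of $\mathcal{H}$ and $\|\cdot\|$ its norm. The gradient of $f$ is $g(x)=Ax-y$. The spectral family $(E_\lambda)$ is the resolution of the identity of $A$: $E_\lambda$ is the spectral projection of $A$ for $(-\infty,\lambda]$, so that $A=\int\lambda\,dE_\lambda$. Let $P(\cdot)$ be a real function on $[m,M]$, infinitely differentiable, with Laurent series $P(z)=\sum_{k=-\infty}^{\infty}c_kz^k$, $c_k\in\mathbb{R}$, such that $0<\sum_{k=-\infty}^\infty c_ka^k<\infty$ for all $a\in[m,M]$. The corresponding $P$-gradient algorithm is $x_{k+1}=x_k-\gamma_kg_k$, $g_k=g(x_k)$, where the step-length $\gamma_k$ minimizes $(P(A)g(x_k-\gamma g_k),g(x_k-\gamma g_k))$ with respect to $\gamma$, that is (for $g_k\ne0$) $$\gamma_k=\frac{(P(A)Ag_k,g_k)}{(P(A)A^2g_k,g_k)}.$$ The renormalised gradient at $x$ (with $g(x)\neq0$) is $$z(x)=\frac{Bg(x)}{(P(A)Ag(x),g(x))^{1/2}},$$ where $B=[P(A)A]^{1/2}$ is the positive square root of $P(A)A$; thus $\|z(x)\|=1$. *)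

theory Defs
  imports "HOL-Analysis.Analysis"
begin

definition selfadjoint_op :: "('a::real_inner \<Rightarrow>\<^sub>L 'a) \<Rightarrow> bool" where
  "selfadjoint_op T \<longleftrightarrow> (\<forall>x y. T x \<bullet> y = x \<bullet> T y)"

definition positive_op :: "('a::real_inner \<Rightarrow>\<^sub>L 'a) \<Rightarrow> bool" where
  "positive_op T \<longleftrightarrow> (\<forall>x. 0 \<le> T x \<bullet> x)"

definition op_power :: "('a::real_normed_vector \<Rightarrow>\<^sub>L 'a) \<Rightarrow> nat \<Rightarrow> 'a \<Rightarrow>\<^sub>L 'a" where
  "op_power T n = ((\<lambda>S. T o\<^sub>L S) ^^ n) id_blinfun"

text \<open>Meaningful only for boundedly invertible \<open>T\<close>; the inverse is then unique.\<close>

definition op_inverse :: "('a::real_normed_vector \<Rightarrow>\<^sub>L 'a) \<Rightarrow> 'a \<Rightarrow>\<^sub>L 'a" where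
  "op_inverse T = (THE S. S o\<^sub>L T = id_blinfun \<and> T o\<^sub>L S = id_blinfun)"

text \<open>On a Hilbert space a positive self-adjoint \<open>T\<close> has exactly one positive self-adjoint
  square root.\<close>

definition op_sqrt :: "('a::real_inner \<Rightarrow>\<^sub>L 'a) \<Rightarrow> 'a \<Rightarrow>\<^sub>L 'a" where
  "op_sqrt T = (THE B. selfadjoint_op B \<and> positive_op B \<and> B o\<^sub>L B = T)"

text \<open>A bilateral series \<open>\<Sum>k\<in>\<int>. c k * a^k\<close> converges when its part with \<open>k \<ge> 0\<close> and its part
  with \<open>k < 0\<close> both converge; absolute convergence is not required.\<close>

definition laurent_sums :: "(int \<Rightarrow> real) \<Rightarrow> real \<Rightarrow> real \<Rightarrow> bool" where
  "laurent_sums c a s \<longleftrightarrow>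
     (\<exists>s1 s2. (\<lambda>n. c (int n) * a powi (int n)) sums s1 \<and>
              (\<lambda>n. c (- int (Suc n)) * a powi (- int (Suc n))) sums s2 \<and>
              s = s1 + s2)"

text \<open>The operator \<open>\<Sum>k\<in>\<int>. c k T^k\<close>; both series are taken in the operator norm.\<close>

definition laurent_op :: "(int \<Rightarrow> real) \<Rightarrow> ('a::real_normed_vector \<Rightarrow>\<^sub>L 'a) \<Rightarrow> 'a \<Rightarrow>\<^sub>L 'a" where
  "laurent_op c T =
     (\<Sum>n. c (int n) *\<^sub>R op_power T n) +
     (\<Sum>n. c (- int (Suc n)) *\<^sub>R op_power (op_inverse T) (Suc n))"

text \<open>Infinite differentiability on \<open>S\<close>; on a closed interval the derivatives at the end points
  are one-sided. \<open>D n\<close> is the \<open>n\<close>-th derivative.\<close>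

definition infinitely_differentiable_on :: "(real \<Rightarrow> real) \<Rightarrow> real set \<Rightarrow> bool" where
  "infinitely_differentiable_on f S \<longleftrightarrow>
     (\<exists>D :: nat \<Rightarrow> real \<Rightarrow> real.
        (\<forall>t\<in>S. D 0 t = f t) \<and>
        (\<forall>n. \<forall>t\<in>S. (D n has_real_derivative D (Suc n) t) (at t within S)))"

text \<open>\<open>E\<close> is the spectral family (resolution of the identity) of the self-adjoint operator \<open>T\<close>:
  an increasing, strongly right-continuous family of orthogonal projections from \<open>0\<close> to the
  identity with \<open>T = \<integral>\<lambda> dE\<^sub>\<lambda>\<close>. Right continuity makes \<open>E \<lambda>\<close> the spectral projection for
  \<open>(-\<infinity>, \<lambda>]\<close>. The integral is the usual weak one, written for the quadratic form
  \<open>(T x, x) = \<integral>\<lambda> d(E\<^sub>\<lambda> x, x)\<close>, which determines \<open>T\<close> by polarization;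
  \<open>\<lambda> \<mapsto> (E\<^sub>\<lambda> x, x) = \<parallel>E\<^sub>\<lambda> x\<parallel>\<^sup>2\<close> is increasing and right-continuous, so that
  \<^const>\<open>interval_measure\<close> is its Stieltjes measure.\<close>

definition spectral_family ::
    "('a::real_inner \<Rightarrow>\<^sub>L 'a) \<Rightarrow> (real \<Rightarrow> 'a \<Rightarrow>\<^sub>L 'a) \<Rightarrow> bool" where
  "spectral_family T E \<longleftrightarrow>
     (\<forall>t. selfadjoint_op (E t)) \<and>
     (\<forall>s t. E s o\<^sub>L E t = E (min s t)) \<and>
     (\<forall>x t. ((\<lambda>s. E s x) \<longlongrightarrow> E t x) (at_right t)) \<and>
     (\<forall>x. ((\<lambda>s. E s x) \<longlongrightarrow> 0) at_bot) \<and>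
     (\<forall>x. ((\<lambda>s. E s x) \<longlongrightarrow> x) at_top) \<and>
     (\<forall>x. has_bochner_integral (interval_measure (\<lambda>t. E t x \<bullet> x)) (\<lambda>t. t) (T x \<bullet> x))"

definition quadratic_objective :: "('a::real_inner \<Rightarrow>\<^sub>L 'a) \<Rightarrow> 'a \<Rightarrow> 'a \<Rightarrow> real" where
  "quadratic_objective A y x = 1 / 2 * (A x \<bullet> x) - x \<bullet> y"

lemma GDERIV_quadratic_objective:
  assumes "selfadjoint_op A"
  shows "GDERIV (quadratic_objective A y) x :> (A x - y)"
proof -
  have sym: "A x \<bullet> h = h \<bullet> A x" "A h \<bullet> x = h \<bullet> A x" for h
    using assms by (simp_all add: selfadjoint_op_def inner_commute)
  have "((\<lambda>x. 1 / 2 * (A x \<bullet> x) - x \<bullet> y) has_derivative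
      (\<lambda>h. 1 / 2 * (A x \<bullet> h + A h \<bullet> x) - h \<bullet> y)) (at x)"
    by (auto intro!: derivative_eq_intros)
  moreover have "(\<lambda>h. 1 / 2 * (A x \<bullet> h + A h \<bullet> x) - h \<bullet> y) = (\<lambda>h. h \<bullet> (A x - y))"
    by (rule ext) (simp add: sym inner_diff_right)
  ultimately show ?thesis
    by (simp add: gderiv_def quadratic_objective_def[abs_def])
qed

text \<open>\<open>x\<close> is a run of \<open>x\<^sub>k\<^sub>+\<^sub>1 = x\<^sub>k - \<gamma>\<^sub>k g(x\<^sub>k)\<close> with gradient map \<open>g\<close>, where \<open>\<gamma>\<^sub>k\<close> minimizes
  \<open>(Q g(x\<^sub>k - \<gamma> g(x\<^sub>k)), g(x\<^sub>k - \<gamma> g(x\<^sub>k)))\<close> over real \<open>\<gamma>\<close>. If \<open>g(x\<^sub>k) = 0\<close> then every \<open>\<gamma>\<^sub>k\<close> is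
  a minimizer and \<open>x\<^sub>k\<^sub>+\<^sub>1 = x\<^sub>k\<close>.\<close>

definition gradient_algorithm ::
    "('a::real_inner \<Rightarrow>\<^sub>L 'a) \<Rightarrow> ('a \<Rightarrow> 'a) \<Rightarrow> (nat \<Rightarrow> 'a) \<Rightarrow> bool" where
  "gradient_algorithm Q g x \<longleftrightarrow>
     (\<exists>\<gamma> :: nat \<Rightarrow> real. \<forall>k.
        is_arg_min (\<lambda>t. Q (g (x k - t *\<^sub>R g (x k))) \<bullet> g (x k - t *\<^sub>R g (x k))) (\<lambda>_. True) (\<gamma> k) \<and>
        x (Suc k) = x k - \<gamma> k *\<^sub>R g (x k))"

text \<open>The renormalisation of a gradient vector \<open>v \<noteq> 0\<close> with respect to \<open>Q = P(A)\<close>;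
  for \<open>v = 0\<close> the value is \<open>0\<close>.\<close>

definition renormalised_gradient ::
    "('a::real_inner \<Rightarrow>\<^sub>L 'a) \<Rightarrow> ('a \<Rightarrow>\<^sub>L 'a) \<Rightarrow> 'a \<Rightarrow> 'a" where
  "renormalised_gradient Q A v = op_sqrt (Q o\<^sub>L A) v /\<^sub>R sqrt (Q (A v) \<bullet> v)"

end

theory Submission
  imports Defs "HOL-Probability.Characteristic_Functions"
begin

text \<open>
  In terms of the renormalised gradients the algorithm reads \<open>z' = (\<mu> - A) z / d\<close> with
  \<open>\<mu> = (A z, z)\<close> and \<open>d = \<parallel>(A - \<mu>) z\<parallel>\<close>, independently of \<open>P\<close>. The identity
  \<open>\<parallel>d' z'' - d z\<parallel>\<^sup>2 = d'\<^sup>2 - d\<^sup>2\<close> makes \<open>d\<close> increasing, hence convergent, and shows that \<open>z''\<close> approaches \<open>z\<close>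
  and that the quadratic \<open>(A - \<mu>) (A - \<mu>') - d\<^sup>2 = (A - a) (A - b)\<close> almost annihilates \<open>z\<close>. Here
  \<open>m \<le> a < b \<le> M\<close> by orthogonality. The component of \<open>z\<close> near \<open>m\<close> would grow geometrically if \<open>a\<close> stayed
  away from \<open>m\<close>, and the relative weight of slightly higher spectral components decreases, which
  together with the slow variation of \<open>a\<close> forces \<open>a \<longlonglongrightarrow> m\<close>; passing to \<open>- A\<close>, \<open>b \<longlonglongrightarrow> M\<close>. So \<open>z\<close> splits
  asymptotically into approximate eigenvectors for \<open>m\<close> and \<open>M\<close>. The squared norms \<open>\<pi>\<close> and \<open>1 - \<pi>\<close> of the
  two parts satisfy \<open>\<pi> (1 - \<pi>) \<longlonglongrightarrow> (lim d / (M - m))\<^sup>2\<close>, swap at every step and vary slowly over two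
  steps, so they converge along even and odd indices.
\<close>

section \<open>Spectral families\<close>

text \<open>Neither m nor M need be an eigenvalue, so the mass of \<open>z k\<close> near an end of
  the spectrum has no limiting vector that could be followed. All estimates are therefore made with
  projections at fixed thresholds, while the roots a and b move with k. That a comes near m
  infinitely often would still allow it to drift away again; the monotone ratio of a slice to the
  part below it, small at one good time and hence ever after, closes this escape. P enters only
  through B = (P(A) A)^(1/2). Since B commutes with A, it carries the gradient recursion over to B
  g, and the remaining scalar disappears in the normalisation. The functional calculus is there to
  evaluate the operators given by series and by descriptions (\<open>laurent_op\<close>,
  \<open>op_inverse\<close>, \<open>op_sqrt\<close>) and to show that B is self-adjoint and commutes
  with A. A Laurent series may converge only conditionally at m or M, so its convergence in operator
  norm rests on Abel summation. A last obstacle is that the coefficients must be exactly sqrt p and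
  sqrt (1 - p), whereas the norms of the two parts only tend to them; a small rotation repairs
  this.\<close>

locale spectral_resolution =
  fixes T :: "'a::real_inner \<Rightarrow>\<^sub>L 'a" and F :: "real \<Rightarrow> 'a \<Rightarrow>\<^sub>L 'a"
  assumes T_sym: "T x \<bullet> y = x \<bullet> T y"
    and F_sym: "F s x \<bullet> y = x \<bullet> F s y"
    and F_F: "F s (F t x) = F (min s t) x"
    and F_T: "F s (T x) = T (F s x)"
    and F_upper: "T (F s x) \<bullet> F s x \<le> s * (F s x \<bullet> F s x)"
    and F_lower: "s * ((x - F s x) \<bullet> (x - F s x)) \<le> T (x - F s x) \<bullet> (x - F s x)"

text \<open>Both sides are finite Borel measures with distribution function
  \<open>G (min t s)\<close>, and such measures are determined by that function. For
  \<open>G t = E t x \<bullet> x\<close> the stopped function belongs to \<open>E s x\<close>: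
  projecting a vector restricts its spectral measure.\<close>

lemma interval_measure_min:
  fixes G :: "real \<Rightarrow> real"
  assumes mono: "\<And>x y. x \<le> y \<Longrightarrow> G x \<le> G y" and cont: "\<And>a. continuous (at_right a) G"
    and bot: "(G \<longlongrightarrow> 0) at_bot" and top: "(G \<longlongrightarrow> c) at_top" and c: "0 \<le> c"
  shows "interval_measure (\<lambda>t. G (min t s)) = density (interval_measure G) (indicator {..s})"
proof (rule cdf_unique')
  let ?H = "\<lambda>t. G (min t s)"
  have monoH: "\<And>x y. x \<le> y \<Longrightarrow> ?H x \<le> ?H y"
    by (auto intro: mono)
  have contH: "continuous (at_right a) ?H" for a
  proof (cases "a < s")
    case True
    have "eventually (\<lambda>t. G t = ?H t) (at_right a)"
      unfolding eventually_at_right_field using True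
      by (intro exI[of _ s]) (auto simp: min_def)
    moreover have "(G \<longlongrightarrow> ?H a) (at_right a)"
      using cont[of a] True by (simp add: continuous_within min_def)
    ultimately show ?thesis
      unfolding continuous_within by (rule Lim_transform_eventually[rotated])
  next
    case False
    have "eventually (\<lambda>t. G s = ?H t) (at_right a)"
      unfolding eventually_at_right_field using False
      by (intro exI[of _ "a + 1"]) (auto simp: min_def)
    then show ?thesis
      unfolding continuous_within using False
      by (intro Lim_transform_eventually[OF tendsto_const]) (auto simp: min_def elim: eventually_mono)
  qed
  have botH: "(?H \<longlongrightarrow> 0) at_bot"
  proof (rule Lim_transform_eventually[OF bot])
    show "eventually (\<lambda>t. G t = ?H t) at_bot"
      unfolding eventually_at_bot_linorder by (intro exI[of _ s]) (auto simp: min_def)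
  qed
  have topH: "(?H \<longlongrightarrow> G s) at_top"
  proof (rule Lim_transform_eventually[OF tendsto_const])
    show "eventually (\<lambda>t. G s = ?H t) at_top"
      unfolding eventually_at_top_linorder by (intro exI[of _ s]) (auto simp: min_def)
  qed
  have Gs: "0 \<le> G s"
    using bot by (rule tendsto_upperbound) (auto simp: eventually_at_bot_linorder mono intro!: exI[of _ s])
  show "finite_borel_measure (interval_measure ?H)"
    by (rule finite_borel_measure_interval_measure[OF monoH contH botH topH Gs])
  let ?M = "interval_measure G"
  let ?D = "density ?M (indicator {..s})"
  interpret G: finite_borel_measure ?M
    by (rule finite_borel_measure_interval_measure[OF mono cont bot top c])
  show "finite_borel_measure ?D"
    by (intro finite_borel_measure.intro G.finite_measure_restricted finite_borel_measure_axioms.intro)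
      (simp_all add: sets_density)
  show "cdf (interval_measure ?H) = cdf ?D"
  proof
    fix t
    have "cdf (interval_measure ?H) t = G (min t s)"
      by (simp add: cdf_interval_measure[OF monoH contH botH])
    also have "\<dots> = measure ?M {..min t s}"
      by (simp add: measure_interval_measure_Iic[OF mono cont bot])
    also have "{..min t s} = {..s} \<inter> {..t}" by auto
    also have "measure ?M \<dots> = cdf ?D t"
      unfolding cdf_def by (simp add: measure_restricted)
    finally show "cdf (interval_measure ?H) t = cdf ?D t" .
  qed
qed

text \<open>The spectral measures of \<open>E s x\<close> and \<open>x - E s x\<close> are the
  restrictions of that of x to \<open>{..s}\<close> and \<open>{s<..}\<close>. The form bounds
  express these supports; additivity of the integral splits the form of A along \<open>E s\<close>,
  which polarises to commutation. From here on no measure occurs.\<close>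

lemma spectral_family_resolution:
  assumes A: "selfadjoint_op A" and E: "spectral_family A E"
  shows "spectral_resolution A E"
proof -
  have A_sym: "A x \<bullet> y = x \<bullet> A y" for x y
    using A by (simp add: selfadjoint_op_def)
  have E_sym: "E s x \<bullet> y = x \<bullet> E s y" for s x y
    using E by (simp add: spectral_family_def selfadjoint_op_def)
  have "E s o\<^sub>L E t = E (min s t)" for s t
    using E by (simp add: spectral_family_def)
  then have E_E: "E s (E t x) = E (min s t) x" for s t x
    by (metis blinfun_apply_blinfun_compose)
  have E_right: "((\<lambda>s. E s x) \<longlongrightarrow> E t x) (at_right t)" for x t
    using E by (simp add: spectral_family_def)
  have E_bot: "((\<lambda>s. E s x) \<longlongrightarrow> 0) at_bot" and E_top: "((\<lambda>s. E s x) \<longlongrightarrow> x) at_top" for x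
    using E by (simp_all add: spectral_family_def)
  define G where "G x t = E t x \<bullet> x" for x t
  have int: "has_bochner_integral (interval_measure (G x)) (\<lambda>t. t) (A x \<bullet> x)" for x
    using E by (simp add: spectral_family_def G_def[abs_def])
  have G_norm: "G x t = norm (E t x) ^ 2" for x t
    using E_sym[of t x "E t x"] E_E[of t t x]
    by (simp add: G_def power2_norm_eq_inner inner_commute)
  have E_le: "norm (E s x) \<le> norm x" for s x
  proof -
    have "norm (E s x) ^ 2 \<le> norm (E s x) * norm x"
      using G_norm[of x s] norm_cauchy_schwarz[of "E s x" x] by (simp add: G_def)
    then show ?thesis
      by (cases "norm (E s x) = 0") (auto simp: power2_eq_square)
  qed
  have G_mono: "G x s \<le> G x t" if "s \<le> t" for x s t
    using that E_le[of s "E t x"] E_E[of s t x] by (simp add: G_norm power_mono)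
  have G_cont: "continuous (at_right t) (G x)" for t x
    unfolding continuous_within G_def by (intro tendsto_intros E_right)
  have G_bot: "(G x \<longlongrightarrow> 0) at_bot" for x
    unfolding G_def using tendsto_inner[OF E_bot tendsto_const, of x x] by simp
  have G_top: "(G x \<longlongrightarrow> x \<bullet> x) at_top" for x
    unfolding G_def by (intro tendsto_intros E_top)
  have fin: "finite_borel_measure (interval_measure (G x))" for x
    by (rule finite_borel_measure_interval_measure[OF G_mono G_cont G_bot G_top]) simp_all
  have UNIV: "emeasure (interval_measure (G x)) UNIV = ennreal (x \<bullet> x)" for x
    by (rule interval_measure_UNIV[OF G_mono G_cont G_bot G_top]) simp_all
  have Iic: "emeasure (interval_measure (G x)) {..t} = ennreal (G x t)" for x t
    by (rule emeasure_interval_measure_Iic[OF G_mono G_cont G_bot])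
  have mUNIV: "measure (interval_measure (G x)) UNIV = x \<bullet> x" for x
    using UNIV[of x] by (simp add: measure_def)
  have A_int: "A x \<bullet> x = (\<integral>t. t \<partial>interval_measure (G x))"
    and integrable: "integrable (interval_measure (G x)) (\<lambda>t. t)" for x
    using int[of x] by (simp_all add: has_bochner_integral_iff)
  show ?thesis
  proof
    show "A x \<bullet> y = x \<bullet> A y" for x y by (fact A_sym)
    show "E s x \<bullet> y = x \<bullet> E s y" for s x y by (fact E_sym)
    show "E s (E t x) = E (min s t) x" for s t x by (fact E_E)
    have sum: "A x \<bullet> x = A (E s x) \<bullet> E s x + A (x - E s x) \<bullet> (x - E s x)" for x s
    proof -
      let ?M = "interval_measure (G x)"
      have G1: "G (E s x) = (\<lambda>t. G x (min t s))"
        by (simp add: fun_eq_iff G_norm E_E)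
      have G2: "G (x - E s x) = (\<lambda>t. G x t - G x (min t s))"
      proof
        fix t
        have "E t (x - E s x) \<bullet> E s x = E s (E t (x - E s x)) \<bullet> x" by (simp add: E_sym)
        also have "\<dots> = 0" by (simp add: E_E blinfun.diff_right min.commute min.left_commute)
        finally show "G (x - E s x) t = G x t - G x (min t s)"
          by (simp add: G_def inner_diff_right blinfun.diff_right inner_diff_left E_E)
      qed
      interpret M: finite_borel_measure ?M by (rule fin)
      have M1: "interval_measure (G (E s x)) = density ?M (indicator {..s})"
        unfolding G1 by (rule interval_measure_min[OF G_mono G_cont G_bot G_top]) simp_all
      have M2: "interval_measure (G (x - E s x)) = density ?M (indicator {s<..})"
      proof (rule cdf_unique')
        let ?D = "density ?M (indicator {s<..})"
        show "finite_borel_measure ?D"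
          by (intro finite_borel_measure.intro M.finite_measure_restricted finite_borel_measure_axioms.intro)
            (simp_all add: sets_density)
        show "finite_borel_measure (interval_measure (G (x - E s x)))" by (rule fin)
        show "cdf (interval_measure (G (x - E s x))) = cdf ?D"
        proof
          fix t
          have "cdf (interval_measure (G (x - E s x))) t = G x t - G x (min t s)"
            by (simp add: cdf_interval_measure[OF G_mono G_cont G_bot]) (simp add: G2)
          also have "\<dots> = measure ?M ({..t} - {..min t s})"
            by (subst M.finite_measure_Diff)
              (auto simp: measure_interval_measure_Iic[OF G_mono G_cont G_bot])
          also have "{..t} - {..min t s} = {s<..} \<inter> {..t}" by auto
          also have "measure ?M \<dots> = cdf ?D t"
            unfolding cdf_def by (simp add: measure_restricted)
          finally show "cdf (interval_measure (G (x - E s x))) t = cdf ?D t" .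
        qed
      qed
      \<comment> \<open>\<open>integral_density\<close> expects the density as a coerced real
        function, while \<open>M1\<close> and \<open>M2\<close> carry the indicator with values in
        \<open>ennreal\<close>.\<close>
      have ind: "ennreal (indicator X t) = indicator X t" for X :: "real set" and t
        by (simp split: split_indicator)
      have i1: "A (E s x) \<bullet> E s x = (\<integral>t. indicator {..s} t * t \<partial>?M)"
        unfolding A_int[of "E s x"] M1 ind[symmetric]
        by (subst integral_density) auto
      have i2: "A (x - E s x) \<bullet> (x - E s x) = (\<integral>t. indicator {s<..} t * t \<partial>?M)"
        unfolding A_int[of "x - E s x"] M2 ind[symmetric]
        by (subst integral_density) auto
      have I: "integrable ?M (\<lambda>t. indicator X t * t)" if "X \<in> sets borel" for X :: "real set"
        using integrable_mult_indicator[of X ?M "\<lambda>t. t"] integrable[of x] that by simp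
      have "A x \<bullet> x = (\<integral>t. indicator {..s} t * t + indicator {s<..} t * t \<partial>?M)"
        unfolding A_int[of x] by (intro Bochner_Integration.integral_cong) (auto split: split_indicator)
      also have "\<dots> = A (E s x) \<bullet> E s x + A (x - E s x) \<bullet> (x - E s x)"
        unfolding i1 i2 by (rule Bochner_Integration.integral_add[OF I I]) auto
      finally show ?thesis .
    qed
    have ortho: "A (E s u) \<bullet> (w - E s w) = 0" for s u w
    proof -
      \<comment> \<open>A vector with freely chosen parts below and above s: comparing its form with
        \<open>sum\<close> leaves twice the cross term, by symmetry of A.\<close>
      let ?x = "E s u + (w - E s w)"
      have "E s ?x = E s u" by (simp add: blinfun.add_right blinfun.diff_right E_E)
      then have "A ?x \<bullet> ?x = A (E s u) \<bullet> E s u + A (w - E s w) \<bullet> (w - E s w)"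
        using sum[of ?x s] by simp
      moreover have "A (w - E s w) \<bullet> E s u = A (E s u) \<bullet> (w - E s w)"
        by (metis A_sym inner_commute)
      ultimately show ?thesis
        by (simp add: blinfun.add_right[of A "E s u"] inner_add_left inner_add_right)
    qed
    show "E s (A x) = A (E s x)" for s x
    proof -
      have "(E s (A x) - A (E s x)) \<bullet> w = 0" for w
      proof -
        have "A (E s x) \<bullet> w = A (E s x) \<bullet> E s w"
          using ortho[of s x w] by (simp add: inner_diff_right)
        moreover have "A x \<bullet> E s w = A (E s x) \<bullet> E s w"
          using ortho[of s w x]
          by (metis A_sym inner_commute inner_diff_right right_minus_eq)
        ultimately show ?thesis
          by (simp add: inner_diff_left E_sym)
      qed
      then show ?thesis by (metis inner_eq_zero_iff right_minus_eq)
    qed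
    show "A (E s x) \<bullet> E s x \<le> s * (E s x \<bullet> E s x)" for s x
    proof -
      let ?x = "E s x"
      let ?M = "interval_measure (G ?x)"
      interpret M: finite_borel_measure ?M by (rule fin)
      have "emeasure ?M (UNIV - {..s}) = emeasure ?M UNIV - emeasure ?M {..s}"
        by (rule emeasure_Diff) (auto simp: M.emeasure_finite[of "{..s}", simplified])
      also have "\<dots> = 0" unfolding UNIV Iic by (simp add: G_norm E_E power2_norm_eq_inner)
      finally have "AE t in ?M. t \<le> s"
        by (intro AE_I[of _ _ "UNIV - {..s}"]) auto
      then have "(\<integral>t. t \<partial>?M) \<le> (\<integral>t. s \<partial>?M)"
        by (intro integral_mono_AE integrable) auto
      then show ?thesis by (simp add: A_int[symmetric] mUNIV mult.commute)
    qed
    show "s * ((x - E s x) \<bullet> (x - E s x)) \<le> A (x - E s x) \<bullet> (x - E s x)" for s x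
    proof -
      let ?x = "x - E s x"
      let ?M = "interval_measure (G ?x)"
      interpret M: finite_borel_measure ?M by (rule fin)
      have "G ?x s = 0" by (simp add: G_norm blinfun.diff_right E_E)
      then have "emeasure ?M {..s} = 0" by (simp add: Iic)
      then have "AE t in ?M. s \<le> t"
        by (intro AE_I[of _ _ "{..s}"]) auto
      then have "(\<integral>t. s \<partial>?M) \<le> (\<integral>t. t \<partial>?M)"
        by (intro integral_mono_AE integrable) auto
      then show ?thesis by (simp add: A_int[symmetric] mUNIV mult.commute)
    qed
  qed
qed

text \<open>This is the operator inequality S^2 \<le> C S. It comes from positivity of S at x - S x
  / C, where the upper bound at S x controls the quadratic term.\<close>

lemma positive_op_norm_le:
  fixes S :: "'a::real_inner \<Rightarrow>\<^sub>L 'a"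
  assumes sym: "\<And>x y. S x \<bullet> y = x \<bullet> S y" and pos: "\<And>x. 0 \<le> S x \<bullet> x"
    and le: "\<And>x. S x \<bullet> x \<le> C * (x \<bullet> x)" and C: "0 < C"
  shows "(norm (S x))\<^sup>2 \<le> C * (S x \<bullet> x)"
proof -
  let ?n = "(norm (S x))\<^sup>2"
  have "0 \<le> S (x - inverse C *\<^sub>R S x) \<bullet> (x - inverse C *\<^sub>R S x)" by (rule pos)
  also have "\<dots> = S x \<bullet> x - 2 * inverse C * ?n + (inverse C)\<^sup>2 * (S (S x) \<bullet> S x)"
    using sym[of "S x" x] unfolding power2_norm_eq_inner
    by (simp add: blinfun.diff_right blinfun.scaleR_right inner_diff_left inner_diff_right
        power2_eq_square inner_commute algebra_simps)
  also have "\<dots> \<le> S x \<bullet> x - 2 * inverse C * ?n + (inverse C)\<^sup>2 * (C * ?n)"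
    using le[of "S x"] by (intro add_left_mono mult_left_mono) (auto simp: power2_norm_eq_inner)
  also have "\<dots> = S x \<bullet> x - inverse C * ?n"
    using C by (simp add: power2_eq_square field_simps)
  finally show ?thesis using C by (simp add: field_simps)
qed

section \<open>Norm estimates on spectral subspaces\<close>

context spectral_resolution
begin

lemma F_ortho: "F s x \<bullet> (y - F s y) = 0"
  by (metis F_F F_sym min.idem inner_diff_right right_minus_eq)

lemma F_pythagoras: "(norm x)\<^sup>2 = (norm (F s x))\<^sup>2 + (norm (x - F s x))\<^sup>2"
proof -
  have "x \<bullet> x = (F s x + (x - F s x)) \<bullet> (F s x + (x - F s x))" by simp
  also have "\<dots> = F s x \<bullet> F s x + (x - F s x) \<bullet> (x - F s x) + 2 * (F s x \<bullet> (x - F s x))"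
    by (simp only: inner_add_left inner_add_right inner_commute)
  finally show ?thesis by (simp add: F_ortho power2_norm_eq_inner)
qed

lemma norm_F_le: "norm (F s x) \<le> norm x"
  and norm_F_compl_le: "norm (x - F s x) \<le> norm x"
  using F_pythagoras[of x s] by (auto intro: power2_le_imp_le)

text \<open>On the range of \<open>F s\<close> the form of c - T is at least c - s, and
  Cauchy-Schwarz turns this into expansion by at least that factor.\<close>

lemma shift_below_le:
  assumes "s \<le> c"
  shows "(c - s) * norm (F s x) \<le> norm (T (F s x) - c *\<^sub>R F s x)"
proof (cases "F s x = 0")
  case False
  have "(c - s) * (norm (F s x))\<^sup>2 \<le> (c *\<^sub>R F s x - T (F s x)) \<bullet> F s x"
    using F_upper[of s x] by (simp add: inner_diff_left power2_norm_eq_inner algebra_simps)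
  also have "\<dots> \<le> norm (T (F s x) - c *\<^sub>R F s x) * norm (F s x)"
    by (metis norm_cauchy_schwarz norm_minus_commute)
  finally show ?thesis using False by (simp add: power2_eq_square)
qed simp

lemma shift_above_le:
  assumes "c \<le> s"
  shows "(s - c) * norm (x - F s x) \<le> norm (T (x - F s x) - c *\<^sub>R (x - F s x))"
proof (cases "x - F s x = 0")
  case False
  have "(s - c) * (norm (x - F s x))\<^sup>2 \<le> (T (x - F s x) - c *\<^sub>R (x - F s x)) \<bullet> (x - F s x)"
    using F_lower[of s x] by (simp only: inner_diff_left power2_norm_eq_inner inner_scaleR_left left_diff_distrib diff_right_mono)
  also have "\<dots> \<le> norm (T (x - F s x) - c *\<^sub>R (x - F s x)) * norm (x - F s x)"
    by (rule norm_cauchy_schwarz)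
  finally show ?thesis using False by (simp add: power2_eq_square)
qed simp

text \<open>For \<open>s \<le> r\<close>, the spectral projection for the interval between s and r:
  its range lies in the range of \<open>F r\<close> and in the kernel of \<open>F s\<close>.\<close>

definition slice :: "real \<Rightarrow> real \<Rightarrow> 'a \<Rightarrow>\<^sub>L 'a" where
  "slice s r = F r - F s"

lemma slice_apply: "slice s r x = F r x - F s x"
  by (simp add: slice_def blinfun.diff_left)

lemma slice_T: "slice s r (T x) = T (slice s r x)"
  by (simp add: slice_apply F_T blinfun.diff_right)

lemma F_slice: "s \<le> r \<Longrightarrow> F r (slice s r x) = slice s r x"
  "s \<le> r \<Longrightarrow> F s (slice s r x) = 0"
  by (simp_all add: slice_apply F_F blinfun.diff_right min_absorb1 min_absorb2)

lemma slice_eq: "s \<le> r \<Longrightarrow> slice s r x = F r x - F s (F r x)"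
  by (simp add: slice_apply F_F)

lemma norm_slice_le: "s \<le> r \<Longrightarrow> norm (slice s r x) \<le> norm x"
  unfolding slice_eq by (meson norm_F_compl_le norm_F_le order_trans)

lemma slice_form:
  assumes "s \<le> r"
  shows "s * (slice s r x \<bullet> slice s r x) \<le> T (slice s r x) \<bullet> slice s r x"
    and "T (slice s r x) \<bullet> slice s r x \<le> r * (slice s r x \<bullet> slice s r x)"
  using F_lower[of s "slice s r x"] F_upper[of r "slice s r x"] assms
  by (simp_all add: F_slice)

text \<open>On the slice the form of c - T lies between 0 and c - s. Cauchy-Schwarz would give only
  lower norm bounds; the upper one comes from \<open>positive_op_norm_le\<close>.\<close>

lemma slice_le:
  assumes "s < r" "r \<le> c"
  shows "norm (T (slice s r x) - c *\<^sub>R slice s r x) \<le> (c - s) * norm (slice s r x)"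
proof -
  have sr: "s \<le> r" using assms by simp
  \<comment> \<open>Composition with the projection makes the form bounds of the slice valid on the
    whole space.\<close>
  define S where "S = c *\<^sub>R slice s r - (T o\<^sub>L slice s r)"
  have S: "S x = c *\<^sub>R slice s r x - T (slice s r x)" for x
    by (simp add: S_def blinfun.diff_left blinfun.scaleR_left)
  have sl_sym: "slice s r x \<bullet> y = x \<bullet> slice s r y" for x y
    by (simp add: slice_apply inner_diff_left inner_diff_right F_sym)
  have sl_sl: "slice s r (slice s r x) = slice s r x" for x
    using sr by (simp add: slice_apply F_F blinfun.diff_right min_absorb1 min_absorb2)
  have form: "S x \<bullet> x = c * (slice s r x \<bullet> slice s r x) - T (slice s r x) \<bullet> slice s r x" for x
    by (metis S S_def inner_diff_left inner_scaleR_left sl_sl sl_sym slice_T)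
  have "(norm (S x))\<^sup>2 \<le> (c - s) * (S x \<bullet> x)" for x
  proof (rule positive_op_norm_le)
    show "S x \<bullet> y = x \<bullet> S y" for x y
      by (simp add: S inner_diff_left inner_diff_right sl_sym T_sym slice_T)
    show "0 \<le> S x \<bullet> x" for x
      using slice_form(2)[OF sr, of x] mult_right_mono[OF assms(2), of "slice s r x \<bullet> slice s r x"]
      by (simp add: form)
    show "S x \<bullet> x \<le> (c - s) * (x \<bullet> x)" for x
    proof -
      have "S x \<bullet> x \<le> (c - s) * (slice s r x \<bullet> slice s r x)"
        using slice_form(1)[OF sr, of x] by (simp add: form algebra_simps)
      also have "\<dots> \<le> (c - s) * (x \<bullet> x)"
        using norm_slice_le[OF sr, of x] assms
        by (intro mult_left_mono) (auto simp: power2_norm_eq_inner[symmetric] power_mono)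
      finally show ?thesis .
    qed
    show "0 < c - s" using assms by simp
  qed
  then have "(norm (S (slice s r x)))\<^sup>2 \<le> (c - s) * (S (slice s r x) \<bullet> slice s r x)" .
  also have "\<dots> \<le> (c - s) * ((c - s) * (slice s r x \<bullet> slice s r x))"
    using slice_form(1)[OF sr, of x] assms
    by (intro mult_left_mono) (simp_all add: form sl_sl algebra_simps)
  finally have "(norm (S (slice s r x)))\<^sup>2 \<le> ((c - s) * norm (slice s r x))\<^sup>2"
    by (simp add: power_mult_distrib power2_norm_eq_inner) (simp add: power2_eq_square mult.assoc)
  then have "norm (S (slice s r x)) \<le> (c - s) * norm (slice s r x)"
    by (rule power2_le_imp_le) (use assms in simp)
  then show ?thesis by (simp add: S sl_sl norm_minus_commute)
qed

end

locale bounded_resolution = spectral_resolution T F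
  for T :: "'a::real_inner \<Rightarrow>\<^sub>L 'a" and F +
  fixes m M :: real
  assumes T_ge: "m * (x \<bullet> x) \<le> T x \<bullet> x" and T_le: "T x \<bullet> x \<le> M * (x \<bullet> x)"
    and m_less_M: "m < M"

section \<open>Continuous functional calculus\<close>

text \<open>The sort is spelled with \<open>complete_space\<close> rather than \<open>banach\<close>
  so that it fits spaces of sort \<open>{real_inner, complete_space}\<close>. The limit is built
  pointwise; letting j tend to infinity in \<open>norm (X n x - X j x)\<close> gives convergence in
  operator norm.\<close>

lemma blinfun_Cauchy_convergent:
  fixes X :: "nat \<Rightarrow> 'a::real_normed_vector \<Rightarrow>\<^sub>L 'b::{real_normed_vector, complete_space}"
  assumes "Cauchy X"
  shows "convergent X"
proof -
  have diff: "norm (X i x - X j x) \<le> norm (X i - X j) * norm x" for i j x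
    by (metis blinfun.diff_left norm_blinfun)
  have "convergent (\<lambda>n. X n x)" for x
  proof (rule Cauchy_convergent, rule CauchyI)
    fix e :: real assume e: "0 < e"
    then obtain N where N: "\<And>i j. N \<le> i \<Longrightarrow> N \<le> j \<Longrightarrow> norm (X i - X j) < e / (norm x + 1)"
      using CauchyD[OF assms, of "e / (norm x + 1)"] by (auto simp: add_nonneg_pos)
    show "\<exists>N. \<forall>i\<ge>N. \<forall>j\<ge>N. norm (X i x - X j x) < e"
    proof (intro exI allI impI)
      fix i j assume ij: "N \<le> i" "N \<le> j"
      have "norm (X i x - X j x) \<le> norm (X i - X j) * (norm x + 1)"
        by (rule order_trans[OF diff mult_left_mono]) auto
      also have "\<dots> < e" using N[OF ij] by (simp add: pos_less_divide_eq add_nonneg_pos)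
      finally show "norm (X i x - X j x) < e" .
    qed
  qed
  then obtain v where v: "\<And>x. (\<lambda>n. X n x) \<longlonglongrightarrow> v x"
    unfolding convergent_def by metis
  obtain K where K: "\<And>n. norm (X n) \<le> K"
    using Cauchy_Bseq[OF assms] by (auto simp: Bseq_def)
  have "bounded_linear v"
  proof (rule bounded_linear_intro)
    show "v (x + y) = v x + v y" for x y
      by (rule LIMSEQ_unique[OF v]) (simp add: blinfun.add_right tendsto_add v)
    show "v (r *\<^sub>R x) = r *\<^sub>R v x" for r x
      by (rule LIMSEQ_unique[OF v]) (simp add: blinfun.scaleR_right tendsto_scaleR v)
    show "norm (v x) \<le> norm x * K" for x
    proof (rule LIMSEQ_le_const2[OF tendsto_norm[OF v]])
      show "\<exists>N. \<forall>n\<ge>N. norm (X n x) \<le> norm x * K"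
        using K by (metis mult.commute mult_left_mono norm_blinfun norm_ge_zero order_trans)
    qed
  qed
  then obtain V where V: "\<And>x. blinfun_apply V x = v x"
    by (metis bounded_linear_Blinfun_apply)
  have "X \<longlonglongrightarrow> V"
  proof (rule LIMSEQ_I)
    fix e :: real assume e: "0 < e"
    then obtain N where N: "\<And>i j. N \<le> i \<Longrightarrow> N \<le> j \<Longrightarrow> norm (X i - X j) < e / 2"
      using CauchyD[OF assms, of "e / 2"] by auto
    show "\<exists>N. \<forall>n\<ge>N. norm (X n - V) < e"
    proof (intro exI allI impI)
      fix n assume n: "N \<le> n"
      have "norm (X n - V) \<le> e / 2"
      proof (rule norm_blinfun_bound)
        fix x
        show "norm ((X n - V) x) \<le> e / 2 * norm x"
        proof (rule LIMSEQ_le_const2)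
          show "(\<lambda>j. norm (X n x - X j x)) \<longlonglongrightarrow> norm ((X n - V) x)"
            by (simp add: blinfun.diff_left V) (intro tendsto_intros v)
          show "\<exists>N. \<forall>j\<ge>N. norm (X n x - X j x) \<le> e / 2 * norm x"
            using N[OF n] diff by (meson less_imp_le mult_right_mono norm_ge_zero order_trans)
        qed
      qed (use e in simp)
      then show "norm (X n - V) < e" using e by simp
    qed
  qed
  then show ?thesis by (rule convergentI)
qed

text \<open>Summation by parts: the boundary term is at most \<open>e * w n\<close>, and the
  decrease of the weights contributes at most \<open>e * (w 0 - w n)\<close>.\<close>

lemma abel_partial_sum:
  fixes d w :: "nat \<Rightarrow> real"
  assumes d: "\<And>n. \<bar>\<Sum>j<n. d j\<bar> \<le> e" and w: "\<And>n. w (Suc n) \<le> w n" "\<And>n. 0 \<le> w n"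
  shows "\<bar>\<Sum>j<n. d j * w j\<bar> \<le> e * w 0"
proof -
  have "(\<Sum>j<n. d j * w j) = (\<Sum>j<n. d j) * w n + (\<Sum>j<n. (\<Sum>i<Suc j. d i) * (w j - w (Suc j)))"
    by (induction n) (simp_all add: algebra_simps)
  also have "\<bar>\<dots>\<bar> \<le> \<bar>\<Sum>j<n. d j\<bar> * w n + (\<Sum>j<n. \<bar>\<Sum>i<Suc j. d i\<bar> * (w j - w (Suc j)))"
    using w by (intro order_trans[OF abs_triangle_ineq] add_mono order_trans[OF sum_abs] sum_mono)
      (auto simp: abs_mult)
  also have "\<dots> \<le> e * w n + (\<Sum>j<n. e * (w j - w (Suc j)))"
    using w d by (intro add_mono sum_mono mult_right_mono) (auto simp del: sum.lessThan_Suc)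
  also have "(\<Sum>j<n. e * (w j - w (Suc j))) = e * (w 0 - w n)"
    by (simp only: sum_distrib_left[symmetric] sum_lessThan_telescope')
  also have "e * w n + e * (w 0 - w n) = e * w 0" by (simp add: algebra_simps)
  finally show ?thesis .
qed

text \<open>Abel's test for uniform convergence. Uniformity comes from the decreasing weights and
  not from absolute values, because the Laurent series may converge only conditionally at m and
  M.\<close>

lemma abel_uniform_limit:
  fixes d :: "nat \<Rightarrow> real" and w :: "nat \<Rightarrow> 'b \<Rightarrow> real"
  assumes d: "summable d" and w: "\<And>n t. t \<in> X \<Longrightarrow> w (Suc n) t \<le> w n t"
    "\<And>n t. t \<in> X \<Longrightarrow> 0 \<le> w n t" "\<And>n t. t \<in> X \<Longrightarrow> w n t \<le> 1"
  obtains f where "uniform_limit X (\<lambda>N t. \<Sum>n<N. d n * w n t) f sequentially"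
proof -
  have "\<exists>N. \<forall>i j t. N \<le> i \<and> N \<le> j \<and> t \<in> X \<longrightarrow>
       dist (\<Sum>n<i. d n * w n t) (\<Sum>n<j. d n * w n t) < e" if e: "0 < e" for e
  proof -
    obtain N where N: "\<And>i j. N \<le> i \<Longrightarrow> \<bar>sum d {i..<j}\<bar> < e / 2"
      using d e unfolding summable_Cauchy by (metis half_gt_zero real_norm_def)
    have main: "\<bar>(\<Sum>n<j. d n * w n t) - (\<Sum>n<i. d n * w n t)\<bar> \<le> e / 2"
      if ij: "N \<le> i" "i \<le> j" and t: "t \<in> X" for i j t
    proof -
      have "\<bar>\<Sum>n<j - i. d (i + n) * w (i + n) t\<bar> \<le> e / 2 * w (i + 0) t"
      proof (rule abel_partial_sum)
        fix n
        have "(\<Sum>j<n. d (i + j)) = sum d {i..<i + n}"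
          using sum.shift_bounds_nat_ivl[of d 0 i n] by (simp add: atLeast0LessThan add.commute)
        then show "\<bar>\<Sum>j<n. d (i + j)\<bar> \<le> e / 2" using N[OF ij(1), of "i + n"] by simp
      qed (use w t in auto)
      also have "\<dots> \<le> e / 2" using w(3)[OF t, of i] e by (simp add: mult_left_le)
      also have "(\<Sum>n<j - i. d (i + n) * w (i + n) t) = (\<Sum>n\<in>{i..<j}. d n * w n t)"
        using sum.shift_bounds_nat_ivl[of "\<lambda>n. d n * w n t" 0 i "j - i"] ij
        by (simp add: atLeast0LessThan add.commute)
      also have "\<dots> = (\<Sum>n<j. d n * w n t) - (\<Sum>n<i. d n * w n t)"
        using sum_diff_nat_ivl[of 0 i j "\<lambda>n. d n * w n t"] ij by (simp add: atLeast0LessThan)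
      finally show ?thesis .
    qed
    show ?thesis
    proof (intro exI allI impI)
      fix i j t assume *: "N \<le> i \<and> N \<le> j \<and> t \<in> X"
      show "dist (\<Sum>n<i. d n * w n t) (\<Sum>n<j. d n * w n t) < e"
        using main[of i j t] main[of j i t] * e
        by (cases "i \<le> j") (auto simp: dist_real_def abs_minus_commute)
    qed
  qed
  then obtain f where f: "\<forall>e>0. \<exists>N. \<forall>n t. N \<le> n \<and> t \<in> X \<longrightarrow> dist (\<Sum>j<n. d j * w j t) (f t) < e"
    using uniformly_convergent_eq_cauchy[of "\<lambda>t. t \<in> X" "\<lambda>N t. \<Sum>n<N. d n * w n t"] by blast
  then have "uniform_limit X (\<lambda>N t. \<Sum>n<N. d n * w n t) f sequentially"
    unfolding uniform_limit_sequentially_iff by blast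
  then show thesis by (rule that)
qed

text \<open>\<open>calc \<phi> S\<close> expresses that \<open>S = \<phi>(T)\<close>: \<open>S\<close> is close to the scalar \<open>\<phi> t\<close> on thin spectral slices near
  \<open>t\<close>.\<close>

context bounded_resolution
begin

definition calc :: "(real \<Rightarrow> real) \<Rightarrow> ('a \<Rightarrow>\<^sub>L 'a) \<Rightarrow> bool" where
  "calc \<phi> S \<longleftrightarrow> continuous_on {m..M} \<phi> \<and> (\<forall>x y. S x \<bullet> y = x \<bullet> S y) \<and>
     (\<forall>C :: 'a \<Rightarrow>\<^sub>L 'a. (\<forall>x. C (T x) = T (C x)) \<longrightarrow> (\<forall>x. C (S x) = S (C x))) \<and>
     (\<forall>\<epsilon>>0. \<exists>\<delta>>0. \<forall>s r t x. s < r \<longrightarrow> t \<in> {m..M} \<longrightarrow> \<bar>s - t\<bar> \<le> \<delta> \<longrightarrow> \<bar>r - t\<bar> \<le> \<delta> \<longrightarrow>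
        norm (S (slice s r x) - \<phi> t *\<^sub>R slice s r x) \<le> \<epsilon> * norm (slice s r x))"

lemma calcI:
  fixes S :: "'a \<Rightarrow>\<^sub>L 'a"
  assumes "continuous_on {m..M} \<phi>" "\<And>x y. S x \<bullet> y = x \<bullet> S y"
    "\<And>(C :: 'a \<Rightarrow>\<^sub>L 'a) x. (\<And>x. C (T x) = T (C x)) \<Longrightarrow> C (S x) = S (C x)"
    "\<And>\<epsilon>. 0 < \<epsilon> \<Longrightarrow> \<exists>\<delta>>0. \<forall>s r t x. s < r \<longrightarrow> t \<in> {m..M} \<longrightarrow> \<bar>s - t\<bar> \<le> \<delta> \<longrightarrow> \<bar>r - t\<bar> \<le> \<delta> \<longrightarrow>
        norm (S (slice s r x) - \<phi> t *\<^sub>R slice s r x) \<le> \<epsilon> * norm (slice s r x)"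
  shows "calc \<phi> S"
  using assms unfolding calc_def by blast

lemma calcD:
  fixes S C :: "'a \<Rightarrow>\<^sub>L 'a"
  assumes "calc \<phi> S"
  shows "continuous_on {m..M} \<phi>" "S x \<bullet> y = x \<bullet> S y"
    "(\<And>x. C (T x) = T (C x)) \<Longrightarrow> C (S x) = S (C x)"
  using assms unfolding calc_def by blast+

lemma calc_slice:
  fixes S :: "'a \<Rightarrow>\<^sub>L 'a"
  assumes "calc \<phi> S" "0 < \<epsilon>"
  obtains \<delta> where "0 < \<delta>"
    "\<And>s r t x. s < r \<Longrightarrow> t \<in> {m..M} \<Longrightarrow> \<bar>s - t\<bar> \<le> \<delta> \<Longrightarrow> \<bar>r - t\<bar> \<le> \<delta> \<Longrightarrow>
        norm (S (slice s r x) - \<phi> t *\<^sub>R slice s r x) \<le> \<epsilon> * norm (slice s r x)"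
proof -
  have "\<exists>\<delta>>0. \<forall>s r t x. s < r \<longrightarrow> t \<in> {m..M} \<longrightarrow> \<bar>s - t\<bar> \<le> \<delta> \<longrightarrow> \<bar>r - t\<bar> \<le> \<delta> \<longrightarrow>
        norm (S (slice s r x) - \<phi> t *\<^sub>R slice s r x) \<le> \<epsilon> * norm (slice s r x)"
    using assms unfolding calc_def by blast
  then show thesis using that by blast
qed

lemma calc_cong:
  assumes "calc \<phi> S" "\<And>t. t \<in> {m..M} \<Longrightarrow> \<phi> t = \<psi> t"
  shows "calc \<psi> S"
proof (rule calcI)
  show "continuous_on {m..M} \<psi>"
    by (rule continuous_on_eq[OF calcD(1)[OF assms(1)] assms(2)])
  show "\<exists>\<delta>>0. \<forall>s r t x. s < r \<longrightarrow> t \<in> {m..M} \<longrightarrow> \<bar>s - t\<bar> \<le> \<delta> \<longrightarrow> \<bar>r - t\<bar> \<le> \<delta> \<longrightarrow>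
        norm (S (slice s r x) - \<psi> t *\<^sub>R slice s r x) \<le> \<epsilon> * norm (slice s r x)" if "0 < \<epsilon>" for \<epsilon>
    using calc_slice[OF assms(1) that] assms(2) by metis
qed (use calcD[OF assms(1)] in blast)+

section \<open>Algebraic rules of the calculus\<close>

lemma calc_const: "calc (\<lambda>_. c) (c *\<^sub>R id_blinfun)"
  by (rule calcI) (auto simp: blinfun.scaleR_left blinfun.scaleR_right intro!: exI[of _ 1])

lemma calc_id: "calc (\<lambda>t. t) T"
proof (rule calcI)
  fix \<epsilon> :: real assume \<epsilon>: "0 < \<epsilon>"
  show "\<exists>\<delta>>0. \<forall>s r t x. s < r \<longrightarrow> t \<in> {m..M} \<longrightarrow> \<bar>s - t\<bar> \<le> \<delta> \<longrightarrow> \<bar>r - t\<bar> \<le> \<delta> \<longrightarrow>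
        norm (T (slice s r x) - t *\<^sub>R slice s r x) \<le> \<epsilon> * norm (slice s r x)"
  proof (intro exI[of _ "\<epsilon> / 3"] conjI allI impI)
    fix s r t x assume *: "s < r" "\<bar>s - t\<bar> \<le> \<epsilon> / 3" "\<bar>r - t\<bar> \<le> \<epsilon> / 3"
    let ?x = "slice s r x"
    have "T ?x - t *\<^sub>R ?x = (T ?x - r *\<^sub>R ?x) + (r - t) *\<^sub>R ?x" by (simp add: algebra_simps)
    then have "norm (T ?x - t *\<^sub>R ?x) \<le> norm (T ?x - r *\<^sub>R ?x) + \<bar>r - t\<bar> * norm ?x"
      by (metis norm_scaleR norm_triangle_ineq)
    also have "\<dots> \<le> (r - s) * norm ?x + \<bar>r - t\<bar> * norm ?x"
      using slice_le[OF *(1), of r x] by simp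
    also have "\<dots> = (r - s + \<bar>r - t\<bar>) * norm ?x" by (simp add: algebra_simps)
    also have "\<dots> \<le> \<epsilon> * norm ?x" using * by (intro mult_right_mono norm_ge_zero) linarith
    finally show "norm (T ?x - t *\<^sub>R ?x) \<le> \<epsilon> * norm ?x" .
  qed (use \<epsilon> in simp)
qed (auto simp: T_sym)

lemma calc_add:
  assumes "calc \<phi> S" "calc \<psi> R"
  shows "calc (\<lambda>t. \<phi> t + \<psi> t) (S + R)"
proof (rule calcI)
  show "continuous_on {m..M} (\<lambda>t. \<phi> t + \<psi> t)"
    by (intro continuous_intros calcD(1)[OF assms(1)] calcD(1)[OF assms(2)])
  show "(S + R) x \<bullet> y = x \<bullet> (S + R) y" for x y
    by (simp add: blinfun.add_left inner_add_left inner_add_right calcD(2)[OF assms(1)] calcD(2)[OF assms(2)])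
  show "C ((S + R) x) = (S + R) (C x)" if "\<And>x. C (T x) = T (C x)" for C :: "'a \<Rightarrow>\<^sub>L 'a" and x
    by (simp add: blinfun.add_left blinfun.add_right calcD(3)[OF assms(1) that] calcD(3)[OF assms(2) that])
  fix \<epsilon> :: real assume "0 < \<epsilon>"
  then have \<epsilon>: "0 < \<epsilon> / 2" by simp
  obtain d1 where d1: "0 < d1"
    "\<And>s r t x. s < r \<Longrightarrow> t \<in> {m..M} \<Longrightarrow> \<bar>s - t\<bar> \<le> d1 \<Longrightarrow> \<bar>r - t\<bar> \<le> d1 \<Longrightarrow>
        norm (S (slice s r x) - \<phi> t *\<^sub>R slice s r x) \<le> \<epsilon> / 2 * norm (slice s r x)"
    using calc_slice[OF assms(1) \<epsilon>] by blast
  obtain d2 where d2: "0 < d2"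
    "\<And>s r t x. s < r \<Longrightarrow> t \<in> {m..M} \<Longrightarrow> \<bar>s - t\<bar> \<le> d2 \<Longrightarrow> \<bar>r - t\<bar> \<le> d2 \<Longrightarrow>
        norm (R (slice s r x) - \<psi> t *\<^sub>R slice s r x) \<le> \<epsilon> / 2 * norm (slice s r x)"
    using calc_slice[OF assms(2) \<epsilon>] by blast
  show "\<exists>\<delta>>0. \<forall>s r t x. s < r \<longrightarrow> t \<in> {m..M} \<longrightarrow> \<bar>s - t\<bar> \<le> \<delta> \<longrightarrow> \<bar>r - t\<bar> \<le> \<delta> \<longrightarrow>
        norm ((S + R) (slice s r x) - (\<phi> t + \<psi> t) *\<^sub>R slice s r x) \<le> \<epsilon> * norm (slice s r x)"
  proof (intro exI[of _ "min d1 d2"] conjI allI impI)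
    fix s r t x assume *: "s < r" "t \<in> {m..M}" "\<bar>s - t\<bar> \<le> min d1 d2" "\<bar>r - t\<bar> \<le> min d1 d2"
    let ?x = "slice s r x"
    have "(S + R) ?x - (\<phi> t + \<psi> t) *\<^sub>R ?x = (S ?x - \<phi> t *\<^sub>R ?x) + (R ?x - \<psi> t *\<^sub>R ?x)"
      by (simp add: blinfun.add_left algebra_simps)
    then have "norm ((S + R) ?x - (\<phi> t + \<psi> t) *\<^sub>R ?x) \<le> norm (S ?x - \<phi> t *\<^sub>R ?x) + norm (R ?x - \<psi> t *\<^sub>R ?x)"
      by (metis norm_triangle_ineq)
    also have "\<dots> \<le> \<epsilon> / 2 * norm ?x + \<epsilon> / 2 * norm ?x"
      using * by (intro add_mono d1 d2) auto
    finally show "norm ((S + R) ?x - (\<phi> t + \<psi> t) *\<^sub>R ?x) \<le> \<epsilon> * norm ?x" by (simp add: field_simps)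
  qed (use d1 d2 in simp)
qed

lemma calc_bounded:
  assumes "calc \<phi> S"
  obtains K where "0 \<le> K" "\<And>t. t \<in> {m..M} \<Longrightarrow> \<bar>\<phi> t\<bar> \<le> K"
proof -
  have "bounded (\<phi> ` {m..M})"
    using calcD(1)[OF assms] by (intro compact_imp_bounded compact_continuous_image) auto
  then obtain K where K: "\<forall>x\<in>\<phi> ` {m..M}. norm x \<le> K" by (auto simp only: bounded_iff)
  show thesis
  proof (rule that[of "\<bar>K\<bar>"])
    show "\<bar>\<phi> t\<bar> \<le> \<bar>K\<bar>" if "t \<in> {m..M}" for t
      using K that by (metis abs_ge_self image_eqI order_trans real_norm_def)
  qed simp
qed

text \<open>The commutant clause of \<open>calc\<close> is used twice: T commutes with itself, so S
  commutes with T, and therefore with R.\<close>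

lemma calc_commute:
  fixes S R :: "'a \<Rightarrow>\<^sub>L 'a"
  assumes "calc \<phi> S" "calc \<psi> R"
  shows "S (R x) = R (S x)"
proof (rule calcD(3)[OF assms(2)])
  show "S (T x) = T (S x)" for x using calcD(3)[OF assms(1), of T x] by simp
qed

lemma calc_mult:
  assumes "calc \<phi> S" "calc \<psi> R"
  shows "calc (\<lambda>t. \<phi> t * \<psi> t) (S o\<^sub>L R)"
proof (rule calcI)
  show "continuous_on {m..M} (\<lambda>t. \<phi> t * \<psi> t)"
    by (intro continuous_intros calcD(1)[OF assms(1)] calcD(1)[OF assms(2)])
  show "(S o\<^sub>L R) x \<bullet> y = x \<bullet> (S o\<^sub>L R) y" for x y
    by (simp add: calcD(2)[OF assms(1)] calcD(2)[OF assms(2)] calc_commute[OF assms])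
  show "C ((S o\<^sub>L R) x) = (S o\<^sub>L R) (C x)" if "\<And>x. C (T x) = T (C x)" for C :: "'a \<Rightarrow>\<^sub>L 'a" and x
    by (simp add: calcD(3)[OF assms(1) that] calcD(3)[OF assms(2) that])
  obtain K where K: "0 \<le> K" "\<And>t. t \<in> {m..M} \<Longrightarrow> \<bar>\<psi> t\<bar> \<le> K" using calc_bounded[OF assms(2)] by blast
  fix \<epsilon> :: real assume \<epsilon>: "0 < \<epsilon>"
  \<comment> \<open>The error of R is amplified by \<open>norm S\<close>, that of S by K; the
    summand 1 keeps the denominator positive.\<close>
  define \<epsilon>' where "\<epsilon>' = \<epsilon> / (norm S + K + 1)"
  have \<epsilon>': "0 < \<epsilon>'" using \<epsilon> K by (simp add: \<epsilon>'_def add_nonneg_pos)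
  obtain d1 where d1: "0 < d1"
    "\<And>s r t x. s < r \<Longrightarrow> t \<in> {m..M} \<Longrightarrow> \<bar>s - t\<bar> \<le> d1 \<Longrightarrow> \<bar>r - t\<bar> \<le> d1 \<Longrightarrow>
        norm (S (slice s r x) - \<phi> t *\<^sub>R slice s r x) \<le> \<epsilon>' * norm (slice s r x)"
    using calc_slice[OF assms(1) \<epsilon>'] by blast
  obtain d2 where d2: "0 < d2"
    "\<And>s r t x. s < r \<Longrightarrow> t \<in> {m..M} \<Longrightarrow> \<bar>s - t\<bar> \<le> d2 \<Longrightarrow> \<bar>r - t\<bar> \<le> d2 \<Longrightarrow>
        norm (R (slice s r x) - \<psi> t *\<^sub>R slice s r x) \<le> \<epsilon>' * norm (slice s r x)"
    using calc_slice[OF assms(2) \<epsilon>'] by blast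
  show "\<exists>\<delta>>0. \<forall>s r t x. s < r \<longrightarrow> t \<in> {m..M} \<longrightarrow> \<bar>s - t\<bar> \<le> \<delta> \<longrightarrow> \<bar>r - t\<bar> \<le> \<delta> \<longrightarrow>
        norm ((S o\<^sub>L R) (slice s r x) - (\<phi> t * \<psi> t) *\<^sub>R slice s r x) \<le> \<epsilon> * norm (slice s r x)"
  proof (intro exI[of _ "min d1 d2"] conjI allI impI)
    fix s r t x assume *: "s < r" "t \<in> {m..M}" "\<bar>s - t\<bar> \<le> min d1 d2" "\<bar>r - t\<bar> \<le> min d1 d2"
    let ?x = "slice s r x"
    have "(S o\<^sub>L R) ?x - (\<phi> t * \<psi> t) *\<^sub>R ?x = S (R ?x - \<psi> t *\<^sub>R ?x) + \<psi> t *\<^sub>R (S ?x - \<phi> t *\<^sub>R ?x)"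
      by (simp add: blinfun.diff_right blinfun.scaleR_right algebra_simps)
    then have "norm ((S o\<^sub>L R) ?x - (\<phi> t * \<psi> t) *\<^sub>R ?x)
        \<le> norm (S (R ?x - \<psi> t *\<^sub>R ?x)) + \<bar>\<psi> t\<bar> * norm (S ?x - \<phi> t *\<^sub>R ?x)"
      by (metis norm_scaleR norm_triangle_ineq)
    also have "\<dots> \<le> norm S * (\<epsilon>' * norm ?x) + K * (\<epsilon>' * norm ?x)"
    proof (intro add_mono mult_mono K)
      show "norm (S (R ?x - \<psi> t *\<^sub>R ?x)) \<le> norm S * (\<epsilon>' * norm ?x)"
        using * by (intro order_trans[OF norm_blinfun] mult_left_mono d2) auto
      show "norm (S ?x - \<phi> t *\<^sub>R ?x) \<le> \<epsilon>' * norm ?x" using * by (intro d1) auto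
    qed (use * K in auto)
    also have "\<dots> \<le> (norm S + K + 1) * \<epsilon>' * norm ?x"
      using \<epsilon>' by (simp add: algebra_simps)
    also have "\<dots> = \<epsilon> * norm ?x"
    proof -
      have "norm S + K + 1 > 0" using K by (simp add: add_nonneg_pos)
      then show ?thesis by (simp add: \<epsilon>'_def)
    qed
    finally show "norm ((S o\<^sub>L R) ?x - (\<phi> t * \<psi> t) *\<^sub>R ?x) \<le> \<epsilon> * norm ?x" .
  qed (use d1 d2 in simp)
qed

lemma calc_scaleR:
  assumes "calc \<phi> S"
  shows "calc (\<lambda>t. c * \<phi> t) (c *\<^sub>R S)"
proof -
  have "(c *\<^sub>R id_blinfun) o\<^sub>L S = c *\<^sub>R S" by (rule blinfun_eqI) (simp add: blinfun.scaleR_left)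
  then show ?thesis using calc_mult[OF calc_const[of c] assms] by simp
qed

lemma calc_diff: "calc \<phi> S \<Longrightarrow> calc \<psi> R \<Longrightarrow> calc (\<lambda>t. \<phi> t - \<psi> t) (S - R)"
  using calc_add[OF _ calc_scaleR[of \<psi> R "- 1"], of \<phi> S] by simp

lemma calc_sum:
  fixes N :: nat
  assumes "\<And>n. calc (\<phi> n) (S n)"
  shows "calc (\<lambda>t. \<Sum>n<N. \<phi> n t) (\<Sum>n<N. S n)"
proof (induction N)
  case 0
  then show ?case using calc_const[of 0] by simp
next
  case (Suc N)
  then show ?case using calc_add[OF Suc assms[of N]] by simp
qed

lemma calc_power: "calc \<phi> S \<Longrightarrow> calc (\<lambda>t. \<phi> t ^ n) (op_power S n)"
proof (induction n)
  case 0
  then show ?case using calc_const[of 1] by (simp add: op_power_def)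
next
  case (Suc n)
  then show ?case using calc_mult[OF Suc.prems Suc.IH] by (simp add: op_power_def)
qed

section \<open>Form and norm bounds by partition of the spectrum\<close>

lemma F_below: "s < m \<Longrightarrow> F s x = 0"
proof -
  assume s: "s < m"
  have "(m - s) * (F s x \<bullet> F s x) \<le> 0"
    using T_ge[of "F s x"] F_upper[of s x] by (simp add: algebra_simps)
  then have "F s x \<bullet> F s x \<le> 0" using s by (simp add: mult_le_0_iff)
  then show ?thesis by (meson inner_eq_zero_iff inner_ge_zero order_antisym)
qed

lemma F_above: "M < s \<Longrightarrow> F s x = x"
proof -
  assume s: "M < s"
  have "(s - M) * ((x - F s x) \<bullet> (x - F s x)) \<le> 0"
    using T_le[of "x - F s x"] F_lower[of s x] by (simp add: left_diff_distrib)
  then have "(x - F s x) \<bullet> (x - F s x) \<le> 0" using s by (simp add: mult_le_0_iff)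
  then have "x - F s x = 0" by (meson inner_eq_zero_iff inner_ge_zero order_antisym)
  then show ?thesis by simp
qed

text \<open>S is almost scalar on each slice of a fine partition. The slices are orthogonal and S
  commutes with every \<open>F s\<close>, so the forms add up without cross terms.\<close>

lemma calc_lower:
  fixes S :: "'a \<Rightarrow>\<^sub>L 'a"
  assumes calc: "calc \<phi> S" and C: "\<And>t. t \<in> {m..M} \<Longrightarrow> C \<le> \<phi> t"
  shows "C * (x \<bullet> x) \<le> S x \<bullet> x"
proof -
  have approx: "(C - \<epsilon>) * (x \<bullet> x) \<le> S x \<bullet> x" if \<epsilon>: "0 < \<epsilon>" for \<epsilon>
  proof -
    obtain h where h: "0 < h"
      "\<And>s r t x. s < r \<Longrightarrow> t \<in> {m..M} \<Longrightarrow> \<bar>s - t\<bar> \<le> h \<Longrightarrow> \<bar>r - t\<bar> \<le> h \<Longrightarrow>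
        norm (S (slice s r x) - \<phi> t *\<^sub>R slice s r x) \<le> \<epsilon> * norm (slice s r x)"
      using calc_slice[OF calc \<epsilon>] by blast
    \<comment> \<open>The grid starts at m - h because \<open>F m\<close> may be nonzero, and it has
      to pass M because \<open>F\<close> is known to be the identity only beyond M.\<close>
    define p where "p i = m - h + real i * h" for i
    have form: "p i \<le> M + h \<Longrightarrow> (C - \<epsilon>) * (F (p i) x \<bullet> F (p i) x) \<le> S (F (p i) x) \<bullet> F (p i) x" for i
    proof (induction i)
      case 0
      then show ?case using h by (simp add: p_def F_below)
    next
      case (Suc i)
      let ?s = "p i" and ?r = "p (Suc i)"
      have sr: "?r = ?s + h" by (simp add: p_def algebra_simps)
      have ms: "m \<le> ?r" using h by (simp add: p_def)
      \<comment> \<open>The first slice starts below m, so its sample point is moved up to m. The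
        premise \<open>p (Suc i) \<le> M + h\<close> keeps the sample point at most M.\<close>
      define t where "t = max m ?s"
      have t: "t \<in> {m..M}" "\<bar>?s - t\<bar> \<le> h" "\<bar>?r - t\<bar> \<le> h"
        using Suc.prems sr ms h m_less_M by (auto simp: t_def max_def)
      define k where "k = slice ?s ?r x"
      define f where "f = F ?s x"
      have Fr: "F ?r x = f + k" by (simp add: k_def f_def slice_apply)
      have Fk: "F ?s k = 0" using sr h by (simp add: k_def F_slice)
      have fk: "f \<bullet> k = 0" by (simp add: f_def F_sym Fk)
      \<comment> \<open>S commutes with \<open>F ?s\<close>, since \<open>F ?s\<close> commutes with
        T; so S f stays in the range of \<open>F ?s\<close>, which is orthogonal to the
        slice.\<close>
      have "S f \<bullet> k = F ?s (S x) \<bullet> k"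
        unfolding f_def using calcD(3)[OF calc, of "F ?s" x] F_T by simp
      then have Sfk: "S f \<bullet> k = 0" by (simp add: F_sym Fk)
      then have Skf: "S k \<bullet> f = 0" by (metis calcD(2)[OF calc] inner_commute)
      have "\<phi> t * (k \<bullet> k) - S k \<bullet> k = - ((S k - \<phi> t *\<^sub>R k) \<bullet> k)" by (simp add: inner_diff_left)
      also have "\<dots> \<le> norm (S k - \<phi> t *\<^sub>R k) * norm k"
        by (metis inner_minus_left norm_cauchy_schwarz norm_minus_cancel)
      also have "\<dots> \<le> \<epsilon> * norm k * norm k"
        unfolding k_def using t sr h by (intro mult_right_mono h(2)) auto
      also have "\<dots> = \<epsilon> * (k \<bullet> k)" by (simp add: dot_square_norm power2_eq_square)
      finally have "\<phi> t * (k \<bullet> k) - S k \<bullet> k \<le> \<epsilon> * (k \<bullet> k)" .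
      moreover have "C * (k \<bullet> k) \<le> \<phi> t * (k \<bullet> k)" using C[OF t(1)] by (intro mult_right_mono) auto
      ultimately have "(C - \<epsilon>) * (k \<bullet> k) \<le> S k \<bullet> k" by (simp add: algebra_simps)
      moreover have "(C - \<epsilon>) * (f \<bullet> f) \<le> S f \<bullet> f"
        unfolding f_def using Suc sr h by simp
      ultimately show ?case unfolding Fr
        by (simp add: inner_add_left inner_add_right blinfun.add_right fk inner_commute[of k f] Sfk Skf
            distrib_left)
    qed
    \<comment> \<open>The added 1 makes the inequality \<open>M < p i\<close> strict, so that
      \<open>F (p i)\<close> is the identity, while p i still does not exceed M + h.\<close>
    define i where "i = nat (\<lfloor>(M - m + h) / h\<rfloor> + 1)"
    have "0 \<le> (M - m + h) / h" using h m_less_M by simp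
    then have i: "real i = of_int \<lfloor>(M - m + h) / h\<rfloor> + 1" by (simp add: i_def)
    have "(M - m + h) / h < real i" "real i \<le> (M - m + h) / h + 1" unfolding i by linarith+
    then have "M - m + h < real i * h" "real i * h \<le> M - m + h + h"
      using h by (simp_all add: field_simps)
    then have "M < p i" "p i \<le> M + h" by (simp_all add: p_def)
    then show ?thesis using form[of i] by (simp add: F_above)
  qed
  have "C * (x \<bullet> x) \<le> S x \<bullet> x + e" if e: "0 < e" for e
  proof -
    have pos: "0 < x \<bullet> x + 1" by (simp add: add_nonneg_pos)
    have "(C - e / (x \<bullet> x + 1)) * (x \<bullet> x) \<le> S x \<bullet> x" using e pos by (intro approx) simp
    moreover have "e / (x \<bullet> x + 1) * (x \<bullet> x) \<le> e" using e pos by (simp add: field_simps)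
    ultimately show ?thesis by (simp add: algebra_simps)
  qed
  then show ?thesis by (rule field_le_epsilon)
qed

text \<open>The operator C^2 - S^2 has a nonnegative symbol, and its form at x is C^2 times the
  squared norm of x minus the squared norm of S x.\<close>

lemma calc_norm_le:
  fixes S :: "'a \<Rightarrow>\<^sub>L 'a"
  assumes "calc \<phi> S" "\<And>t. t \<in> {m..M} \<Longrightarrow> \<bar>\<phi> t\<bar> \<le> C" "0 \<le> C"
  shows "norm (S x) \<le> C * norm x"
proof (rule power2_le_imp_le)
  have "0 * (x \<bullet> x) \<le> (C\<^sup>2 *\<^sub>R id_blinfun - (S o\<^sub>L S)) x \<bullet> x"
  proof (rule calc_lower[OF calc_diff[OF calc_const calc_mult[OF assms(1) assms(1)]]])
    fix t assume "t \<in> {m..M}"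
    then have "\<bar>\<phi> t\<bar>\<^sup>2 \<le> C\<^sup>2" using assms(2) by (intro power_mono) auto
    then show "0 \<le> C\<^sup>2 - \<phi> t * \<phi> t" by (simp add: power2_eq_square)
  qed
  then show "(norm (S x))\<^sup>2 \<le> (C * norm x)\<^sup>2"
    by (simp add: blinfun.diff_left blinfun.scaleR_left inner_diff_left calcD(2)[OF assms(1)]
        power_mult_distrib power2_norm_eq_inner)
qed (use assms in simp)

text \<open>With this, operator identities such as those for the inverse and the square root can be
  checked on symbols.\<close>

lemma calc_unique:
  fixes S R :: "'a \<Rightarrow>\<^sub>L 'a"
  assumes "calc \<phi> S" "calc \<phi> R"
  shows "S = R"
proof (rule blinfun_eqI)
  fix x
  have "norm ((S - R) x) \<le> 0 * norm x"
    by (rule calc_norm_le[OF calc_diff[OF assms]]) auto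
  then show "S x = R x" by (simp add: blinfun.diff_left)
qed

text \<open>The second clause speaks of everything commuting with S, a larger class than the
  commutant of T. It is needed for a rival square root of S, of which only commutation with S is
  known.\<close>

lemma calc_polynomial:
  assumes "real_polynomial_function p" "calc \<phi> S"
  shows "\<exists>R. calc (\<lambda>t. p (\<phi> t)) R \<and>
    (\<forall>C :: 'a \<Rightarrow>\<^sub>L 'a. (\<forall>x. C (S x) = S (C x)) \<longrightarrow> (\<forall>x. C (R x) = R (C x)))"
  using assms(1)
proof induction
  case (linear f)
  have "f t = f 1 * t" for t :: real
    using linear_scale[OF bounded_linear.linear[OF linear], of t 1] by (simp add: mult.commute)
  then have "(\<lambda>t. f (\<phi> t)) = (\<lambda>t. f 1 * \<phi> t)" by blast
  then show ?case
    using calc_scaleR[OF assms(2), of "f 1"]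
    by (auto simp: blinfun.scaleR_left blinfun.scaleR_right intro!: exI[of _ "f 1 *\<^sub>R S"])
next
  case (const c)
  then show ?case
    using calc_const[of c]
    by (auto simp: blinfun.scaleR_left blinfun.scaleR_right intro!: exI[of _ "c *\<^sub>R id_blinfun"])
next
  case (add f g)
  then obtain R1 R2 where R:
    "calc (\<lambda>t. f (\<phi> t)) R1" "\<forall>C :: 'a \<Rightarrow>\<^sub>L 'a. (\<forall>x. C (S x) = S (C x)) \<longrightarrow> (\<forall>x. C (R1 x) = R1 (C x))"
    "calc (\<lambda>t. g (\<phi> t)) R2" "\<forall>C :: 'a \<Rightarrow>\<^sub>L 'a. (\<forall>x. C (S x) = S (C x)) \<longrightarrow> (\<forall>x. C (R2 x) = R2 (C x))"
    by blast
  show ?case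
  proof (intro exI conjI allI impI)
    show "calc (\<lambda>t. f (\<phi> t) + g (\<phi> t)) (R1 + R2)" by (rule calc_add[OF R(1,3)])
    show "C ((R1 + R2) x) = (R1 + R2) (C x)" if "\<forall>x. C (S x) = S (C x)" for C :: "'a \<Rightarrow>\<^sub>L 'a" and x
    proof -
      have "C (R1 w) = R1 (C w)" "C (R2 w) = R2 (C w)" for w
        using R(2)[THEN spec, THEN mp, OF that] R(4)[THEN spec, THEN mp, OF that] by blast+
      then show ?thesis by (simp add: blinfun.add_left blinfun.add_right)
    qed
  qed
next
  case (mult f g)
  then obtain R1 R2 where R:
    "calc (\<lambda>t. f (\<phi> t)) R1" "\<forall>C :: 'a \<Rightarrow>\<^sub>L 'a. (\<forall>x. C (S x) = S (C x)) \<longrightarrow> (\<forall>x. C (R1 x) = R1 (C x))"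
    "calc (\<lambda>t. g (\<phi> t)) R2" "\<forall>C :: 'a \<Rightarrow>\<^sub>L 'a. (\<forall>x. C (S x) = S (C x)) \<longrightarrow> (\<forall>x. C (R2 x) = R2 (C x))"
    by blast
  show ?case
  proof (intro exI conjI allI impI)
    show "calc (\<lambda>t. f (\<phi> t) * g (\<phi> t)) (R1 o\<^sub>L R2)" by (rule calc_mult[OF R(1,3)])
    show "C ((R1 o\<^sub>L R2) x) = (R1 o\<^sub>L R2) (C x)" if "\<forall>x. C (S x) = S (C x)" for C :: "'a \<Rightarrow>\<^sub>L 'a" and x
    proof -
      have "C (R1 w) = R1 (C w)" "C (R2 w) = R2 (C w)" for w
        using R(2)[THEN spec, THEN mp, OF that] R(4)[THEN spec, THEN mp, OF that] by blast+
      then show ?thesis by simp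
    qed
  qed
qed

end

section \<open>Limits, inverse, Laurent series and square root in the calculus\<close>

locale hilbert_resolution = bounded_resolution T F m M
  for T :: "'a::{real_inner, complete_space} \<Rightarrow>\<^sub>L 'a" and F m M
begin

text \<open>\<open>calc_norm_le\<close> bounds operator norms by sup norms of symbols, so the
  operators form a Cauchy sequence; the slice estimate survives the limit by splitting the error
  into three parts.\<close>

lemma calc_limit:
  assumes calc: "\<And>n. calc (\<phi> n) (S n)" and lim: "uniform_limit {m..M} \<phi> \<psi> sequentially"
  obtains R where "S \<longlonglongrightarrow> R" "calc \<psi> R"
proof -
  have unif: "\<exists>N. \<forall>n\<ge>N. \<forall>t\<in>{m..M}. \<bar>\<phi> n t - \<psi> t\<bar> < e" if "0 < e" for e
    using uniform_limitD[OF lim that] unfolding eventually_sequentially dist_real_def .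
  have "Cauchy S"
  proof (rule CauchyI)
    fix e :: real assume e: "0 < e"
    then have "0 < e / 4" by simp
    from unif[OF this] obtain N where N: "\<And>n t. N \<le> n \<Longrightarrow> t \<in> {m..M} \<Longrightarrow> \<bar>\<phi> n t - \<psi> t\<bar> < e / 4"
      by blast
    show "\<exists>N. \<forall>i\<ge>N. \<forall>j\<ge>N. norm (S i - S j) < e"
    proof (intro exI allI impI)
      fix i j assume ij: "N \<le> i" "N \<le> j"
      have "norm (S i - S j) \<le> e / 2"
      proof (rule norm_blinfun_bound)
        show "norm ((S i - S j) x) \<le> e / 2 * norm x" for x
        proof (rule calc_norm_le[OF calc_diff[OF calc calc]])
          fix t assume t: "t \<in> {m..M}"
          show "\<bar>\<phi> i t - \<phi> j t\<bar> \<le> e / 2" using N[OF ij(1) t] N[OF ij(2) t] by linarith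
        qed (use e in simp)
      qed (use e in simp)
      then show "norm (S i - S j) < e" using e by simp
    qed
  qed
  then obtain R where R: "S \<longlonglongrightarrow> R"
    using blinfun_Cauchy_convergent convergentD by blast
  have Rx: "(\<lambda>n. S n x) \<longlonglongrightarrow> R x" for x
    using R by (intro tendsto_intros)
  have "calc \<psi> R"
  proof (rule calcI)
    show "continuous_on {m..M} \<psi>"
      by (rule uniform_limit_theorem[OF always_eventually lim]) (simp_all add: calcD(1)[OF calc])
    show "R x \<bullet> y = x \<bullet> R y" for x y
    proof (rule LIMSEQ_unique)
      show "(\<lambda>n. S n x \<bullet> y) \<longlonglongrightarrow> R x \<bullet> y" by (intro tendsto_intros Rx)
      show "(\<lambda>n. S n x \<bullet> y) \<longlonglongrightarrow> x \<bullet> R y"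
        unfolding calcD(2)[OF calc] by (intro tendsto_intros Rx)
    qed
    show "C (R x) = R (C x)" if C: "\<And>x. C (T x) = T (C x)" for C :: "'a \<Rightarrow>\<^sub>L 'a" and x
    proof (rule LIMSEQ_unique)
      show "(\<lambda>n. C (S n x)) \<longlonglongrightarrow> C (R x)" by (intro tendsto_intros Rx)
      show "(\<lambda>n. C (S n x)) \<longlonglongrightarrow> R (C x)" unfolding calcD(3)[OF calc C] by (rule Rx)
    qed
    fix \<epsilon> :: real assume "0 < \<epsilon>"
    then have \<epsilon>: "0 < \<epsilon> / 3" by simp
    obtain n1 where n1: "\<And>n t. n1 \<le> n \<Longrightarrow> t \<in> {m..M} \<Longrightarrow> \<bar>\<phi> n t - \<psi> t\<bar> < \<epsilon> / 3"
      using unif[OF \<epsilon>] by blast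
    obtain n2 where n2: "\<And>n. n2 \<le> n \<Longrightarrow> norm (S n - R) < \<epsilon> / 3"
      using LIMSEQ_D[OF R \<epsilon>] by blast
    define n where "n = max n1 n2"
    have n: "n1 \<le> n" "n2 \<le> n" by (auto simp: n_def)
    obtain d where d: "0 < d"
      "\<And>s r t x. s < r \<Longrightarrow> t \<in> {m..M} \<Longrightarrow> \<bar>s - t\<bar> \<le> d \<Longrightarrow> \<bar>r - t\<bar> \<le> d \<Longrightarrow>
        norm (S n (slice s r x) - \<phi> n t *\<^sub>R slice s r x) \<le> \<epsilon> / 3 * norm (slice s r x)"
      using calc_slice[OF calc[of n] \<epsilon>] by blast
    show "\<exists>\<delta>>0. \<forall>s r t x. s < r \<longrightarrow> t \<in> {m..M} \<longrightarrow> \<bar>s - t\<bar> \<le> \<delta> \<longrightarrow> \<bar>r - t\<bar> \<le> \<delta> \<longrightarrow>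
        norm (R (slice s r x) - \<psi> t *\<^sub>R slice s r x) \<le> \<epsilon> * norm (slice s r x)"
    proof (intro exI[of _ d] conjI allI impI)
      fix s r t x assume *: "s < r" "t \<in> {m..M}" "\<bar>s - t\<bar> \<le> d" "\<bar>r - t\<bar> \<le> d"
      let ?x = "slice s r x"
      have "R ?x - \<psi> t *\<^sub>R ?x = (S n ?x - \<phi> n t *\<^sub>R ?x) + (\<phi> n t - \<psi> t) *\<^sub>R ?x - (S n - R) ?x"
        by (simp add: blinfun.diff_left algebra_simps)
      then have "norm (R ?x - \<psi> t *\<^sub>R ?x)
          \<le> norm (S n ?x - \<phi> n t *\<^sub>R ?x) + norm ((\<phi> n t - \<psi> t) *\<^sub>R ?x) + norm ((S n - R) ?x)"
        by (simp only: order_trans[OF norm_triangle_ineq4 add_right_mono[OF norm_triangle_ineq]])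
      also have "\<dots> \<le> \<epsilon> / 3 * norm ?x + \<epsilon> / 3 * norm ?x + \<epsilon> / 3 * norm ?x"
      proof (intro add_mono)
        show "norm (S n ?x - \<phi> n t *\<^sub>R ?x) \<le> \<epsilon> / 3 * norm ?x" using * by (intro d)
        show "norm ((\<phi> n t - \<psi> t) *\<^sub>R ?x) \<le> \<epsilon> / 3 * norm ?x"
          unfolding norm_scaleR using n1[OF n(1) *(2)] by (intro mult_right_mono) auto
        show "norm ((S n - R) ?x) \<le> \<epsilon> / 3 * norm ?x"
          using n2[OF n(2)] by (intro order_trans[OF norm_blinfun] mult_right_mono) auto
      qed
      also have "\<dots> = \<epsilon> * norm ?x" by simp
      finally show "norm (R ?x - \<psi> t *\<^sub>R ?x) \<le> \<epsilon> * norm ?x" .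
    qed (use d in simp)
  qed
  then show thesis using R that by blast
qed

text \<open>Weierstrass approximation of \<psi> by polynomials; the commutation property of
  \<open>calc_polynomial\<close> is closed under norm limits.\<close>

lemma calc_compose:
  assumes calc: "calc \<phi> S" and range: "\<And>t. t \<in> {m..M} \<Longrightarrow> \<phi> t \<in> {a..b}"
    and cont: "continuous_on {a..b} \<psi>"
  obtains R where "calc (\<lambda>t. \<psi> (\<phi> t)) R"
    "\<And>(C :: 'a \<Rightarrow>\<^sub>L 'a) x. (\<And>x. C (S x) = S (C x)) \<Longrightarrow> C (R x) = R (C x)"
proof -
  have "\<exists>p. real_polynomial_function p \<and> (\<forall>t\<in>{a..b}. norm (\<psi> t - p t) < inverse (real (Suc n)))" for n
    unfolding real_polynomial_function_eq
    by (rule Stone_Weierstrass_polynomial_function[OF compact_Icc cont]) simp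
  then obtain p where p: "\<And>n. real_polynomial_function (p n)"
    "\<And>n t. t \<in> {a..b} \<Longrightarrow> norm (\<psi> t - p n t) < inverse (real (Suc n))"
    by metis
  have "\<exists>R. calc (\<lambda>t. p n (\<phi> t)) R \<and>
    (\<forall>C :: 'a \<Rightarrow>\<^sub>L 'a. (\<forall>x. C (S x) = S (C x)) \<longrightarrow> (\<forall>x. C (R x) = R (C x)))" for n
    by (rule calc_polynomial[OF p(1) calc])
  then obtain Rn where Rn: "\<And>n. calc (\<lambda>t. p n (\<phi> t)) (Rn n)" and
    comm: "\<And>n. \<forall>C :: 'a \<Rightarrow>\<^sub>L 'a. (\<forall>x. C (S x) = S (C x)) \<longrightarrow> (\<forall>x. C (Rn n x) = Rn n (C x))"
    by metis
  have "uniform_limit {m..M} (\<lambda>n t. p n (\<phi> t)) (\<lambda>t. \<psi> (\<phi> t)) sequentially"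
  proof (rule uniform_limitI)
    fix e :: real assume "0 < e"
    with LIMSEQ_inverse_real_of_nat have "eventually (\<lambda>n. inverse (real (Suc n)) < e) sequentially"
      by (rule order_tendstoD)
    then show "eventually (\<lambda>n. \<forall>t\<in>{m..M}. dist (p n (\<phi> t)) (\<psi> (\<phi> t)) < e) sequentially"
    proof eventually_elim
      case (elim n)
      show ?case
      proof
        fix t assume "t \<in> {m..M}"
        then show "dist (p n (\<phi> t)) (\<psi> (\<phi> t)) < e"
          using p(2)[OF range, of t n] elim unfolding dist_norm
          by (subst norm_minus_commute) (rule less_trans)
      qed
    qed
  qed
  then obtain R where R: "Rn \<longlonglongrightarrow> R" "calc (\<lambda>t. \<psi> (\<phi> t)) R"
    using calc_limit[where \<phi> = "\<lambda>n t. p n (\<phi> t)", OF Rn] by blast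
  have "C (R x) = R (C x)" if C: "\<And>x. C (S x) = S (C x)" for C :: "'a \<Rightarrow>\<^sub>L 'a" and x
  proof (rule LIMSEQ_unique)
    have CR: "C (Rn n x) = Rn n (C x)" for n
      using comm[of n] C by blast
    show "(\<lambda>n. C (Rn n x)) \<longlonglongrightarrow> C (R x)" by (intro tendsto_intros R)
    show "(\<lambda>n. C (Rn n x)) \<longlonglongrightarrow> R (C x)" unfolding CR by (intro tendsto_intros R)
  qed
  then show thesis using R that by blast
qed

lemma calc_op_inverse:
  assumes "0 < m"
  shows "calc inverse (op_inverse T)"
proof -
  have cont: "continuous_on {m..M} (inverse :: real \<Rightarrow> real)"
    using assms by (intro continuous_intros) auto
  obtain V where V: "calc inverse V"
    by (rule calc_compose[OF calc_id _ cont]) auto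
  have one: "calc (\<lambda>_. 1) id_blinfun" using calc_const[of 1] by simp
  have VT: "V o\<^sub>L T = id_blinfun"
    by (rule calc_unique[OF calc_cong[OF calc_mult[OF V calc_id]] one]) (use assms in auto)
  have TV: "T o\<^sub>L V = id_blinfun"
    by (rule calc_unique[OF calc_cong[OF calc_mult[OF calc_id V]] one]) (use assms in auto)
  have "op_inverse T = V"
    unfolding op_inverse_def
  proof (rule the_equality)
    fix S assume S: "S o\<^sub>L T = id_blinfun \<and> T o\<^sub>L S = id_blinfun"
    show "S = V"
    proof (rule blinfun_eqI)
      fix x
      have "S (T (V x)) = V x" using S by (metis blinfun_apply_blinfun_compose id_blinfun.rep_eq)
      moreover have "T (V x) = x" using TV by (metis blinfun_apply_blinfun_compose id_blinfun.rep_eq)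
      ultimately show "S x = V x" by simp
    qed
  qed (use VT TV in blast)
  then show ?thesis using V by simp
qed

lemma calc_series:
  assumes calc: "\<And>n. calc (\<phi> n) (S n)" and d: "summable d"
    and w: "\<And>n t. t \<in> {m..M} \<Longrightarrow> c n * \<phi> n t = d n * w n t"
      "\<And>n t. t \<in> {m..M} \<Longrightarrow> w (Suc n) t \<le> w n t" "\<And>n t. t \<in> {m..M} \<Longrightarrow> 0 \<le> w n t"
      "\<And>n t. t \<in> {m..M} \<Longrightarrow> w n t \<le> 1"
  shows "calc (\<lambda>t. \<Sum>n. c n * \<phi> n t) (\<Sum>n. c n *\<^sub>R S n)"
proof -
  obtain f where f: "uniform_limit {m..M} (\<lambda>N t. \<Sum>n<N. d n * w n t) f sequentially"
    using abel_uniform_limit[OF d, of "{m..M}" w] w(2-4) by blast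
  have eq: "(\<Sum>n<N. d n * w n t) = (\<Sum>n<N. c n * \<phi> n t)" if "t \<in> {m..M}" for N t
    using w(1)[OF that] by simp
  have u: "uniform_limit {m..M} (\<lambda>N t. \<Sum>n<N. c n * \<phi> n t) f sequentially"
    by (rule uniform_limit_cong'[THEN iffD1, OF _ _ f]) (simp_all only: eq)
  obtain R where R: "(\<lambda>N. \<Sum>n<N. c n *\<^sub>R S n) \<longlonglongrightarrow> R" "calc f R"
    using calc_limit[OF calc_sum[OF calc_scaleR[OF calc]] u] by blast
  have "(\<lambda>n. c n *\<^sub>R S n) sums R"
    unfolding sums_def by (rule R(1))
  then have "(\<Sum>n. c n *\<^sub>R S n) = R" by (rule sums_unique[symmetric])
  moreover have "f t = (\<Sum>n. c n * \<phi> n t)" if "t \<in> {m..M}" for t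
  proof -
    have "(\<lambda>n. c n * \<phi> n t) sums f t"
      unfolding sums_def by (rule tendsto_uniform_limitI[OF u that])
    then show ?thesis by (rule sums_unique)
  qed
  ultimately show ?thesis using calc_cong[OF R(2)] by simp
qed

text \<open>Each half of the series is compared with its worst end point: a nonnegative power t^n is
  M^n (t / M)^n, and a negative power is treated likewise with m and m / t. The remaining factors
  decrease in n, so convergence at M and at m is enough for Abel's test.\<close>

lemma calc_laurent_op:
  assumes m: "0 < m" and P: "\<And>a. a \<in> {m..M} \<Longrightarrow> laurent_sums c a (P a)"
  shows "calc P (laurent_op c T)"
proof -
  have M: "0 < M" using m m_less_M by simp
  have conv: "a powi int n = a ^ n" "a powi (- int (Suc n)) = inverse a ^ Suc n" for n and a :: real
    by (simp_all only: power_int_of_nat power_int_minus power_inverse)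
  have ex: "\<exists>s1 s2. (\<lambda>n. c (int n) * a ^ n) sums s1 \<and>
      (\<lambda>n. c (- int (Suc n)) * inverse a ^ Suc n) sums s2 \<and> P a = s1 + s2"
    if a: "a \<in> {m..M}" for a
    using P[OF a] unfolding laurent_sums_def conv .
  have pos: "summable (\<lambda>n. c (int n) * a ^ n)"
    and neg: "summable (\<lambda>n. c (- int (Suc n)) * inverse a ^ Suc n)"
    if a: "a \<in> {m..M}" for a
    using ex[OF a] sums_summable by blast+
  have P_eq: "P a = (\<Sum>n. c (int n) * a ^ n) + (\<Sum>n. c (- int (Suc n)) * inverse a ^ Suc n)"
    if a: "a \<in> {m..M}" for a
    using ex[OF a] sums_unique by metis
  have "calc (\<lambda>t. \<Sum>n. c (int n) * t ^ n) (\<Sum>n. c (int n) *\<^sub>R op_power T n)"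
  proof (rule calc_series[OF calc_power[OF calc_id] pos[of M], where w = "\<lambda>n t. (t / M) ^ n"])
    fix n t assume t: "t \<in> {m..M}"
    then have t': "0 \<le> t / M" "t / M \<le> 1" using m M by auto
    show "c (int n) * t ^ n = c (int n) * M ^ n * (t / M) ^ n" using M by (simp add: power_divide)
    show "(t / M) ^ Suc n \<le> (t / M) ^ n" using t' by (intro power_decreasing) auto
    show "0 \<le> (t / M) ^ n" using t' by simp
    show "(t / M) ^ n \<le> 1" using t' by (intro power_le_one)
  qed (use m_less_M in simp)
  moreover have "calc (\<lambda>t. \<Sum>n. c (- int (Suc n)) * inverse t ^ Suc n)
      (\<Sum>n. c (- int (Suc n)) *\<^sub>R op_power (op_inverse T) (Suc n))"
  proof (rule calc_series[OF calc_power[OF calc_op_inverse[OF m]] neg[of m], where w = "\<lambda>n t. (m / t) ^ Suc n"])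
    fix n t assume t: "t \<in> {m..M}"
    then have t': "0 \<le> m / t" "m / t \<le> 1" using m M by auto
    have "inverse t = inverse m * (m / t)" using m by (simp add: divide_inverse)
    then have "inverse t ^ Suc n = inverse m ^ Suc n * (m / t) ^ Suc n"
      by (metis power_mult_distrib)
    then show "c (- int (Suc n)) * inverse t ^ Suc n = c (- int (Suc n)) * inverse m ^ Suc n * (m / t) ^ Suc n"
      by (simp only: mult.assoc)
    show "(m / t) ^ Suc (Suc n) \<le> (m / t) ^ Suc n" using t' by (intro power_decreasing) auto
    show "0 \<le> (m / t) ^ Suc n" using t' by (rule_tac zero_le_power)
    show "(m / t) ^ Suc n \<le> 1" using t' by (rule_tac power_le_one)
  qed (use m_less_M in simp)
  ultimately have "calc (\<lambda>t. (\<Sum>n. c (int n) * t ^ n) + (\<Sum>n. c (- int (Suc n)) * inverse t ^ Suc n))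
      (laurent_op c T)"
    unfolding laurent_op_def by (rule calc_add)
  then show ?thesis by (rule calc_cong) (simp only: P_eq)
qed

text \<open>The minimum of \<phi> on [m, M] is positive, so the root B is bounded below by some
  \<beta> > 0. This gives uniqueness among positive roots, which is what evaluates the description
  in \<open>op_sqrt\<close>.\<close>

lemma calc_op_sqrt:
  assumes calc: "calc \<phi> S" and pos: "\<And>t. t \<in> {m..M} \<Longrightarrow> 0 < \<phi> t"
  shows "calc (\<lambda>t. sqrt (\<phi> t)) (op_sqrt S)" "op_sqrt S o\<^sub>L op_sqrt S = S"
    "\<exists>\<beta>>0. \<forall>x. \<beta> * (x \<bullet> x) \<le> op_sqrt S x \<bullet> x"
proof -
  have "{m..M} \<noteq> {}" using m_less_M by simp
  from continuous_attains_inf[OF compact_Icc this calcD(1)[OF calc]]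
  obtain t0 where t0: "t0 \<in> {m..M}" "\<And>t. t \<in> {m..M} \<Longrightarrow> \<phi> t0 \<le> \<phi> t" by blast
  obtain K where K: "\<And>t. t \<in> {m..M} \<Longrightarrow> \<bar>\<phi> t\<bar> \<le> K" using calc_bounded[OF calc] by blast
  define \<beta> where "\<beta> = sqrt (\<phi> t0)"
  have \<beta>: "0 < \<beta>" using pos[OF t0(1)] by (simp add: \<beta>_def)
  have range: "\<phi> t \<in> {\<phi> t0..K}" if "t \<in> {m..M}" for t using t0(2)[OF that] K[OF that] by auto
  have "continuous_on {\<phi> t0..K} sqrt" by (intro continuous_intros)
  then obtain B where B: "calc (\<lambda>t. sqrt (\<phi> t)) B"
    and comm: "\<And>(C :: 'a \<Rightarrow>\<^sub>L 'a) x. (\<And>x. C (S x) = S (C x)) \<Longrightarrow> C (B x) = B (C x)"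
    using calc_compose[OF calc range] by blast
  have BB: "B o\<^sub>L B = S"
  proof (rule calc_unique[OF calc_cong[OF calc_mult[OF B B]] calc])
    show "sqrt (\<phi> t) * sqrt (\<phi> t) = \<phi> t" if "t \<in> {m..M}" for t using pos[OF that] by simp
  qed
  have lower: "\<beta> * (x \<bullet> x) \<le> B x \<bullet> x" for x
    by (rule calc_lower[OF B]) (simp add: \<beta>_def t0)
  have "op_sqrt S = B"
    unfolding op_sqrt_def
  proof (rule the_equality, intro conjI)
    show "selfadjoint_op B" using calcD(2)[OF B] by (simp add: selfadjoint_op_def)
    show "positive_op B"
      unfolding positive_op_def
    proof
      fix x :: 'a
      have "0 \<le> \<beta> * (x \<bullet> x)" using \<beta> by simp
      then show "0 \<le> B x \<bullet> x" using lower[of x] by linarith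
    qed
    show "B o\<^sub>L B = S" by (rule BB)
    fix C assume C: "selfadjoint_op C \<and> positive_op C \<and> C o\<^sub>L C = S"
    then have CC: "C (C x) = S x" for x by (metis blinfun_apply_blinfun_compose)
    have BB': "B (B x) = S x" for x by (metis BB blinfun_apply_blinfun_compose)
    \<comment> \<open>C commutes with its own square S, hence with B.\<close>
    have CB: "C (B x) = B (C x)" for x by (rule comm) (simp only: CC[symmetric])
    show "C = B"
    proof (rule blinfun_eqI)
      fix x
      \<comment> \<open>Because B and C commute, (B + C) w = B^2 x - C^2 x = 0; both forms are
        nonnegative at w and that of B is strictly positive unless w = 0.\<close>
      define w where "w = B x - C x"
      have "B w + C w = 0" by (simp add: w_def blinfun.diff_right BB' CC CB)
      then have "B w \<bullet> w + C w \<bullet> w = 0" by (metis inner_add_left inner_zero_left)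
      moreover have "0 \<le> C w \<bullet> w" using C by (simp add: positive_op_def)
      ultimately have "\<beta> * (w \<bullet> w) \<le> 0" using lower[of w] by linarith
      then have "w \<bullet> w \<le> 0" using \<beta> by (simp add: mult_le_0_iff)
      then have "w = 0" by (meson inner_eq_zero_iff inner_ge_zero order_antisym)
      then show "C x = B x" by (simp add: w_def)
    qed
  qed
  then show "calc (\<lambda>t. sqrt (\<phi> t)) (op_sqrt S)" "op_sqrt S o\<^sub>L op_sqrt S = S"
    "\<exists>\<beta>>0. \<forall>x. \<beta> * (x \<bullet> x) \<le> op_sqrt S x \<bullet> x"
    using B BB lower \<beta> by blast+
qed

end

section \<open>The renormalised iteration\<close>

lemma steepest_step:
  fixes T :: "'a::real_inner \<Rightarrow>\<^sub>L 'a" and z z' z'' :: 'a and \<mu> \<mu>' d d' \<sigma> :: real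
  assumes sym: "\<And>x y. T x \<bullet> y = x \<bullet> T y" and \<sigma>: "\<sigma> * \<sigma> = 1"
    and unit: "norm z = 1" "norm z' = 1"
    and mu: "\<mu> = T z \<bullet> z" "\<mu>' = T z' \<bullet> z'"
    and d: "d = norm (T z - \<mu> *\<^sub>R z)" "d' = norm (T z' - \<mu>' *\<^sub>R z')"
    and pos: "0 < d"
    and step: "d *\<^sub>R z' = \<sigma> *\<^sub>R (\<mu> *\<^sub>R z - T z)" "d' *\<^sub>R z'' = \<sigma> *\<^sub>R (\<mu>' *\<^sub>R z' - T z')"
  shows "z' \<bullet> z = 0" "(norm (d' *\<^sub>R z'' - d *\<^sub>R z))\<^sup>2 = d'\<^sup>2 - d\<^sup>2" "d \<le> d'"
    "d' * (z'' \<bullet> z) = d" "d' * (z'' \<bullet> z') = 0"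
proof -
  have zz: "z \<bullet> z = 1" "z' \<bullet> z' = 1" using unit by (simp_all add: dot_square_norm)
  have "d * (z' \<bullet> z) = (d *\<^sub>R z') \<bullet> z" by simp
  also have "\<dots> = 0" unfolding step(1) by (simp add: inner_diff_left zz mu(1))
  finally show o: "z' \<bullet> z = 0" using pos by simp
  have Tz: "T z = \<mu> *\<^sub>R z - (\<sigma> * d) *\<^sub>R z'"
  proof -
    have "(\<sigma> * d) *\<^sub>R z' = (\<sigma> * \<sigma>) *\<^sub>R (\<mu> *\<^sub>R z - T z)"
      using step(1) by (metis scaleR_scaleR)
    then show ?thesis using \<sigma> by simp
  qed
  have cross: "T z' \<bullet> z = - \<sigma> * d"
    by (simp add: sym Tz inner_diff_right o zz)
  have "d' * (z'' \<bullet> z) = (d' *\<^sub>R z'') \<bullet> z" by simp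
  also have "\<dots> = d"
    unfolding step(2) using \<sigma> by (simp add: inner_diff_left o cross mult.assoc[symmetric])
  finally show z''z: "d' * (z'' \<bullet> z) = d" .
  have "d' * (z'' \<bullet> z') = (d' *\<^sub>R z'') \<bullet> z'" by simp
  also have "\<dots> = 0" unfolding step(2) by (simp add: inner_diff_left zz mu(2))
  finally show "d' * (z'' \<bullet> z') = 0" .
  have "\<bar>\<sigma>\<bar> = 1" using \<sigma> by (metis abs_mult_self_eq abs_mult abs_one abs_ge_zero abs_eq_0 mult_cancel_left1 power2_eq_square power2_eq_1_iff abs_minus_cancel)
  then have "norm (\<sigma> *\<^sub>R (\<mu>' *\<^sub>R z' - T z')) = d'"
    unfolding d(2) by (simp add: norm_minus_commute)
  then have "norm (d' *\<^sub>R z'') = d'"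
    by (simp only: step(2))
  then have n: "(d' *\<^sub>R z'') \<bullet> (d' *\<^sub>R z'') = d'\<^sup>2" by (simp add: dot_square_norm)
  have "(norm (d' *\<^sub>R z'' - d *\<^sub>R z))\<^sup>2
      = (d' *\<^sub>R z'') \<bullet> (d' *\<^sub>R z'') - 2 * d * (d' * (z'' \<bullet> z)) + d\<^sup>2 * (z \<bullet> z)"
    unfolding power2_norm_eq_inner
    by (simp add: inner_diff_left inner_diff_right inner_commute power2_eq_square algebra_simps)
  then show sq: "(norm (d' *\<^sub>R z'' - d *\<^sub>R z))\<^sup>2 = d'\<^sup>2 - d\<^sup>2"
    by (simp only: n z''z zz) (simp add: power2_eq_square)
  have "0 \<le> d'\<^sup>2 - d\<^sup>2" unfolding sq[symmetric] by simp
  then have "d\<^sup>2 \<le> d'\<^sup>2" by simp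
  then show "d \<le> d'" by (rule power2_le_imp_le) (simp add: d(2))
qed

text \<open>Only the lower end of the spectrum is treated here. The upper end is reached by
  instantiating the same locale with - T, the reversed projections and \<sigma> = - 1, for the same
  vectors z.\<close>

locale normalized_steps = bounded_resolution T F m M
  for T :: "'a::real_inner \<Rightarrow>\<^sub>L 'a" and F m M +
  fixes \<sigma> :: real and z :: "nat \<Rightarrow> 'a"
  assumes \<sigma>: "\<sigma> * \<sigma> = 1"
    and unit: "norm (z k) = 1"
    and dev_pos': "0 < norm (T (z k) - (T (z k) \<bullet> z k) *\<^sub>R z k)"
    and step': "norm (T (z k) - (T (z k) \<bullet> z k) *\<^sub>R z k) *\<^sub>R z (Suc k)
      = \<sigma> *\<^sub>R ((T (z k) \<bullet> z k) *\<^sub>R z k - T (z k))"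
    and F_z0: "m < s \<Longrightarrow> F s (z 0) \<noteq> 0"
begin

definition \<mu> :: "nat \<Rightarrow> real" where "\<mu> k = T (z k) \<bullet> z k"

definition dev :: "nat \<Rightarrow> real" where "dev k = norm (T (z k) - \<mu> k *\<^sub>R z k)"

lemma zz: "z k \<bullet> z k = 1"
  using unit by (simp add: dot_square_norm)

lemma dev_pos: "0 < dev k"
  using dev_pos' by (simp add: dev_def \<mu>_def)

lemma step: "dev k *\<^sub>R z (Suc k) = \<sigma> *\<^sub>R (\<mu> k *\<^sub>R z k - T (z k))"
  using step' by (simp add: dev_def \<mu>_def)

lemmas step_facts = steepest_step[OF T_sym \<sigma> unit unit \<mu>_def \<mu>_def dev_def dev_def dev_pos step step]

lemma dev_mono: "incseq dev"
  by (rule incseq_SucI) (rule step_facts(3))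

lemma abs_\<sigma>: "\<bar>\<sigma>\<bar> = 1"
  using \<sigma> by (metis power2_eq_square power2_eq_1_iff abs_1 abs_minus_cancel)

lemma \<mu>_le: "\<mu> k \<le> M" and \<mu>_ge: "m \<le> \<mu> k"
  using T_le[of "z k"] T_ge[of "z k"] by (simp_all add: \<mu>_def zz)

lemma norm_shift_le: "(norm (T x - m *\<^sub>R x))\<^sup>2 \<le> (M - m) * ((T x - m *\<^sub>R x) \<bullet> x)"
proof -
  define S where "S = T - m *\<^sub>R id_blinfun"
  have S: "S x = T x - m *\<^sub>R x" for x
    by (simp add: S_def blinfun.diff_left blinfun.scaleR_left)
  have "(norm (S x))\<^sup>2 \<le> (M - m) * (S x \<bullet> x)"
    by (rule positive_op_norm_le)
      (use T_ge T_le m_less_M in \<open>simp_all add: S inner_diff_left inner_diff_right T_sym algebra_simps\<close>)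
  then show ?thesis by (simp add: S)
qed

lemma norm_shift_le': "norm (T x - m *\<^sub>R x) \<le> (M - m) * norm x"
proof (rule power2_le_imp_le)
  have "(norm (T x - m *\<^sub>R x))\<^sup>2 \<le> (M - m) * ((T x - m *\<^sub>R x) \<bullet> x)" by (rule norm_shift_le)
  also have "\<dots> \<le> (M - m) * ((M - m) * (x \<bullet> x))"
    using T_le[of x] m_less_M by (intro mult_left_mono) (simp_all add: inner_diff_left algebra_simps)
  finally show "(norm (T x - m *\<^sub>R x))\<^sup>2 \<le> ((M - m) * norm x)\<^sup>2"
    by (simp add: power_mult_distrib power2_norm_eq_inner) (simp add: power2_eq_square)
qed (use m_less_M in simp)

lemma norm_shift_between:
  assumes "m \<le> c" "c \<le> M"
  shows "norm (T x - c *\<^sub>R x) \<le> 2 * (M - m) * norm x"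
proof -
  have "T x - c *\<^sub>R x = (T x - m *\<^sub>R x) - (c - m) *\<^sub>R x"
    by (simp add: algebra_simps)
  then have "norm (T x - c *\<^sub>R x) \<le> norm (T x - m *\<^sub>R x) + norm ((c - m) *\<^sub>R x)"
    by (metis norm_triangle_ineq4)
  also have "\<dots> \<le> (M - m) * norm x + (M - m) * norm x"
    using assms norm_shift_le'[of x] by (intro add_mono) (auto intro: mult_right_mono)
  finally show ?thesis by (simp add: algebra_simps)
qed

lemma dev_sq: "(dev k)\<^sup>2 = T (z k) \<bullet> T (z k) - (\<mu> k)\<^sup>2"
  unfolding dev_def power2_norm_eq_inner
  by (simp add: inner_diff_left inner_diff_right zz \<mu>_def inner_commute power2_eq_square)

text \<open>The variance of the spectral measure of \<open>z k\<close> is at most its second moment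
  about m, which \<open>norm_shift_le\<close> compares with the first moment about m.\<close>

lemma dev_sq_le: "(dev k)\<^sup>2 \<le> (M - m) * (\<mu> k - m)"
proof -
  have "(dev k)\<^sup>2 \<le> (dev k)\<^sup>2 + (\<mu> k - m)\<^sup>2" by simp
  also have "\<dots> = (norm (T (z k) - m *\<^sub>R z k))\<^sup>2"
    unfolding dev_sq unfolding power2_norm_eq_inner
    by (simp add: inner_diff_left inner_diff_right zz \<mu>_def inner_commute power2_eq_square algebra_simps)
  also have "\<dots> \<le> (M - m) * ((T (z k) - m *\<^sub>R z k) \<bullet> z k)" by (rule norm_shift_le)
  finally show ?thesis by (simp add: inner_diff_left zz \<mu>_def)
qed

lemma dev_le: "dev k \<le> M - m"
proof (rule power2_le_imp_le)
  have "(dev k)\<^sup>2 \<le> (M - m) * (\<mu> k - m)" by (rule dev_sq_le)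
  also have "\<dots> \<le> (M - m)\<^sup>2"
    unfolding power2_eq_square using m_less_M \<mu>_le[of k] by (intro mult_left_mono) auto
  finally show "(dev k)\<^sup>2 \<le> (M - m)\<^sup>2" .
qed (use m_less_M in simp)

definition dev_lim :: real where "dev_lim = lim dev"

lemma dev_tendsto: "dev \<longlonglongrightarrow> dev_lim"
proof -
  obtain L where "dev \<longlonglongrightarrow> L"
    using incseq_convergent[OF dev_mono] dev_le by blast
  then show ?thesis by (simp add: dev_lim_def limI)
qed

lemma dev_le_lim: "dev k \<le> dev_lim"
  using dev_mono dev_tendsto by (rule incseq_le)

lemma dev_lim_pos: "0 < dev_lim"
  using dev_pos[of 0] dev_le_lim[of 0] by linarith

lemma dev_0_le: "dev 0 \<le> dev k"
  using dev_mono by (simp add: incseq_def)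

section \<open>Slow variation over two steps\<close>

lemma two_step: "(\<lambda>k. norm (dev (Suc k) *\<^sub>R z (Suc (Suc k)) - dev k *\<^sub>R z k)) \<longlonglongrightarrow> 0"
proof -
  have "(\<lambda>k. sqrt ((dev (Suc k))\<^sup>2 - (dev k)\<^sup>2)) \<longlonglongrightarrow> sqrt (dev_lim\<^sup>2 - dev_lim\<^sup>2)"
    by (intro tendsto_intros LIMSEQ_Suc dev_tendsto)
  then show ?thesis by (simp add: step_facts(2)[symmetric])
qed

text \<open>Replacing \<open>dev (Suc k)\<close> by \<open>dev k\<close> in \<open>two_step\<close>
  costs their difference, which tends to 0; dividing by \<open>dev k\<close> is harmless because it
  is at least \<open>dev 0\<close>.\<close>

lemma z_two_step: "(\<lambda>k. z (Suc (Suc k)) - z k) \<longlonglongrightarrow> 0"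
proof (rule tendsto_norm_zero_cancel)
  have bound: "norm (z (Suc (Suc k)) - z k) \<le>
     (norm (dev (Suc k) *\<^sub>R z (Suc (Suc k)) - dev k *\<^sub>R z k) + (dev (Suc k) - dev k)) / dev 0" for k
  proof -
    let ?d = "dev (Suc k)" and ?e = "dev k"
    have "?e *\<^sub>R (z (Suc (Suc k)) - z k) = (?d *\<^sub>R z (Suc (Suc k)) - ?e *\<^sub>R z k) - (?d - ?e) *\<^sub>R z (Suc (Suc k))"
      by (simp add: algebra_simps)
    then have "norm (?e *\<^sub>R (z (Suc (Suc k)) - z k)) \<le>
       norm (?d *\<^sub>R z (Suc (Suc k)) - ?e *\<^sub>R z k) + norm ((?d - ?e) *\<^sub>R z (Suc (Suc k)))"
      by (metis norm_triangle_ineq4)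
    also have "norm ((?d - ?e) *\<^sub>R z (Suc (Suc k))) = ?d - ?e"
      using step_facts(3)[of k] by (simp add: unit)
    finally have "?e * norm (z (Suc (Suc k)) - z k) \<le>
       norm (?d *\<^sub>R z (Suc (Suc k)) - ?e *\<^sub>R z k) + (?d - ?e)"
      using dev_pos[of k] by simp
    moreover have "dev 0 * norm (z (Suc (Suc k)) - z k) \<le> ?e * norm (z (Suc (Suc k)) - z k)"
      by (intro mult_right_mono dev_0_le) simp
    ultimately show ?thesis using dev_pos[of 0] by (simp add: field_simps)
  qed
  show "(\<lambda>k. norm (z (Suc (Suc k)) - z k)) \<longlonglongrightarrow> 0"
  proof (rule tendsto_sandwich[OF _ _ tendsto_const])
    have "(\<lambda>k. (norm (dev (Suc k) *\<^sub>R z (Suc (Suc k)) - dev k *\<^sub>R z k) + (dev (Suc k) - dev k)) / dev 0)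
      \<longlonglongrightarrow> (0 + (dev_lim - dev_lim)) / dev 0"
      using dev_pos[of 0] by (intro tendsto_intros two_step LIMSEQ_Suc dev_tendsto) simp
    then show "(\<lambda>k. (norm (dev (Suc k) *\<^sub>R z (Suc (Suc k)) - dev k *\<^sub>R z k) + (dev (Suc k) - dev k)) / dev 0)
      \<longlonglongrightarrow> 0" by simp
  qed (auto simp: bound)
qed

lemma \<mu>_two_step: "(\<lambda>k. \<mu> (Suc (Suc k)) - \<mu> k) \<longlonglongrightarrow> 0"
proof -
  have eq: "\<mu> (Suc (Suc k)) - \<mu> k = T (z (Suc (Suc k)) - z k) \<bullet> (z (Suc (Suc k)) + z k)" for k
  proof -
    have "T (z (Suc (Suc k))) \<bullet> z k = T (z k) \<bullet> z (Suc (Suc k))"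
      by (metis T_sym inner_commute)
    then show ?thesis
      by (simp add: \<mu>_def blinfun.diff_right inner_diff_left inner_add_right)
  qed
  have "(\<lambda>k. norm (T (z (Suc (Suc k)) - z k))) \<longlonglongrightarrow> norm (T 0)"
    by (intro tendsto_intros z_two_step)
  then have lim: "(\<lambda>k. norm (T (z (Suc (Suc k)) - z k)) * 2) \<longlonglongrightarrow> 0"
    using tendsto_mult[OF _ tendsto_const, of _ 0 sequentially "2::real"] by force
  show ?thesis
  proof (rule Lim_null_comparison[OF always_eventually lim], intro allI)
    fix k
    have "norm (z (Suc (Suc k)) + z k) \<le> 2"
      using norm_triangle_ineq[of "z (Suc (Suc k))" "z k"] by (simp add: unit)
    then show "norm (\<mu> (Suc (Suc k)) - \<mu> k) \<le> norm (T (z (Suc (Suc k)) - z k)) * 2"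
      unfolding eq real_norm_def
      by (meson Cauchy_Schwarz_ineq2 mult_left_mono norm_ge_zero order_trans)
  qed
qed

text \<open>\<open>(t - \<mu> k) (t - \<mu> (k + 1)) - (dev k)\<^sup>2\<close> is the monic second orthogonal polynomial of the
  spectral measure of \<open>z k\<close>, so that its roots \<open>root_lo k\<close> and \<open>root_hi k\<close> lie between \<open>m\<close> and \<open>M\<close>. Evaluated
  at \<open>T\<close> it maps \<open>z k\<close> to \<open>resid k\<close>.\<close>

definition disc :: "nat \<Rightarrow> real" where "disc k = (\<mu> k - \<mu> (Suc k))\<^sup>2 + 4 * (dev k)\<^sup>2"

definition root_lo :: "nat \<Rightarrow> real" where "root_lo k = (\<mu> k + \<mu> (Suc k) - sqrt (disc k)) / 2"

definition root_hi :: "nat \<Rightarrow> real" where "root_hi k = (\<mu> k + \<mu> (Suc k) + sqrt (disc k)) / 2"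

definition resid :: "nat \<Rightarrow> 'a" where
  "resid k = dev k *\<^sub>R (dev (Suc k) *\<^sub>R z (Suc (Suc k)) - dev k *\<^sub>R z k)"

section \<open>Roots of the second orthogonal polynomial\<close>

lemma disc_ge: "(2 * dev k)\<^sup>2 \<le> disc k"
  by (simp add: disc_def power_mult_distrib)

lemma root_sum: "root_lo k + root_hi k = \<mu> k + \<mu> (Suc k)"
  by (simp add: root_lo_def root_hi_def field_simps)

lemma root_prod: "root_lo k * root_hi k = \<mu> k * \<mu> (Suc k) - (dev k)\<^sup>2"
proof -
  have "0 \<le> disc k" by (simp add: disc_def)
  then have "(sqrt (disc k))\<^sup>2 = (\<mu> k - \<mu> (Suc k))\<^sup>2 + 4 * (dev k)\<^sup>2"
    by (simp add: disc_def)
  then show ?thesis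
    by (simp add: root_lo_def root_hi_def power2_eq_square field_simps)
qed

lemma root_gap: "root_lo k + 2 * dev k \<le> root_hi k"
  using real_le_rsqrt[OF disc_ge[of k]] by (simp add: root_lo_def root_hi_def field_simps)

lemma root_gap0: "root_lo k + 2 * dev 0 \<le> root_hi k"
  using root_gap[of k] dev_0_le[of k] by linarith

lemma root_poly: "(\<mu> k - t) * (\<mu> (Suc k) - t) = (root_lo k - t) * (root_hi k - t) + (dev k)\<^sup>2"
proof -
  have "(root_lo k - t) * (root_hi k - t) = root_lo k * root_hi k - t * (root_lo k + root_hi k) + t * t"
    by (simp add: algebra_simps)
  then show ?thesis unfolding root_sum root_prod by (simp add: algebra_simps)
qed

lemma root_lo_le: "root_lo k \<le> \<mu> k" "root_lo k \<le> \<mu> (Suc k)"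
proof -
  have "\<bar>\<mu> k - \<mu> (Suc k)\<bar> \<le> sqrt (disc k)"
    by (rule real_le_rsqrt) (simp add: disc_def)
  then show "root_lo k \<le> \<mu> k" "root_lo k \<le> \<mu> (Suc k)"
    by (auto simp: root_lo_def field_simps)
qed

lemma resid_eq:
  "resid k = T (T (z k)) - (root_lo k + root_hi k) *\<^sub>R T (z k) + (root_lo k * root_hi k) *\<^sub>R z k"
proof -
  define w where "w = \<mu> k *\<^sub>R z k - T (z k)"
  have w: "dev k *\<^sub>R z (Suc k) = \<sigma> *\<^sub>R w"
    unfolding w_def by (rule step)
  have "dev k *\<^sub>R dev (Suc k) *\<^sub>R z (Suc (Suc k)) = \<sigma> *\<^sub>R (\<mu> (Suc k) *\<^sub>R (dev k *\<^sub>R z (Suc k)) - T (dev k *\<^sub>R z (Suc k)))"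
    unfolding step[of "Suc k"] by (simp add: blinfun.scaleR_right scaleR_diff_right mult.commute mult.left_commute)
  also have "\<dots> = (\<sigma> * \<sigma>) *\<^sub>R (\<mu> (Suc k) *\<^sub>R w - T w)"
    unfolding w by (simp add: blinfun.scaleR_right scaleR_diff_right mult.commute mult.left_commute)
  finally have "resid k = \<mu> (Suc k) *\<^sub>R w - T w - (dev k)\<^sup>2 *\<^sub>R z k"
    by (simp add: resid_def \<sigma> scaleR_diff_right power2_eq_square)
  also have "\<dots> = T (T (z k)) - (\<mu> k + \<mu> (Suc k)) *\<^sub>R T (z k) + (\<mu> k * \<mu> (Suc k) - (dev k)\<^sup>2) *\<^sub>R z k"
    by (simp add: w_def blinfun.diff_right blinfun.scaleR_right algebra_simps)
  finally show ?thesis unfolding root_sum root_prod .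
qed

lemma resid_tendsto: "(\<lambda>k. norm (resid k)) \<longlonglongrightarrow> 0"
proof -
  have "norm (resid k) = dev k * norm (dev (Suc k) *\<^sub>R z (Suc (Suc k)) - dev k *\<^sub>R z k)" for k
    using dev_pos[of k] by (simp add: resid_def)
  then show ?thesis
    using tendsto_mult[OF dev_tendsto two_step] by simp
qed

lemma resid_ortho: "resid k \<bullet> z k = 0" "resid k \<bullet> T (z k) = 0"
proof -
  show *: "resid k \<bullet> z k = 0"
    by (simp add: resid_def inner_diff_left step_facts(4) zz)
  have **: "resid k \<bullet> z (Suc k) = 0"
  proof -
    have "z k \<bullet> z (Suc k) = 0" using step_facts(1)[of k] by (simp add: inner_commute)
    then show ?thesis
      using step_facts(5)[of k] unfolding resid_def by (simp only: inner_diff_left inner_scaleR_left) simp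
  qed
  have "T (z k) = \<mu> k *\<^sub>R z k - \<sigma> *\<^sub>R (dev k *\<^sub>R z (Suc k))"
    unfolding step using \<sigma> by (simp add: algebra_simps)
  then show "resid k \<bullet> T (z k) = 0"
    by (simp add: inner_diff_right * **)
qed

text \<open>For the other root c', the vector y = (T - c') z k satisfies (T - c) y =
  \<open>resid k\<close>, which is orthogonal to y. So c is the Rayleigh quotient of y, and y is
  nonzero because \<open>dev k\<close> is positive.\<close>

lemma root_between:
  assumes "c \<in> {root_lo k, root_hi k}"
  shows "m \<le> c \<and> c \<le> M"
proof -
  define c' where "c' = root_lo k + root_hi k - c"
  define y where "y = T (z k) - c' *\<^sub>R z k"
  have r: "T y - c *\<^sub>R y = resid k"
    using assms unfolding y_def c'_def resid_eq
    by (auto simp: blinfun.diff_right blinfun.add_right blinfun.scaleR_right algebra_simps)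
  have "(T y - c *\<^sub>R y) \<bullet> y = 0"
    unfolding r unfolding y_def by (simp add: inner_diff_right resid_ortho)
  then have Ty: "T y \<bullet> y = c * (y \<bullet> y)" by (simp add: inner_diff_left)
  have "y \<bullet> y = (dev k)\<^sup>2 + (\<mu> k - c')\<^sup>2"
    unfolding dev_sq y_def
    by (simp add: inner_diff_left inner_diff_right zz \<mu>_def inner_commute power2_eq_square algebra_simps)
  also have "\<dots> > 0" using dev_pos[of k] by (simp add: add_pos_nonneg)
  finally have "0 < y \<bullet> y" .
  then show ?thesis using T_ge[of y] T_le[of y] unfolding Ty by simp
qed

lemma root_lo_ge: "m \<le> root_lo k" and root_hi_ge: "m \<le> root_hi k" and root_hi_le: "root_hi k \<le> M"
  using root_between[of _ k] by auto

text \<open>Although \<mu> may jump at each step, \<open>root_lo k\<close> is symmetric in \<mu> k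
  and \<mu> (Suc k); passing to the next index only replaces \<mu> k by \<mu> (Suc (Suc k)) and
  changes \<open>dev\<close> slightly.\<close>

lemma root_lo_step: "(\<lambda>k. root_lo (Suc k) - root_lo k) \<longlonglongrightarrow> 0"
proof -
  \<comment> \<open>Hoelder continuity of the square root reduces the claim to the differences of
    the discriminants.\<close>
  have abs: "\<bar>sqrt x - sqrt y\<bar> \<le> sqrt \<bar>x - y\<bar>" if "0 \<le> x" "0 \<le> y" for x y :: real
  proof -
    have "sqrt u \<le> sqrt v + sqrt \<bar>u - v\<bar>" if "0 \<le> u" "0 \<le> v" for u v :: real
      using that by (intro order_trans[OF real_sqrt_le_mono sqrt_add_le_add_sqrt]) auto
    from this[of x y] this[of y x] that show ?thesis by (simp add: abs_minus_commute)
  qed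
  have "(\<lambda>k. sqrt (disc (Suc k)) - sqrt (disc k)) \<longlonglongrightarrow> 0"
  proof (rule Lim_null_comparison[OF always_eventually])
    show "\<forall>k. norm (sqrt (disc (Suc k)) - sqrt (disc k)) \<le> sqrt \<bar>disc (Suc k) - disc k\<bar>"
      unfolding real_norm_def by (intro allI abs) (simp_all add: disc_def)
    have disc_diff: "disc (Suc k) - disc k =
       (\<mu> (Suc (Suc k)) - \<mu> k) * (\<mu> (Suc (Suc k)) + \<mu> k - 2 * \<mu> (Suc k))
       + 4 * ((dev (Suc k))\<^sup>2 - (dev k)\<^sup>2)" for k
      by (simp add: disc_def power2_eq_square algebra_simps)
    have "(\<lambda>k. (\<mu> (Suc (Suc k)) - \<mu> k) * (\<mu> (Suc (Suc k)) + \<mu> k - 2 * \<mu> (Suc k))) \<longlonglongrightarrow> 0"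
    proof (rule Lim_null_comparison[OF always_eventually])
      show "\<forall>k. norm ((\<mu> (Suc (Suc k)) - \<mu> k) * (\<mu> (Suc (Suc k)) + \<mu> k - 2 * \<mu> (Suc k)))
         \<le> norm (\<mu> (Suc (Suc k)) - \<mu> k) * (2 * (M - m))"
      proof
        fix k
        have "\<bar>\<mu> (Suc (Suc k)) + \<mu> k - 2 * \<mu> (Suc k)\<bar> \<le> 2 * (M - m)"
          using \<mu>_le[of k] \<mu>_le[of "Suc k"] \<mu>_le[of "Suc (Suc k)"]
            \<mu>_ge[of k] \<mu>_ge[of "Suc k"] \<mu>_ge[of "Suc (Suc k)"] by (simp add: abs_le_iff)
        then show "norm ((\<mu> (Suc (Suc k)) - \<mu> k) * (\<mu> (Suc (Suc k)) + \<mu> k - 2 * \<mu> (Suc k)))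
         \<le> norm (\<mu> (Suc (Suc k)) - \<mu> k) * (2 * (M - m))"
          by (simp add: abs_mult mult_left_mono)
      qed
      show "(\<lambda>k. norm (\<mu> (Suc (Suc k)) - \<mu> k) * (2 * (M - m))) \<longlonglongrightarrow> 0"
        by (rule tendsto_mult_left_zero[OF tendsto_norm_zero[OF \<mu>_two_step]])
    qed
    moreover have "(\<lambda>k. 4 * ((dev (Suc k))\<^sup>2 - (dev k)\<^sup>2)) \<longlonglongrightarrow> 4 * (dev_lim\<^sup>2 - dev_lim\<^sup>2)"
      by (intro tendsto_intros LIMSEQ_Suc dev_tendsto)
    ultimately have "(\<lambda>k. disc (Suc k) - disc k) \<longlonglongrightarrow> 0 + 4 * (dev_lim\<^sup>2 - dev_lim\<^sup>2)"
      unfolding disc_diff by (rule tendsto_add)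
    then have "(\<lambda>k. sqrt \<bar>disc (Suc k) - disc k\<bar>) \<longlonglongrightarrow> sqrt \<bar>0 + 4 * (dev_lim\<^sup>2 - dev_lim\<^sup>2)\<bar>"
      by (intro tendsto_intros)
    then show "(\<lambda>k. sqrt \<bar>disc (Suc k) - disc k\<bar>) \<longlonglongrightarrow> 0" by simp
  qed
  then have "(\<lambda>k. ((\<mu> (Suc (Suc k)) - \<mu> k) - (sqrt (disc (Suc k)) - sqrt (disc k))) / 2) \<longlonglongrightarrow> (0 - 0) / 2"
    by (intro tendsto_intros \<mu>_two_step) auto
  moreover have eq: "root_lo (Suc k) - root_lo k =
     ((\<mu> (Suc (Suc k)) - \<mu> k) - (sqrt (disc (Suc k)) - sqrt (disc k))) / 2" for k
    by (simp add: root_lo_def field_simps)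
  ultimately show ?thesis unfolding eq by simp
qed

section \<open>Mass estimates from the residual\<close>

lemma resid_factor:
  "resid k = T (T (z k) - root_hi k *\<^sub>R z k) - root_lo k *\<^sub>R (T (z k) - root_hi k *\<^sub>R z k)"
  unfolding resid_eq by (simp add: blinfun.diff_right blinfun.scaleR_right algebra_simps)

text \<open>Each linear factor of the polynomial expands the range of \<open>F s\<close> by at least
  the distance from s to its root. A small residual thus leaves little mass below s.\<close>

lemma F_root_bound:
  assumes "s \<le> root_lo k"
  shows "(root_lo k - s) * ((root_hi k - s) * norm (F s (z k))) \<le> norm (resid k)"
proof -
  define y where "y = T (z k) - root_hi k *\<^sub>R z k"
  have "s \<le> root_hi k" using assms root_gap[of k] dev_pos[of k] by linarith
  then have "(root_hi k - s) * norm (F s (z k)) \<le> norm (F s y)"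
    using shift_below_le[of s "root_hi k" "z k"] by (simp add: y_def blinfun.diff_right blinfun.scaleR_right F_T)
  then have "(root_lo k - s) * ((root_hi k - s) * norm (F s (z k))) \<le> (root_lo k - s) * norm (F s y)"
    using assms by (intro mult_left_mono) auto
  also have "\<dots> \<le> norm (F s (resid k))"
    using shift_below_le[OF assms, of y]
    unfolding resid_factor y_def[symmetric] by (simp add: blinfun.diff_right blinfun.scaleR_right F_T)
  also have "\<dots> \<le> norm (resid k)" by (rule norm_F_le)
  finally show ?thesis .
qed

lemma slice_root_bound:
  assumes "root_lo k \<le> s" "s \<le> r" "r \<le> root_hi k"
  shows "(s - root_lo k) * ((root_hi k - r) * norm (slice s r (z k))) \<le> norm (resid k)"
proof -
  define y where "y = T (z k) - root_hi k *\<^sub>R z k"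
  have "(root_hi k - r) * norm (slice s r (z k)) \<le> norm (slice s r y)"
    using shift_below_le[OF assms(3), of "slice s r (z k)"] assms(2)
    by (simp add: F_slice y_def blinfun.diff_right blinfun.scaleR_right slice_T)
  then have "(s - root_lo k) * ((root_hi k - r) * norm (slice s r (z k))) \<le> (s - root_lo k) * norm (slice s r y)"
    using assms by (intro mult_left_mono) auto
  also have "\<dots> \<le> norm (slice s r (resid k))"
    using shift_above_le[OF assms(1), of "slice s r y"] assms(2)
    unfolding resid_factor y_def[symmetric]
    by (simp add: F_slice blinfun.diff_right blinfun.scaleR_right slice_T)
  also have "\<dots> \<le> norm (resid k)" using assms(2) by (rule norm_slice_le)
  finally show ?thesis .
qed

text \<open>Conversely, mass is forced below every r above the lower root: y = (T - root_hi) z k is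
  nearly an eigenvector for the lower root when the residual is small, so its part above r is small,
  while its norm is at least \<open>dev k\<close>.\<close>

lemma dev_le_F:
  assumes "root_lo k < r"
  shows "dev k \<le> norm (resid k) / (r - root_lo k) + 2 * (M - m) * norm (F r (z k))"
proof -
  define y where "y = T (z k) - root_hi k *\<^sub>R z k"
  have "(r - root_lo k) * norm (y - F r y) \<le> norm (T (y - F r y) - root_lo k *\<^sub>R (y - F r y))"
    using assms by (intro shift_above_le) simp
  also have "T (y - F r y) - root_lo k *\<^sub>R (y - F r y) = resid k - F r (resid k)"
    unfolding resid_factor y_def[symmetric]
    by (simp add: blinfun.diff_right blinfun.scaleR_right F_T algebra_simps)
  also have "norm \<dots> \<le> norm (resid k)" by (rule norm_F_compl_le)
  finally have 1: "norm (y - F r y) \<le> norm (resid k) / (r - root_lo k)"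
    using assms by (simp add: field_simps)
  have "F r y = T (F r (z k)) - root_hi k *\<^sub>R F r (z k)"
    by (simp add: y_def blinfun.diff_right blinfun.scaleR_right F_T)
  then have 2: "norm (F r y) \<le> 2 * (M - m) * norm (F r (z k))"
    using norm_shift_between[OF root_hi_ge[of k] root_hi_le, of "F r (z k)"] by simp
  \<comment> \<open>The distance from T z k to a multiple c z k is least at c = \<mu> k, where it
    equals \<open>dev k\<close>.\<close>
  have "y \<bullet> y = (dev k)\<^sup>2 + (\<mu> k - root_hi k)\<^sup>2"
    unfolding dev_sq y_def
    by (simp add: inner_diff_left inner_diff_right zz \<mu>_def inner_commute power2_eq_square algebra_simps)
  then have "(dev k)\<^sup>2 \<le> (norm y)\<^sup>2" by (simp add: power2_norm_eq_inner)
  then have "dev k \<le> norm y" by (rule power2_le_imp_le) simp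
  also have "\<dots> \<le> norm (y - F r y) + norm (F r y)"
    using norm_triangle_ineq[of "y - F r y" "F r y"] by simp
  finally show ?thesis using 1 2 by linarith
qed

lemma dev_F_step: "dev k * norm (F s (z (Suc k))) = norm (T (F s (z k)) - \<mu> k *\<^sub>R F s (z k))"
proof -
  have "dev k * norm (F s (z (Suc k))) = norm (F s (dev k *\<^sub>R z (Suc k)))"
    using dev_pos[of k] by (simp add: blinfun.scaleR_right)
  also have "\<dots> = norm (T (F s (z k)) - \<mu> k *\<^sub>R F s (z k))"
    unfolding step by (simp add: abs_\<sigma> blinfun.diff_right blinfun.scaleR_right F_T norm_minus_commute)
  finally show ?thesis .
qed

lemma dev_slice_step:
  "dev k * norm (slice s r (z (Suc k))) = norm (T (slice s r (z k)) - \<mu> k *\<^sub>R slice s r (z k))"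
proof -
  have "dev k * norm (slice s r (z (Suc k))) = norm (slice s r (dev k *\<^sub>R z (Suc k)))"
    using dev_pos[of k] by (simp add: blinfun.scaleR_right)
  also have "\<dots> = norm (T (slice s r (z k)) - \<mu> k *\<^sub>R slice s r (z k))"
    unfolding step by (simp add: abs_\<sigma> blinfun.diff_right blinfun.scaleR_right slice_T norm_minus_commute)
  finally show ?thesis .
qed

lemma F_step_ge:
  assumes "s \<le> \<mu> k"
  shows "(\<mu> k - s) * norm (F s (z k)) \<le> dev k * norm (F s (z (Suc k)))"
  unfolding dev_F_step by (rule shift_below_le[OF assms])

text \<open>The factor \<mu> k - s is the same as in \<open>F_step_ge\<close>, so that it cancels
  when the growth of the slice is compared with that of the part below s.\<close>

lemma slice_step_le:
  assumes "s < r" "r \<le> \<mu> k"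
  shows "dev k * norm (slice s r (z (Suc k))) \<le> (\<mu> k - s) * norm (slice s r (z k))"
  unfolding dev_slice_step by (rule slice_le[OF assms])

section \<open>Convergence of the lower root\<close>

lemma \<mu>_gt: "m < \<mu> k"
proof -
  have "0 < (M - m) * (\<mu> k - m)"
    using dev_sq_le[of k] dev_pos[of k] by (meson less_le_trans zero_less_power)
  then show ?thesis using m_less_M by (simp add: zero_less_mult_iff)
qed

lemma F_z_pos: "m < s \<Longrightarrow> 0 < norm (F s (z k))"
proof (induction k arbitrary: s)
  case 0
  then show ?case using F_z0 by simp
next
  case (Suc k)
  \<comment> \<open>Below \<mu> k the step has a positive expansion factor, and
    \<open>t \<le> s\<close> transfers nonvanishing from \<open>F t\<close> to \<open>F s\<close>.
    The threshold changes, so the induction runs over all of them.\<close>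
  define t where "t = min s ((m + \<mu> k) / 2)"
  have t: "m < t" "t < \<mu> k" "t \<le> s"
    using Suc.prems \<mu>_gt[of k] by (auto simp: t_def min_less_iff_disj)
  have "0 < (\<mu> k - t) * norm (F t (z k))"
    using Suc.IH[OF t(1)] t by simp
  also have "\<dots> \<le> dev k * norm (F t (z (Suc k)))" using t by (intro F_step_ge) simp
  finally have "F t (z (Suc k)) \<noteq> 0" by auto
  moreover have "F t (z (Suc k)) = F t (F s (z (Suc k)))" using t by (simp add: F_F min_absorb1)
  ultimately show ?case by (auto simp: blinfun.zero_right)
qed

lemma norm_F_z_le: "norm (F s (z k)) \<le> 1"
  using norm_F_le[of s "z k"] by (simp add: unit)

text \<open>If \<open>root_lo\<close> stayed away from \<open>m\<close>, the part of \<open>z k\<close> near the bottom of the spectrum would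
  grow geometrically.\<close>

lemma root_lo_frequently:
  assumes "m < s"
  shows "\<exists>k\<ge>n. root_lo k < s"
proof (rule ccontr)
  assume "\<not> ?thesis"
  then have lo: "s \<le> root_lo k" if "n \<le> k" for k using that by force
  \<comment> \<open>The midpoint stays above m, where \<open>F_z_pos\<close> applies, and keeps a
    distance \<epsilon> from all later lower roots.\<close>
  define t where "t = (m + s) / 2"
  define \<epsilon> where "\<epsilon> = s - t"
  have t: "m < t" "t < s" "0 < \<epsilon>" using assms by (auto simp: t_def \<epsilon>_def)
  \<comment> \<open>Half of the excess 2 * \<epsilon> obtained below is spent on replacing
    \<open>dev k\<close> by its limit; this makes the growth factor independent of k.\<close>
  have "eventually (\<lambda>k. dev_lim - \<epsilon> < dev k) sequentially"
    using dev_tendsto t by (intro order_tendstoD) auto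
  then obtain n1 where n1: "\<And>k. n1 \<le> k \<Longrightarrow> dev_lim - \<epsilon> < dev k"
    by (auto simp: eventually_sequentially)
  define n2 where "n2 = max n n1"
  let ?N = "\<lambda>k. norm (F t (z k))"
  have grow: "(dev_lim + \<epsilon>) * ?N k \<le> dev_lim * ?N (Suc (Suc k))" if "n2 \<le> k" for k
  proof -
    have lk: "s \<le> root_lo k" and dk: "dev_lim - \<epsilon> < dev k"
      using that lo n1 by (auto simp: n2_def)
    have m1: "t \<le> \<mu> k" "t \<le> \<mu> (Suc k)" using lk root_lo_le[of k] t by auto
    \<comment> \<open>Two steps are taken together, since the factor of a single step may be less
      than 1. By \<open>root_poly\<close> the product of both exceeds \<open>(dev k)\<^sup>2\<close>
      by the quantity bounded here.\<close>
    have "\<epsilon> * (2 * dev k) \<le> (root_lo k - t) * (root_hi k - t)"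
      using lk root_gap[of k] t dev_pos[of k] by (intro mult_mono) (auto simp: \<epsilon>_def)
    then have "dev k * (dev k + 2 * \<epsilon>) \<le> (\<mu> k - t) * (\<mu> (Suc k) - t)"
      unfolding root_poly by (simp add: power2_eq_square algebra_simps)
    then have "dev k * (dev k + 2 * \<epsilon>) * ?N k \<le> (\<mu> k - t) * (\<mu> (Suc k) - t) * ?N k"
      by (rule mult_right_mono) simp
    also have "\<dots> = (\<mu> (Suc k) - t) * ((\<mu> k - t) * ?N k)" by simp
    also have "\<dots> \<le> (\<mu> (Suc k) - t) * (dev k * ?N (Suc k))"
      using m1 by (intro mult_left_mono F_step_ge) auto
    also have "\<dots> = dev k * ((\<mu> (Suc k) - t) * ?N (Suc k))" by simp
    also have "\<dots> \<le> dev k * (dev (Suc k) * ?N (Suc (Suc k)))"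
      using m1 dev_pos[of k] by (intro mult_left_mono F_step_ge) auto
    finally have "(dev k + 2 * \<epsilon>) * ?N k \<le> dev (Suc k) * ?N (Suc (Suc k))"
      using dev_pos[of k] by (simp add: mult.assoc)
    also have "\<dots> \<le> dev_lim * ?N (Suc (Suc k))"
      by (intro mult_right_mono dev_le_lim) simp
    finally have "(dev k + 2 * \<epsilon>) * ?N k \<le> dev_lim * ?N (Suc (Suc k))" .
    moreover have "(dev_lim + \<epsilon>) * ?N k \<le> (dev k + 2 * \<epsilon>) * ?N k"
      using dk by (intro mult_right_mono) auto
    ultimately show ?thesis by linarith
  qed
  define \<rho> where "\<rho> = (dev_lim + \<epsilon>) / dev_lim"
  have \<rho>: "1 < \<rho>" using dev_lim_pos t by (simp add: \<rho>_def)
  have geo: "\<rho> ^ j * ?N n2 \<le> ?N (n2 + 2 * j)" for j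
  proof (induction j)
    case (Suc j)
    have "\<rho> * ?N (n2 + 2 * j) \<le> ?N (Suc (Suc (n2 + 2 * j)))"
      using grow[of "n2 + 2 * j"] dev_lim_pos by (simp add: \<rho>_def field_simps)
    moreover have "\<rho> * (\<rho> ^ j * ?N n2) \<le> \<rho> * ?N (n2 + 2 * j)"
      using Suc \<rho> by (intro mult_left_mono) auto
    ultimately show ?case by (simp add: mult.assoc)
  qed simp
  obtain j where "1 / ?N n2 < \<rho> ^ j" using real_arch_pow[OF \<rho>] by blast
  then have "1 < \<rho> ^ j * ?N n2" using F_z_pos[OF t(1), of n2] by (simp add: field_simps)
  then show False using geo[of j] norm_F_z_le[of t "n2 + 2 * j"] by linarith
qed

text \<open>A threshold independent of k: \<open>dev_sq_le\<close> and
  \<open>dev 0 \<le> dev k\<close> put every \<mu> k at or above it, while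
  \<open>dev 0 \<le> M - m\<close> keeps it at least \<open>dev 0\<close> below every upper
  root.\<close>

definition bar :: real where "bar = m + (dev 0)\<^sup>2 / (M - m)"

lemma bar_gt: "m < bar"
  using dev_pos[of 0] m_less_M by (simp add: bar_def)

lemma bar_le_\<mu>: "bar \<le> \<mu> k"
proof -
  have "(dev 0)\<^sup>2 \<le> (dev k)\<^sup>2"
    using dev_0_le[of k] dev_pos[of 0] by (intro power_mono) auto
  then have "(dev 0)\<^sup>2 \<le> (\<mu> k - m) * (M - m)" using dev_sq_le[of k] by (simp add: mult.commute)
  then have "(dev 0)\<^sup>2 / (M - m) \<le> \<mu> k - m" using m_less_M by (simp add: pos_divide_le_eq)
  then show ?thesis by (simp add: bar_def)
qed

lemma bar_le_hi: "bar + dev 0 \<le> root_hi k"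
proof -
  have "dev 0 * dev 0 \<le> dev 0 * (M - m)"
    using dev_le[of 0] dev_pos[of 0] by (intro mult_left_mono) auto
  then have "(dev 0)\<^sup>2 / (M - m) \<le> dev 0"
    using m_less_M by (simp add: pos_divide_le_eq power2_eq_square)
  then show ?thesis using root_lo_ge[of k] root_gap0[of k] by (simp add: bar_def)
qed

text \<open>In \<open>dev_le_F\<close> with r = \<open>bar\<close> the residual accounts for at most
  half of \<open>dev 0\<close>; the part below \<open>bar\<close> has to supply the rest.\<close>

lemma F_bar_ge:
  assumes "0 < c" "root_lo k + c \<le> bar" "norm (resid k) \<le> c * dev 0 / 2"
  shows "dev 0 / (4 * (M - m)) \<le> norm (F bar (z k))"
proof -
  have "norm (resid k) / (bar - root_lo k) \<le> (c * dev 0 / 2) / c"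
    using assms dev_pos[of 0] by (intro frac_le) auto
  also have "\<dots> = dev 0 / 2" using assms by simp
  finally have "dev 0 / 2 \<le> 2 * (M - m) * norm (F bar (z k))"
    using dev_le_F[of k bar] assms dev_0_le[of k] by linarith
  then show ?thesis using m_less_M by (simp add: field_simps)
qed

text \<open>Below \<open>bar \<le> \<mu> k\<close> a step amplifies lower spectral components more than higher ones.\<close>

lemma slice_ratio_mono:
  assumes "m < s" "s < bar"
  shows "decseq (\<lambda>k. norm (slice s bar (z k)) / norm (F s (z k)))"
proof (rule decseq_SucI)
  fix k
  let ?K = "\<lambda>k. norm (slice s bar (z k))" and ?N = "\<lambda>k. norm (F s (z k))"
  have N: "0 < ?N k" "0 < ?N (Suc k)" using F_z_pos[OF assms(1)] by auto
  have "dev k * (?K (Suc k) * ?N k) = (dev k * ?K (Suc k)) * ?N k" by simp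
  also have "\<dots> \<le> ((\<mu> k - s) * ?K k) * ?N k"
    using assms bar_le_\<mu> by (intro mult_right_mono slice_step_le) auto
  also have "\<dots> = ?K k * ((\<mu> k - s) * ?N k)" by simp
  also have "\<dots> \<le> ?K k * (dev k * ?N (Suc k))"
    using assms bar_le_\<mu>[of k] by (intro mult_left_mono F_step_ge) auto
  finally have "?K (Suc k) * ?N k \<le> ?K k * ?N (Suc k)"
    using dev_pos[of k] by (simp add: mult.left_commute)
  then show "?K (Suc k) / ?N (Suc k) \<le> ?K k / ?N k" using N by (simp add: field_simps)
qed

text \<open>One good time suffices. When the lower root is near m and the residual is small, the
  slice lies strictly between the roots and is small, while the part below \<open>bar\<close> is
  not; so the ratio of \<open>slice_ratio_mono\<close> drops below \<theta> and stays there.\<close>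

lemma slice_tendsto:
  assumes s: "m < s" "s < bar"
  shows "(\<lambda>k. norm (slice s bar (z k))) \<longlonglongrightarrow> 0"
proof (rule LIMSEQ_I)
  fix \<theta> :: real assume \<theta>: "0 < \<theta>"
  let ?K = "\<lambda>k. norm (slice s bar (z k))" and ?N = "\<lambda>k. norm (F s (z k))"
  define c where "c = (s - m) / 2"
  define L where "L = dev 0 / (4 * (M - m))"
  \<comment> \<open>The entry L / 2 leaves at least that much below s; the other one then bounds the
    ratio by \<theta> / 2.\<close>
  define \<tau> where "\<tau> = min (L / 2) (\<theta> * (L / 4))"
  have pos: "0 < c" "0 < L" "0 < dev 0" "0 < \<tau>"
    using s dev_pos[of 0] m_less_M \<theta> by (auto simp: c_def L_def \<tau>_def)
  \<comment> \<open>The first entry serves \<open>F_bar_ge\<close>, the second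
    \<open>slice_root_bound\<close>.\<close>
  define \<eta> where "\<eta> = min (c * dev 0 / 2) (c * (dev 0 * \<tau>))"
  have "0 < \<eta>" using pos by (simp add: \<eta>_def)
  then have "eventually (\<lambda>k. norm (resid k) < \<eta>) sequentially"
    using resid_tendsto by (intro order_tendstoD) auto
  then obtain n where n: "\<And>k. n \<le> k \<Longrightarrow> norm (resid k) < \<eta>"
    by (auto simp: eventually_sequentially)
  obtain k where k: "n \<le> k" "root_lo k < m + c"
    using root_lo_frequently[of "m + c" n] pos by auto
  have lo: "root_lo k + c \<le> s" using k by (simp add: c_def field_simps)
  have e: "norm (resid k) < \<eta>" using n k by simp
  have LN: "L \<le> norm (F bar (z k))"
    unfolding L_def using lo s pos e by (intro F_bar_ge[of c]) (auto simp: \<eta>_def)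
  have hi: "dev 0 \<le> root_hi k - bar" using bar_le_hi[of k] by simp
  have "c * (dev 0 * ?K k) \<le> (s - root_lo k) * ((root_hi k - bar) * ?K k)"
    using lo hi pos by (intro mult_mono mult_right_mono) auto
  also have "\<dots> \<le> norm (resid k)"
    using lo hi s pos by (intro slice_root_bound) auto
  also have "\<dots> < c * (dev 0 * \<tau>)" using e by (simp add: \<eta>_def)
  finally have K: "?K k < \<tau>" using pos by simp
  have "norm (F bar (z k)) \<le> ?N k + ?K k"
    using norm_triangle_ineq[of "F s (z k)" "slice s bar (z k)"] by (simp add: slice_apply)
  then have "L / 2 \<le> ?N k" using LN K by (simp add: \<tau>_def)
  then have "?K k / ?N k \<le> \<tau> / (L / 2)"
    using K pos by (intro frac_le) auto
  also have "\<dots> \<le> (\<theta> * (L / 4)) / (L / 2)"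
    using pos by (intro divide_right_mono) (auto simp: \<tau>_def)
  also have "\<dots> < \<theta>" using pos \<theta> by simp
  finally have ratio: "?K k / ?N k < \<theta>" .
  show "\<exists>n. \<forall>j\<ge>n. norm (?K j - 0) < \<theta>"
  proof (intro exI allI impI)
    fix j assume "k \<le> j"
    then have "?K j / ?N j < \<theta>"
      using slice_ratio_mono[OF s] ratio unfolding decseq_def by (meson le_less_trans)
    then have "?K j < \<theta> * ?N j" using F_z_pos[OF s(1), of j] by (simp add: pos_divide_less_eq)
    also have "\<dots> \<le> \<theta>" using norm_F_z_le[of s j] \<theta> by (simp add: mult_left_le)
    finally show "norm (?K j - 0) < \<theta>" by simp
  qed
qed

text \<open>The lower root cannot cross a narrow band above \<open>m\<close>: in the band \<open>z k\<close> would have almost no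
  component below \<open>bar\<close>.\<close>

lemma root_lo_tendsto: "root_lo \<longlonglongrightarrow> m"
proof (rule LIMSEQ_I)
  fix \<theta> :: real assume \<theta>: "0 < \<theta>"
  \<comment> \<open>The band reaches from m + 2 * \<eta> to m + 3 * \<eta>, at distance \<eta> or
    more from both s = m + \<eta> and \<open>bar\<close>. Its width \<eta> also bounds the late
    steps of \<open>root_lo\<close>, which therefore cannot jump over it.\<close>
  define \<eta> where "\<eta> = min (\<theta> / 4) ((bar - m) / 4)"
  have "\<eta> \<le> \<theta> / 4" "\<eta> \<le> (bar - m) / 4" unfolding \<eta>_def by (rule min.cobounded1, rule min.cobounded2)
  moreover have "0 < \<eta>" using \<theta> bar_gt by (simp add: \<eta>_def)
  ultimately have \<eta>: "0 < \<eta>" "2 * \<eta> < \<theta>" "m + 4 * \<eta> \<le> bar"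
    using \<theta> by (simp_all add: field_simps)
  define s where "s = m + \<eta>"
  have s: "m < s" "s < bar" using \<eta> by (auto simp: s_def)
  define L where "L = dev 0 / (4 * (M - m))"
  have pos: "0 < L" "0 < dev 0" using dev_pos[of 0] m_less_M by (auto simp: L_def)
  \<comment> \<open>The first entry serves \<open>F_bar_ge\<close>; the second serves
    \<open>F_root_bound\<close>, where s is at least \<eta> below the lower and 2 * dev 0 below the
    upper root.\<close>
  define \<kappa> where "\<kappa> = min (\<eta> * dev 0 / 2) (\<eta> * (2 * dev 0 * (L / 4)))"
  have "0 < \<kappa>" using \<eta> pos by (simp add: \<kappa>_def)
  then have "eventually (\<lambda>k. norm (resid k) < \<kappa>) sequentially"
    using resid_tendsto by (intro order_tendstoD) auto
  moreover have "eventually (\<lambda>k. norm (slice s bar (z k)) < L / 4) sequentially"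
    using slice_tendsto[OF s] pos by (intro order_tendstoD) auto
  moreover have "eventually (\<lambda>k. root_lo (Suc k) - root_lo k < \<eta>) sequentially"
    using root_lo_step \<eta> by (intro order_tendstoD) auto
  ultimately have "eventually (\<lambda>k. norm (resid k) < \<kappa> \<and> norm (slice s bar (z k)) < L / 4
      \<and> root_lo (Suc k) - root_lo k < \<eta>) sequentially"
    by (intro eventually_conj)
  then obtain n where n: "\<And>k. n \<le> k \<Longrightarrow> norm (resid k) < \<kappa>"
      "\<And>k. n \<le> k \<Longrightarrow> norm (slice s bar (z k)) < L / 4"
      "\<And>k. n \<le> k \<Longrightarrow> root_lo (Suc k) - root_lo k < \<eta>"
    by (auto simp: eventually_sequentially)
  have band: "\<not> (m + 2 * \<eta> \<le> root_lo k \<and> root_lo k \<le> m + 3 * \<eta>)" if k: "n \<le> k" for k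
  proof
    assume b: "m + 2 * \<eta> \<le> root_lo k \<and> root_lo k \<le> m + 3 * \<eta>"
    have LN: "L \<le> norm (F bar (z k))"
      unfolding L_def using b \<eta> n(1)[OF k] by (intro F_bar_ge[of \<eta>]) (auto simp: \<kappa>_def)
    have "\<eta> * (2 * dev 0 * norm (F s (z k))) \<le> (root_lo k - s) * ((root_hi k - s) * norm (F s (z k)))"
      using b \<eta> pos root_gap0[of k] by (intro mult_mono mult_right_mono) (auto simp: s_def)
    also have "\<dots> \<le> norm (resid k)" using b \<eta> by (intro F_root_bound) (auto simp: s_def)
    also have "\<dots> < \<eta> * (2 * dev 0 * (L / 4))" using n(1)[OF k] by (simp add: \<kappa>_def)
    finally have "norm (F s (z k)) < L / 4" using \<eta> pos by simp
    moreover have "norm (F bar (z k)) \<le> norm (F s (z k)) + norm (slice s bar (z k))"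
      using norm_triangle_ineq[of "F s (z k)" "slice s bar (z k)"] by (simp add: slice_apply)
    ultimately show False using n(2)[OF k] LN pos by linarith
  qed
  obtain k0 where k0: "n \<le> k0" "root_lo k0 < m + 2 * \<eta>"
    using root_lo_frequently[of "m + 2 * \<eta>" n] \<eta> by auto
  \<comment> \<open>\<open>root_lo_frequently\<close> gives one late visit below the band; the
    forbidden band makes it permanent.\<close>
  have stay: "root_lo k < m + 2 * \<eta>" if "k0 \<le> k" for k
    using that
  proof (induction rule: dec_induct)
    case (step k)
    then show ?case using n(3)[of k] band[of "Suc k"] k0 by force
  qed (use k0 in simp)
  show "\<exists>n. \<forall>k\<ge>n. norm (root_lo k - m) < \<theta>"
  proof (intro exI allI impI)
    fix k assume "k0 \<le> k"
    then show "norm (root_lo k - m) < \<theta>"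
      using stay[of k] root_lo_ge[of k] \<eta> by simp
  qed
qed

end

section \<open>Convergence to a two-point attractor\<close>

text \<open>The small product confines s to the neighbourhoods of radius d of the two points. They
  are d apart, so steps shorter than d cannot lead from one to the other.\<close>

lemma two_limits_aux:
  fixes s :: "nat \<Rightarrow> real"
  assumes lim: "(\<lambda>n. (s n - \<alpha>) * (s n - \<beta>)) \<longlonglongrightarrow> 0"
    and d: "0 < d" "3 * d = \<bar>\<alpha> - \<beta>\<bar>"
    and n0: "\<And>k. n0 \<le> k \<Longrightarrow> \<bar>(s k - \<alpha>) * (s k - \<beta>)\<bar> < d * d"
      "\<And>k. n0 \<le> k \<Longrightarrow> \<bar>s (Suc k) - s k\<bar> < d"
    and start: "\<bar>s n0 - \<alpha>\<bar> < d"
  shows "s \<longlonglongrightarrow> \<alpha>"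
proof -
  have close: "\<bar>s k - \<alpha>\<bar> < d \<or> \<bar>s k - \<beta>\<bar> < d" if "n0 \<le> k" for k
  proof (rule ccontr)
    assume "\<not> ?thesis"
    then have "d * d \<le> \<bar>s k - \<alpha>\<bar> * \<bar>s k - \<beta>\<bar>" using d by (intro mult_mono) auto
    then show False using n0(1)[OF that] by (simp add: abs_mult)
  qed
  have stay: "\<bar>s k - \<alpha>\<bar> < d" if "n0 \<le> k" for k
    using that
  proof (induction rule: dec_induct)
    case (step k)
    then show ?case using n0(2)[of k] close[of "Suc k"] d by linarith
  qed (rule start)
  have le: "\<bar>s k - \<alpha>\<bar> \<le> \<bar>(s k - \<alpha>) * (s k - \<beta>)\<bar> / (2 * d)" if "n0 \<le> k" for k
  proof -
    have "2 * d \<le> \<bar>s k - \<beta>\<bar>" using stay[OF that] d by linarith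
    then have "\<bar>s k - \<alpha>\<bar> * (2 * d) \<le> \<bar>s k - \<alpha>\<bar> * \<bar>s k - \<beta>\<bar>" by (intro mult_left_mono) auto
    then show ?thesis using d by (simp add: abs_mult pos_le_divide_eq)
  qed
  have "(\<lambda>k. s k - \<alpha>) \<longlonglongrightarrow> 0"
  proof (rule Lim_null_comparison)
    show "eventually (\<lambda>k. norm (s k - \<alpha>) \<le> \<bar>(s k - \<alpha>) * (s k - \<beta>)\<bar> / (2 * d)) sequentially"
      using le by (auto simp: eventually_sequentially)
    show "(\<lambda>k. \<bar>(s k - \<alpha>) * (s k - \<beta>)\<bar> / (2 * d)) \<longlonglongrightarrow> 0"
      using tendsto_divide[OF tendsto_rabs[OF lim] tendsto_const, of "2 * d"] d by simp
  qed
  then show ?thesis by (simp add: LIM_zero_iff)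
qed

lemma two_limits:
  fixes s :: "nat \<Rightarrow> real"
  assumes lim: "(\<lambda>n. (s n - \<alpha>) * (s n - \<beta>)) \<longlonglongrightarrow> 0" and step: "(\<lambda>n. s (Suc n) - s n) \<longlonglongrightarrow> 0"
  shows "s \<longlonglongrightarrow> \<alpha> \<or> s \<longlonglongrightarrow> \<beta>"
proof (cases "\<alpha> = \<beta>")
  case True
  have "(\<lambda>n. sqrt ((s n - \<alpha>) * (s n - \<alpha>))) \<longlonglongrightarrow> sqrt 0"
    using lim True by (intro tendsto_intros) simp
  then have "(\<lambda>n. s n - \<alpha>) \<longlonglongrightarrow> 0" by (simp add: tendsto_rabs_zero_iff)
  then show ?thesis by (simp add: LIM_zero_iff)
next
  case False
  define d where "d = \<bar>\<alpha> - \<beta>\<bar> / 3"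
  have d: "0 < d" "3 * d = \<bar>\<alpha> - \<beta>\<bar>" using False by (auto simp: d_def)
  have "eventually (\<lambda>k. \<bar>(s k - \<alpha>) * (s k - \<beta>)\<bar> < d * d \<and> \<bar>s (Suc k) - s k\<bar> < d) sequentially"
    using tendsto_rabs_zero[OF lim] tendsto_rabs_zero[OF step] d
    by (intro eventually_conj) (auto intro!: order_tendstoD(2)[where y=0])
  then obtain n0 where n0: "\<And>k. n0 \<le> k \<Longrightarrow> \<bar>(s k - \<alpha>) * (s k - \<beta>)\<bar> < d * d"
      "\<And>k. n0 \<le> k \<Longrightarrow> \<bar>s (Suc k) - s k\<bar> < d"
    by (auto simp: eventually_sequentially)
  have "\<bar>s n0 - \<alpha>\<bar> < d \<or> \<bar>s n0 - \<beta>\<bar> < d"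
  proof (rule ccontr)
    assume "\<not> ?thesis"
    then have "d * d \<le> \<bar>s n0 - \<alpha>\<bar> * \<bar>s n0 - \<beta>\<bar>" using d by (intro mult_mono) auto
    then show False using n0(1)[of n0] by (simp add: abs_mult)
  qed
  then show ?thesis
  proof
    assume "\<bar>s n0 - \<alpha>\<bar> < d"
    then show ?thesis using two_limits_aux[OF lim d n0] by blast
  next
    assume s: "\<bar>s n0 - \<beta>\<bar> < d"
    have "s \<longlonglongrightarrow> \<beta>"
      by (rule two_limits_aux[of s \<beta> \<alpha> d n0])
        (use lim d n0 s in \<open>simp_all add: mult.commute abs_minus_commute\<close>)
    then show ?thesis ..
  qed
qed

lemma LIMSEQ_even_odd_split:
  fixes f :: "nat \<Rightarrow> 'b::real_normed_vector"
  assumes "(\<lambda>n. f (2 * n)) \<longlonglongrightarrow> a" "(\<lambda>n. f (2 * n + 1)) \<longlonglongrightarrow> b"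
  shows "(\<lambda>k. f k - (if even k then a else b)) \<longlonglongrightarrow> 0"
  by (rule limseq_even_odd) (use assms in \<open>simp_all add: LIM_zero\<close>)

section \<open>Reversal of the spectrum and the upper root\<close>

locale two_sided_steps = normalized_steps T F m M 1 z
  for T :: "'a::real_inner \<Rightarrow>\<^sub>L 'a" and F m M z +
  assumes F_z0_top: "s < M \<Longrightarrow> F s (z 0) \<noteq> z 0"
begin

text \<open>The reversed projection belongs to the part where - T is below s, with the end point
  treated the opposite way; a right continuous family becomes left continuous. The locale axioms are
  those common to both conventions. The sign \<sigma> = - 1 compensates that of - T.\<close>

lemma reversed: "normalized_steps (- T) (\<lambda>s. id_blinfun - F (- s)) (- M) (- m) (- 1) z"
proof
  show "(- T) x \<bullet> y = x \<bullet> (- T) y" for x y by (simp add: blinfun.minus_left T_sym)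
  show "(id_blinfun - F (- s)) x \<bullet> y = x \<bullet> (id_blinfun - F (- s)) y" for s x y
    by (simp add: blinfun.diff_left inner_diff_left inner_diff_right F_sym)
  show "(id_blinfun - F (- s)) ((id_blinfun - F (- t)) x) = (id_blinfun - F (- min s t)) x" for s t x
    by (simp add: blinfun.diff_left blinfun.diff_right F_F minus_min_eq_max)
      (auto simp: min_def max_def)
  show "(id_blinfun - F (- s)) ((- T) x) = (- T) ((id_blinfun - F (- s)) x)" for s x
    by (simp add: blinfun.diff_left blinfun.diff_right blinfun.minus_left blinfun.minus_right F_T)
  show "(- T) ((id_blinfun - F (- s)) x) \<bullet> (id_blinfun - F (- s)) x
      \<le> s * ((id_blinfun - F (- s)) x \<bullet> (id_blinfun - F (- s)) x)" for s x
    using F_lower[of "- s" x] by (simp add: blinfun.diff_left blinfun.minus_left)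
  show "s * ((x - (id_blinfun - F (- s)) x) \<bullet> (x - (id_blinfun - F (- s)) x))
      \<le> (- T) (x - (id_blinfun - F (- s)) x) \<bullet> (x - (id_blinfun - F (- s)) x)" for s x
    using F_upper[of "- s" x] by (simp add: blinfun.diff_left blinfun.minus_left)
  show "- M * (x \<bullet> x) \<le> (- T) x \<bullet> x" for x using T_le[of x] by (simp add: blinfun.minus_left)
  show "(- T) x \<bullet> x \<le> - m * (x \<bullet> x)" for x using T_ge[of x] by (simp add: blinfun.minus_left)
  show "- M < - m" using m_less_M by simp
  show "(- 1 :: real) * - 1 = 1" by simp
  show "norm (z k) = 1" for k by (rule unit)
  have dev: "norm ((- T) (z k) - ((- T) (z k) \<bullet> z k) *\<^sub>R z k) = dev k" for k
    by (simp add: dev_def \<mu>_def blinfun.minus_left norm_minus_commute)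
  show "0 < norm ((- T) (z k) - ((- T) (z k) \<bullet> z k) *\<^sub>R z k)" for k
    unfolding dev by (rule dev_pos)
  show "norm ((- T) (z k) - ((- T) (z k) \<bullet> z k) *\<^sub>R z k) *\<^sub>R z (Suc k)
      = - 1 *\<^sub>R (((- T) (z k) \<bullet> z k) *\<^sub>R z k - (- T) (z k))" for k
    unfolding dev step by (simp add: \<mu>_def blinfun.minus_left)
  show "(id_blinfun - F (- s)) (z 0) \<noteq> 0" if "- M < s" for s
    using F_z0_top[of "- s"] that by (simp add: blinfun.diff_left)
qed

text \<open>Reversal keeps \<open>dev\<close> and \<open>disc\<close> and changes the sign of \<mu>,
  so the lower root for - T is \<open>- root_hi k\<close>.\<close>

lemma root_hi_tendsto: "root_hi \<longlonglongrightarrow> M"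
proof -
  interpret rev: normalized_steps "- T" "\<lambda>s. id_blinfun - F (- s)" "- M" "- m" "- 1" z
    by (rule reversed)
  have \<mu>: "rev.\<mu> k = - \<mu> k" for k by (simp add: rev.\<mu>_def \<mu>_def blinfun.minus_left)
  have dev: "rev.dev k = dev k" for k
    by (simp add: rev.dev_def dev_def \<mu> blinfun.minus_left norm_minus_commute)
  have "rev.disc k = disc k" for k
    by (simp add: rev.disc_def disc_def \<mu> dev power2_eq_square algebra_simps)
  then have "rev.root_lo k = - root_hi k" for k
    by (simp add: rev.root_lo_def root_hi_def \<mu> field_simps)
  then have "rev.root_lo = (\<lambda>k. - root_hi k)" by (rule ext)
  then show ?thesis
    using tendsto_minus[OF rev.root_lo_tendsto] by simp
qed

lemma F_z_top: "s < M \<Longrightarrow> 0 < norm (z k - F s (z k))"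
proof -
  interpret rev: normalized_steps "- T" "\<lambda>s. id_blinfun - F (- s)" "- M" "- m" "- 1" z
    by (rule reversed)
  show "s < M \<Longrightarrow> 0 < norm (z k - F s (z k))"
    using rev.F_z_pos[of "- s" k] by (simp add: blinfun.diff_left)
qed

text \<open>This is (T - m) (T - M) z k, the residual with both roots replaced by their
  limits.\<close>

definition annih :: "nat \<Rightarrow> 'a" where
  "annih k = T (T (z k)) - (m + M) *\<^sub>R T (z k) + (m * M) *\<^sub>R z k"

lemma annih_tendsto: "(\<lambda>k. norm (annih k)) \<longlonglongrightarrow> 0"
proof (rule Lim_null_comparison[OF always_eventually])
  let ?b = "\<lambda>k. norm (resid k) + \<bar>root_lo k + root_hi k - (m + M)\<bar> * norm T
    + \<bar>m * M - root_lo k * root_hi k\<bar>"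
  show "\<forall>k. norm (norm (annih k)) \<le> ?b k"
  proof
    fix k
    have "annih k = resid k + (root_lo k + root_hi k - (m + M)) *\<^sub>R T (z k)
        + (m * M - root_lo k * root_hi k) *\<^sub>R z k"
      unfolding annih_def resid_eq by (simp add: algebra_simps)
    then have "norm (annih k) \<le> norm (resid k) + norm ((root_lo k + root_hi k - (m + M)) *\<^sub>R T (z k))
        + norm ((m * M - root_lo k * root_hi k) *\<^sub>R z k)"
      by (metis norm_triangle_ineq norm_triangle_mono order_refl)
    also have "\<dots> \<le> ?b k"
      using norm_blinfun[of T "z k"] by (auto simp: unit intro!: mult_left_mono)
    finally show "norm (norm (annih k)) \<le> ?b k" by simp
  qed
  have "?b \<longlonglongrightarrow> 0 + \<bar>m + M - (m + M)\<bar> * norm T + \<bar>m * M - m * M\<bar>"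
    by (intro tendsto_intros resid_tendsto root_lo_tendsto root_hi_tendsto)
  then show "?b \<longlonglongrightarrow> 0" by simp
qed

section \<open>Approximate eigenvectors at both ends and their weights\<close>

definition mid :: real where "mid = (m + M) / 2"

lemma mid_less: "m < mid" "mid < M" "M - mid = (M - m) / 2" "mid - m = (M - m) / 2"
  using m_less_M by (auto simp: mid_def field_simps)

definition lo :: "nat \<Rightarrow> 'a" where "lo k = F mid (z k)"

definition hi :: "nat \<Rightarrow> 'a" where "hi k = z k - F mid (z k)"

lemma lo_hi: "lo k + hi k = z k"
  by (simp add: lo_def hi_def)

text \<open>On the range of \<open>F mid\<close> the factor T - M expands by at least (M - m) / 2,
  and it takes (T - m) \<open>lo k\<close> to the projection of \<open>annih k\<close>.\<close>

lemma lo_bound: "norm (T (lo k) - m *\<^sub>R lo k) \<le> 2 / (M - m) * norm (annih k)"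
proof -
  define y where "y = T (z k) - m *\<^sub>R z k"
  have "(M - mid) * norm (F mid y) \<le> norm (T (F mid y) - M *\<^sub>R F mid y)"
    using mid_less by (intro shift_below_le) simp
  also have "T (F mid y) - M *\<^sub>R F mid y = F mid (annih k)"
    by (simp add: y_def annih_def blinfun.diff_right blinfun.add_right blinfun.scaleR_right F_T algebra_simps)
  also have "norm \<dots> \<le> norm (annih k)" by (rule norm_F_le)
  finally have "norm (F mid y) \<le> 2 / (M - m) * norm (annih k)"
    using m_less_M by (simp add: mid_less field_simps)
  then show ?thesis by (simp add: y_def lo_def blinfun.diff_right blinfun.scaleR_right F_T)
qed

lemma hi_bound: "norm (T (hi k) - M *\<^sub>R hi k) \<le> 2 / (M - m) * norm (annih k)"
proof -
  define y where "y = T (z k) - M *\<^sub>R z k"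
  have "(mid - m) * norm (y - F mid y) \<le> norm (T (y - F mid y) - m *\<^sub>R (y - F mid y))"
    using mid_less by (intro shift_above_le) simp
  also have "T (y - F mid y) - m *\<^sub>R (y - F mid y) = annih k - F mid (annih k)"
    by (simp add: y_def annih_def blinfun.diff_right blinfun.add_right blinfun.scaleR_right F_T algebra_simps)
  also have "norm \<dots> \<le> norm (annih k)" by (rule norm_F_compl_le)
  finally have "norm (y - F mid y) \<le> 2 / (M - m) * norm (annih k)"
    using m_less_M by (simp add: mid_less field_simps)
  moreover have "y - F mid y = T (hi k) - M *\<^sub>R hi k"
    by (simp add: y_def hi_def blinfun.diff_right blinfun.scaleR_right F_T algebra_simps)
  ultimately show ?thesis by simp
qed

lemma lo_hi_norm: "(norm (lo k))\<^sup>2 + (norm (hi k))\<^sup>2 = 1"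
  using F_pythagoras[of "z k" mid] by (simp add: lo_def hi_def unit)

lemma lo_hi_ortho: "lo k \<bullet> hi k = 0"
  by (simp add: lo_def hi_def F_ortho)

text \<open>The mass at m of the probability distribution on {m, M} with mean \<mu> k. It stands in
  for the squared norm of \<open>lo k\<close>, because the limit laws are known for \<mu>.\<close>

definition weight :: "nat \<Rightarrow> real" where "weight k = (M - \<mu> k) / (M - m)"

lemma weight_bound: "\<bar>(norm (lo k))\<^sup>2 - weight k\<bar> \<le> 4 / (M - m)\<^sup>2 * norm (annih k)"
proof -
  define e1 where "e1 = (T (lo k) - m *\<^sub>R lo k) \<bullet> z k"
  define e2 where "e2 = (T (hi k) - M *\<^sub>R hi k) \<bullet> z k"
  have e: "\<bar>e1\<bar> \<le> 2 / (M - m) * norm (annih k)" "\<bar>e2\<bar> \<le> 2 / (M - m) * norm (annih k)"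
    unfolding e1_def e2_def
    using lo_bound[of k] hi_bound[of k] Cauchy_Schwarz_ineq2[of _ "z k"] unit[of k]
    by (metis mult.right_neutral order_trans)+
  have "T (z k) \<bullet> z k = T (lo k) \<bullet> z k + T (hi k) \<bullet> z k"
    by (metis blinfun.add_right inner_add_left lo_hi)
  then have mu: "\<mu> k = m * (lo k \<bullet> z k) + M * (hi k \<bullet> z k) + (e1 + e2)"
    by (simp add: \<mu>_def e1_def e2_def inner_diff_left)
  have lo_z: "lo k \<bullet> z k = (norm (lo k))\<^sup>2"
    using lo_hi_ortho[of k] by (simp add: lo_hi[symmetric] inner_add_right power2_norm_eq_inner)
  have hi_z: "hi k \<bullet> z k = 1 - (norm (lo k))\<^sup>2"
    using lo_hi_ortho[of k] lo_hi_norm[of k]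
    by (simp add: lo_hi[symmetric] inner_add_right inner_commute power2_norm_eq_inner)
  have "\<mu> k = M - (M - m) * (norm (lo k))\<^sup>2 + (e1 + e2)"
    unfolding mu lo_z hi_z by (simp add: algebra_simps)
  then have "(norm (lo k))\<^sup>2 - weight k = (e1 + e2) / (M - m)"
    using m_less_M by (simp add: weight_def field_simps)
  then have "\<bar>(norm (lo k))\<^sup>2 - weight k\<bar> = \<bar>e1 + e2\<bar> / (M - m)"
    using m_less_M by simp
  also have "\<dots> \<le> (4 / (M - m) * norm (annih k)) / (M - m)"
    using e m_less_M by (intro divide_right_mono) auto
  finally show ?thesis by (simp add: power2_eq_square)
qed

lemma lo_weight: "(\<lambda>k. (norm (lo k))\<^sup>2 - weight k) \<longlonglongrightarrow> 0"
  by (rule Lim_null_comparison[OF always_eventually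
        tendsto_mult_right_zero[OF annih_tendsto, of "4 / (M - m)\<^sup>2"]])
    (unfold real_norm_def, rule allI, rule weight_bound)

text \<open>(M - \<mu> k) (\<mu> k - m) is the variance of that two-point distribution; it differs
  from \<open>(dev k)\<^sup>2\<close> by \<open>annih k \<bullet> z k\<close>.\<close>

lemma weight_product: "(\<lambda>k. weight k * (1 - weight k)) \<longlonglongrightarrow> (dev_lim / (M - m))\<^sup>2"
proof -
  have eq: "weight k * (1 - weight k) = ((dev k)\<^sup>2 - annih k \<bullet> z k) / (M - m)\<^sup>2" for k
  proof -
    have "annih k \<bullet> z k = (dev k)\<^sup>2 - (M - \<mu> k) * (\<mu> k - m)"
      unfolding dev_sq annih_def
      by (simp add: inner_add_left inner_diff_left zz T_sym[of "T (z k)"] \<mu>_def[symmetric] power2_eq_square algebra_simps)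
    moreover have "1 - weight k = (\<mu> k - m) / (M - m)"
      using m_less_M by (simp add: weight_def field_simps)
    ultimately show ?thesis by (simp add: weight_def power2_eq_square)
  qed
  have "(\<lambda>k. annih k \<bullet> z k) \<longlonglongrightarrow> 0"
    by (rule Lim_null_comparison[OF always_eventually annih_tendsto])
      (metis Cauchy_Schwarz_ineq2 mult.right_neutral real_norm_def unit)
  then have "(\<lambda>k. ((dev k)\<^sup>2 - annih k \<bullet> z k) / (M - m)\<^sup>2) \<longlonglongrightarrow> (dev_lim\<^sup>2 - 0) / (M - m)\<^sup>2"
    using m_less_M by (intro tendsto_intros dev_tendsto) auto
  then show ?thesis unfolding eq by (simp add: power_divide)
qed

lemma weight_two_step: "(\<lambda>k. weight (Suc (Suc k)) - weight k) \<longlonglongrightarrow> 0"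
proof -
  have "weight (Suc (Suc k)) - weight k = - (\<mu> (Suc (Suc k)) - \<mu> k) / (M - m)" for k
    by (simp add: weight_def diff_divide_distrib)
  then show ?thesis
    using tendsto_divide[OF tendsto_minus[OF \<mu>_two_step] tendsto_const, of "M - m"] m_less_M by simp
qed

text \<open>The sum of the two roots is \<mu> k + \<mu> (Suc k) and tends to m + M. This is the swap
  of the weights at each step.\<close>

lemma weight_sum: "(\<lambda>k. weight k + weight (Suc k)) \<longlonglongrightarrow> 1"
proof -
  have eq: "weight k + weight (Suc k) = (2 * M - (root_lo k + root_hi k)) / (M - m)" for k
    unfolding root_sum by (simp add: weight_def add_divide_distrib[symmetric])
  have "(\<lambda>k. (2 * M - (root_lo k + root_hi k)) / (M - m)) \<longlonglongrightarrow> (2 * M - (m + M)) / (M - m)"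
    using m_less_M by (intro tendsto_intros root_lo_tendsto root_hi_tendsto) simp
  then show ?thesis unfolding eq using m_less_M by simp
qed

lemma weight_limit:
  obtains p where "0 < p" "p < 1" "(\<lambda>n. weight (2 * n)) \<longlonglongrightarrow> p" "(\<lambda>n. weight (2 * n + 1)) \<longlonglongrightarrow> 1 - p"
proof -
  define c where "c = (dev_lim / (M - m))\<^sup>2"
  have c: "0 < c" using dev_lim_pos m_less_M by (simp add: c_def)
  have "weight k * (1 - weight k) \<le> 1 / 4" for k
    using zero_le_power2[of "weight k - 1 / 2"] by (simp add: power2_eq_square algebra_simps)
  then have c4: "c \<le> 1 / 4"
    using weight_product unfolding c_def by (intro LIMSEQ_le_const2) auto
  \<comment> \<open>The solutions of t (1 - t) = c are \<alpha> and 1 - \<alpha>, real because c is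
    at most 1 / 4. The number p is whichever of them the even weights approach.\<close>
  define \<alpha> where "\<alpha> = (1 + sqrt (1 - 4 * c)) / 2"
  have \<alpha>: "\<alpha> * (1 - \<alpha>) = c"
  proof -
    have "sqrt (1 - 4 * c) * sqrt (1 - 4 * c) = 1 - 4 * c" using c4 by simp
    then show ?thesis by (simp add: \<alpha>_def field_simps)
  qed
  have sub: "strict_mono (\<lambda>n::nat. 2 * n)" by (rule strict_monoI) simp
  have even: "(\<lambda>n. f (2 * n)) \<longlonglongrightarrow> l" if "f \<longlonglongrightarrow> l" for f :: "nat \<Rightarrow> real" and l
    using LIMSEQ_subseq_LIMSEQ[OF that sub] by (simp add: o_def)
  have "(\<lambda>n. c - weight (2 * n) * (1 - weight (2 * n))) \<longlonglongrightarrow> c - c"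
    using even[OF weight_product] unfolding c_def[symmetric] by (intro tendsto_intros)
  moreover have "(weight k - \<alpha>) * (weight k - (1 - \<alpha>)) = c - weight k * (1 - weight k)" for k
    using \<alpha> by (simp add: algebra_simps)
  ultimately have "(\<lambda>n. (weight (2 * n) - \<alpha>) * (weight (2 * n) - (1 - \<alpha>))) \<longlonglongrightarrow> 0" by simp
  moreover have "(\<lambda>n. weight (2 * Suc n) - weight (2 * n)) \<longlonglongrightarrow> 0"
    using even[OF weight_two_step] by simp
  ultimately have "(\<lambda>n. weight (2 * n)) \<longlonglongrightarrow> \<alpha> \<or> (\<lambda>n. weight (2 * n)) \<longlonglongrightarrow> 1 - \<alpha>"
    by (rule two_limits)
  then obtain p where p: "(\<lambda>n. weight (2 * n)) \<longlonglongrightarrow> p" "p * (1 - p) = c"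
    using \<alpha> by (auto simp: mult.commute)
  have "0 < p \<and> p < 1" using c p(2) by (auto simp: zero_less_mult_iff)
  moreover have "(\<lambda>n. weight (2 * n) + weight (Suc (2 * n)) - weight (2 * n)) \<longlonglongrightarrow> 1 - p"
    using even[OF weight_sum] p by (intro tendsto_intros) auto
  ultimately show ?thesis using p by (intro that[of p]) auto
qed

text \<open>The normalised parts of \<open>z k\<close> carry the coefficients
  \<open>norm (lo k)\<close> and \<open>norm (hi k)\<close>, which only tend to the required ones.
  The vectors u and v arise by rotating these parts in their plane through an angle that tends to
  0.\<close>

theorem two_point_limit:
  "\<exists>(p :: real) (u :: nat \<Rightarrow> 'a) (v :: nat \<Rightarrow> 'a).
     0 < p \<and> p < 1 \<and>
     (\<forall>k. z (2 * k) = sqrt p *\<^sub>R u (2 * k) + sqrt (1 - p) *\<^sub>R v (2 * k) \<and>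
          z (2 * k + 1) = sqrt (1 - p) *\<^sub>R u (2 * k + 1) - sqrt p *\<^sub>R v (2 * k + 1)) \<and>
     (\<forall>n. norm (u n) = 1 \<and> norm (v n) = 1) \<and>
     (\<lambda>n. norm (T (u n) - m *\<^sub>R u n)) \<longlonglongrightarrow> 0 \<and>
     (\<lambda>n. norm (T (v n) - M *\<^sub>R v n)) \<longlonglongrightarrow> 0"
proof -
  obtain p where p: "0 < p" "p < 1"
    and even: "(\<lambda>n. weight (2 * n)) \<longlonglongrightarrow> p" and odd: "(\<lambda>n. weight (2 * n + 1)) \<longlonglongrightarrow> 1 - p"
    by (rule weight_limit)
  define P where "P k = (if even k then sqrt p else sqrt (1 - p))" for k :: nat
  define Q where "Q k = (if even k then sqrt (1 - p) else sqrt p)" for k :: nat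
  define N where "N k = norm (lo k)" for k
  define N' where "N' k = norm (hi k)" for k
  have NN: "(N k)\<^sup>2 + (N' k)\<^sup>2 = 1" for k by (simp add: N_def N'_def lo_hi_norm)
  have PQ: "(P k)\<^sup>2 + (Q k)\<^sup>2 = 1" "0 \<le> P k" "0 \<le> Q k" for k
    using p by (auto simp: P_def Q_def)
  \<comment> \<open>Both parts are nonzero at every index, so u and v are unit vectors from the
    start and not just eventually.\<close>
  have N_pos: "0 < N k" "0 < N' k" for k
    using F_z_pos[OF mid_less(1), of k] F_z_top[OF mid_less(2), of k]
    by (simp_all add: N_def N'_def lo_def hi_def)
  have sub: "strict_mono (\<lambda>n::nat. 2 * n)" "strict_mono (\<lambda>n::nat. 2 * n + 1)"
    by (rule strict_monoI, simp)+
  have N_even: "(\<lambda>n. (N (2 * n))\<^sup>2) \<longlonglongrightarrow> p"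
    using tendsto_add[OF LIMSEQ_subseq_LIMSEQ[OF lo_weight sub(1)] even] by (simp add: o_def N_def)
  have N_odd: "(\<lambda>n. (N (2 * n + 1))\<^sup>2) \<longlonglongrightarrow> 1 - p"
    using tendsto_add[OF LIMSEQ_subseq_LIMSEQ[OF lo_weight sub(2)] odd] by (simp add: o_def N_def)
  have N_eq: "N k = sqrt ((N k)\<^sup>2)" "N' k = sqrt (1 - (N k)\<^sup>2)" for k
    using N_pos[of k] NN[of k] by (simp_all add: real_sqrt_unique algebra_simps)
  have "(\<lambda>k. sqrt ((N k)\<^sup>2) - P k) \<longlonglongrightarrow> 0"
    unfolding P_def by (intro LIMSEQ_even_odd_split tendsto_real_sqrt N_even N_odd)
  then have NP: "(\<lambda>k. N k - P k) \<longlonglongrightarrow> 0" using N_eq(1) by simp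
  have "(\<lambda>k. sqrt (1 - (N k)\<^sup>2) - Q k) \<longlonglongrightarrow> 0"
    unfolding Q_def
    by (intro LIMSEQ_even_odd_split tendsto_real_sqrt)
      (use tendsto_diff[OF tendsto_const N_even, of 1] tendsto_diff[OF tendsto_const N_odd, of 1] in auto)
  then have NQ: "(\<lambda>k. N' k - Q k) \<longlonglongrightarrow> 0" using N_eq(2) by simp
  \<comment> \<open>Half the smaller limit eventually bounds both norms from below, so normalisation
    does not spoil the smallness of the eigenvector defects.\<close>
  define \<rho> where "\<rho> = min (sqrt p) (sqrt (1 - p)) / 2"
  have \<rho>: "0 < \<rho>" "2 * \<rho> \<le> P k" "2 * \<rho> \<le> Q k" for k
    using p by (auto simp: \<rho>_def P_def Q_def)
  have N_ge: "eventually (\<lambda>k. \<rho> \<le> N k) sequentially" "eventually (\<lambda>k. \<rho> \<le> N' k) sequentially"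
  proof -
    have "eventually (\<lambda>k. - \<rho> < N k - P k) sequentially"
      using NP \<rho> by (intro order_tendstoD) auto
    then show "eventually (\<lambda>k. \<rho> \<le> N k) sequentially"
      by eventually_elim (use \<rho>(2) in \<open>smt (verit)\<close>)
    have "eventually (\<lambda>k. - \<rho> < N' k - Q k) sequentially"
      using NQ \<rho> by (intro order_tendstoD) auto
    then show "eventually (\<lambda>k. \<rho> \<le> N' k) sequentially"
      by eventually_elim (use \<rho>(3) in \<open>smt (verit)\<close>)
  qed
  define e1 where "e1 k = lo k /\<^sub>R N k" for k
  define e2 where "e2 k = hi k /\<^sub>R N' k" for k
  have e: "e1 k \<bullet> e1 k = 1" "e2 k \<bullet> e2 k = 1" "e1 k \<bullet> e2 k = 0" "e2 k \<bullet> e1 k = 0" for k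
    using N_pos[of k] lo_hi_ortho[of k]
    by (simp_all add: e1_def e2_def N_def N'_def dot_square_norm power2_eq_square inner_commute)
  have z: "z k = N k *\<^sub>R e1 k + N' k *\<^sub>R e2 k" for k
    using N_pos[of k] by (simp add: e1_def e2_def lo_hi)
  have ne: "norm (e1 k) = 1" "norm (e2 k) = 1" for k
    using e[of k] by (simp_all add: norm_eq_1)
  have bound_lim: "(\<lambda>k. 2 / (M - m) * norm (annih k) / \<rho>) \<longlonglongrightarrow> 0"
    using tendsto_divide[OF tendsto_mult_right_zero[OF annih_tendsto] tendsto_const, of \<rho> "2 / (M - m)"] \<rho>
    by simp
  have e1_lim: "(\<lambda>k. norm (T (e1 k) - m *\<^sub>R e1 k)) \<longlonglongrightarrow> 0"
  proof (rule Lim_null_comparison[OF _ bound_lim])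
    show "eventually (\<lambda>k. norm (norm (T (e1 k) - m *\<^sub>R e1 k)) \<le> 2 / (M - m) * norm (annih k) / \<rho>) sequentially"
      using N_ge(1)
    proof eventually_elim
      case (elim k)
      have "T (e1 k) - m *\<^sub>R e1 k = (T (lo k) - m *\<^sub>R lo k) /\<^sub>R N k"
        by (simp add: e1_def blinfun.scaleR_right scaleR_diff_right mult.commute)
      then have "norm (T (e1 k) - m *\<^sub>R e1 k) = norm (T (lo k) - m *\<^sub>R lo k) / N k"
        using N_pos[of k] by (simp add: divide_inverse mult.commute)
      also have "\<dots> \<le> (2 / (M - m) * norm (annih k)) / \<rho>"
        using lo_bound[of k] elim \<rho> m_less_M by (intro frac_le) auto
      finally show ?case by simp
    qed
  qed
  have e2_lim: "(\<lambda>k. norm (T (e2 k) - M *\<^sub>R e2 k)) \<longlonglongrightarrow> 0"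
  proof (rule Lim_null_comparison[OF _ bound_lim])
    show "eventually (\<lambda>k. norm (norm (T (e2 k) - M *\<^sub>R e2 k)) \<le> 2 / (M - m) * norm (annih k) / \<rho>) sequentially"
      using N_ge(2)
    proof eventually_elim
      case (elim k)
      have "T (e2 k) - M *\<^sub>R e2 k = (T (hi k) - M *\<^sub>R hi k) /\<^sub>R N' k"
        by (simp add: e2_def blinfun.scaleR_right scaleR_diff_right mult.commute)
      then have "norm (T (e2 k) - M *\<^sub>R e2 k) = norm (T (hi k) - M *\<^sub>R hi k) / N' k"
        using N_pos[of k] by (simp add: divide_inverse mult.commute)
      also have "\<dots> \<le> (2 / (M - m) * norm (annih k)) / \<rho>"
        using hi_bound[of k] elim \<rho> m_less_M by (intro frac_le) auto
      finally show ?case by simp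
    qed
  qed
  \<comment> \<open>Cosine, and next sine, of the angle between the unit vectors (N k, N' k) and (P
    k, Q k) of the plane.\<close>
  define C where "C k = N k * P k + N' k * Q k" for k
  define S where "S k = N' k * P k - N k * Q k" for k
  have CS: "(C k)\<^sup>2 + (S k)\<^sup>2 = 1" for k
  proof -
    have "(C k)\<^sup>2 + (S k)\<^sup>2 = ((N k)\<^sup>2 + (N' k)\<^sup>2) * ((P k)\<^sup>2 + (Q k)\<^sup>2)"
      by (simp add: C_def S_def power2_eq_square algebra_simps)
    then show ?thesis by (simp add: NN PQ)
  qed
  have C_le: "\<bar>C k\<bar> \<le> 1" for k
    using CS[of k] abs_square_le_1[of "C k"] zero_le_power2[of "S k"] by linarith
  have PQ_le: "\<bar>P k\<bar> \<le> 1" "\<bar>Q k\<bar> \<le> 1" for k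
    using PQ(1)[of k] abs_square_le_1[of "P k"] abs_square_le_1[of "Q k"]
      zero_le_power2[of "P k"] zero_le_power2[of "Q k"] by linarith+
  have S_lim: "S \<longlonglongrightarrow> 0"
  proof (rule Lim_null_comparison[OF always_eventually])
    show "(\<lambda>k. \<bar>N' k - Q k\<bar> + \<bar>N k - P k\<bar>) \<longlonglongrightarrow> 0"
      using tendsto_add[OF tendsto_rabs_zero[OF NQ] tendsto_rabs_zero[OF NP]] by simp
    show "\<forall>k. norm (S k) \<le> \<bar>N' k - Q k\<bar> + \<bar>N k - P k\<bar>"
    proof
      fix k
      have "S k = (N' k - Q k) * P k - (N k - P k) * Q k" by (simp add: S_def algebra_simps)
      then have "\<bar>S k\<bar> \<le> \<bar>N' k - Q k\<bar> * \<bar>P k\<bar> + \<bar>N k - P k\<bar> * \<bar>Q k\<bar>"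
        by (metis abs_mult abs_triangle_ineq4)
      also have "\<dots> \<le> \<bar>N' k - Q k\<bar> * 1 + \<bar>N k - P k\<bar> * 1"
        by (intro add_mono mult_left_mono PQ_le) auto
      finally show "norm (S k) \<le> \<bar>N' k - Q k\<bar> + \<bar>N k - P k\<bar>" by simp
    qed
  qed
  define u where "u k = C k *\<^sub>R e1 k + S k *\<^sub>R e2 k" for k
  define v where "v k = C k *\<^sub>R e2 k - S k *\<^sub>R e1 k" for k
  have zuv: "z k = P k *\<^sub>R u k + Q k *\<^sub>R v k" for k
  proof -
    have "P k * C k - Q k * S k = N k * ((P k)\<^sup>2 + (Q k)\<^sup>2)"
      "P k * S k + Q k * C k = N' k * ((P k)\<^sup>2 + (Q k)\<^sup>2)"
      by (simp_all add: C_def S_def power2_eq_square algebra_simps)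
    then have "P k * C k - Q k * S k = N k" "P k * S k + Q k * C k = N' k"
      by (simp_all add: PQ)
    moreover have "P k *\<^sub>R u k + Q k *\<^sub>R v k
        = (P k * C k - Q k * S k) *\<^sub>R e1 k + (P k * S k + Q k * C k) *\<^sub>R e2 k"
      by (simp add: u_def v_def algebra_simps)
    ultimately show ?thesis by (simp add: z)
  qed
  have uv: "norm (u k) = 1" "norm (v k) = 1" for k
    using CS[of k]
    by (simp_all add: norm_eq_1 u_def v_def inner_add_left inner_add_right inner_diff_left
        inner_diff_right e power2_eq_square algebra_simps)
  have u_lim: "(\<lambda>k. norm (T (u k) - m *\<^sub>R u k)) \<longlonglongrightarrow> 0"
  proof (rule Lim_null_comparison[OF always_eventually])
    show "(\<lambda>k. norm (T (e1 k) - m *\<^sub>R e1 k) + \<bar>S k\<bar> * (2 * (M - m))) \<longlonglongrightarrow> 0"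
      using tendsto_add[OF e1_lim tendsto_mult_left_zero[OF tendsto_rabs_zero[OF S_lim]]] by simp
    show "\<forall>k. norm (norm (T (u k) - m *\<^sub>R u k)) \<le> norm (T (e1 k) - m *\<^sub>R e1 k) + \<bar>S k\<bar> * (2 * (M - m))"
    proof
      fix k
      have "T (u k) - m *\<^sub>R u k = C k *\<^sub>R (T (e1 k) - m *\<^sub>R e1 k) + S k *\<^sub>R (T (e2 k) - m *\<^sub>R e2 k)"
        by (simp add: u_def blinfun.add_right blinfun.scaleR_right algebra_simps)
      then have "norm (T (u k) - m *\<^sub>R u k) \<le> \<bar>C k\<bar> * norm (T (e1 k) - m *\<^sub>R e1 k) + \<bar>S k\<bar> * norm (T (e2 k) - m *\<^sub>R e2 k)"
        by (metis norm_scaleR norm_triangle_ineq)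
      also have "\<dots> \<le> 1 * norm (T (e1 k) - m *\<^sub>R e1 k) + \<bar>S k\<bar> * (2 * (M - m))"
        using norm_shift_between[of m "e2 k"] m_less_M
        by (intro add_mono mult_right_mono mult_left_mono C_le) (auto simp: ne)
      finally show "norm (norm (T (u k) - m *\<^sub>R u k)) \<le> norm (T (e1 k) - m *\<^sub>R e1 k) + \<bar>S k\<bar> * (2 * (M - m))"
        by simp
    qed
  qed
  have v_lim: "(\<lambda>k. norm (T (v k) - M *\<^sub>R v k)) \<longlonglongrightarrow> 0"
  proof (rule Lim_null_comparison[OF always_eventually])
    show "(\<lambda>k. norm (T (e2 k) - M *\<^sub>R e2 k) + \<bar>S k\<bar> * (2 * (M - m))) \<longlonglongrightarrow> 0"
      using tendsto_add[OF e2_lim tendsto_mult_left_zero[OF tendsto_rabs_zero[OF S_lim]]] by simp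
    show "\<forall>k. norm (norm (T (v k) - M *\<^sub>R v k)) \<le> norm (T (e2 k) - M *\<^sub>R e2 k) + \<bar>S k\<bar> * (2 * (M - m))"
    proof
      fix k
      have "T (v k) - M *\<^sub>R v k = C k *\<^sub>R (T (e2 k) - M *\<^sub>R e2 k) - S k *\<^sub>R (T (e1 k) - M *\<^sub>R e1 k)"
        by (simp add: v_def blinfun.diff_right blinfun.scaleR_right algebra_simps)
      then have "norm (T (v k) - M *\<^sub>R v k) \<le> \<bar>C k\<bar> * norm (T (e2 k) - M *\<^sub>R e2 k) + \<bar>S k\<bar> * norm (T (e1 k) - M *\<^sub>R e1 k)"
        by (metis norm_scaleR norm_triangle_ineq4)
      also have "\<dots> \<le> 1 * norm (T (e2 k) - M *\<^sub>R e2 k) + \<bar>S k\<bar> * (2 * (M - m))"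
        using norm_shift_between[of M "e1 k"] m_less_M
        by (intro add_mono mult_right_mono mult_left_mono C_le) (auto simp: ne)
      finally show "norm (norm (T (v k) - M *\<^sub>R v k)) \<le> norm (T (e2 k) - M *\<^sub>R e2 k) + \<bar>S k\<bar> * (2 * (M - m))"
        by simp
    qed
  qed
  \<comment> \<open>The sign absorbs the minus in the odd formula; norm and defect do not
    change.\<close>
  define v' where "v' k = (if even k then v k else - v k)" for k
  have "norm (T (v' k) - M *\<^sub>R v' k) = norm (T (v k) - M *\<^sub>R v k)" for k
    by (simp add: v'_def blinfun.minus_right norm_minus_commute)
  then have v'_lim: "(\<lambda>k. norm (T (v' k) - M *\<^sub>R v' k)) \<longlonglongrightarrow> 0" using v_lim by simp
  show ?thesis
  proof (intro exI conjI allI)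
    show "z (2 * k) = sqrt p *\<^sub>R u (2 * k) + sqrt (1 - p) *\<^sub>R v' (2 * k)" for k
      using zuv[of "2 * k"] by (simp add: P_def Q_def v'_def)
    show "z (2 * k + 1) = sqrt (1 - p) *\<^sub>R u (2 * k + 1) - sqrt p *\<^sub>R v' (2 * k + 1)" for k
      using zuv[of "2 * k + 1"] by (simp add: P_def Q_def v'_def)
    show "norm (v' k) = 1" for k by (simp add: v'_def uv)
  qed (use p uv u_lim v'_lim in auto)
qed

end

section \<open>Reduction of the P-gradient algorithm to the renormalised iteration\<close>

lemma quadratic_min:
  fixes a b c \<gamma> :: real
  assumes b: "0 < b" and min: "\<And>t. c - 2 * \<gamma> * a + \<gamma>\<^sup>2 * b \<le> c - 2 * t * a + t\<^sup>2 * b"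
  shows "\<gamma> = a / b"
proof -
  have "b * (\<gamma> - a / b)\<^sup>2 = (c - 2 * \<gamma> * a + \<gamma>\<^sup>2 * b) - (c - 2 * (a / b) * a + (a / b)\<^sup>2 * b)"
    using b by (simp add: power2_eq_square field_simps)
  also have "\<dots> \<le> 0" using min[of "a / b"] by simp
  finally show ?thesis using b by (simp add: mult_le_0_iff)
qed

theorem theorem2:
  fixes A :: "'a::{real_inner, complete_space} \<Rightarrow>\<^sub>L 'a"
    and m M :: real
    and y :: 'a
    and f :: "'a \<Rightarrow> real"
    and g :: "'a \<Rightarrow> 'a"
    and P :: "real \<Rightarrow> real"
    and c :: "int \<Rightarrow> real"
    and E :: "real \<Rightarrow> 'a \<Rightarrow>\<^sub>L 'a"
    and x z :: "nat \<Rightarrow> 'a"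
  assumes A: "selfadjoint_op A" "positive_op A"
    and m: "m = (INF x\<in>{x. norm x = 1}. A x \<bullet> x)"
    and M: "M = (SUP x\<in>{x. norm x = 1}. A x \<bullet> x)"
    and mM: "0 < m" "m < M"
    and f: "f = quadratic_objective A y"
    and g: "\<And>x. GDERIV f x :> g x"
    and P_smooth: "infinitely_differentiable_on P {m..M}"
    and P_laurent: "\<And>a. a \<in> {m..M} \<Longrightarrow> laurent_sums c a (P a)"
    and P_pos: "\<And>a. a \<in> {m..M} \<Longrightarrow> 0 < P a"
    and alg: "gradient_algorithm (laurent_op c A) g x"
    and z: "\<And>k. z k = renormalised_gradient (laurent_op c A) A (g (x k))"
    and E: "spectral_family A E"
    and z0: "\<And>\<epsilon>. 0 < \<epsilon> \<Longrightarrow> \<epsilon> < (M - m) / 2 \<Longrightarrow>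
               E (m + \<epsilon>) (z 0) \<bullet> z 0 > 0 \<and> E (M - \<epsilon>) (z 0) \<bullet> z 0 < 1"
  shows "\<exists>(p :: real) (u :: nat \<Rightarrow> 'a) (v :: nat \<Rightarrow> 'a).
           0 < p \<and> p < 1 \<and>
           (\<forall>k. z (2 * k) = sqrt p *\<^sub>R u (2 * k) + sqrt (1 - p) *\<^sub>R v (2 * k) \<and>
                z (2 * k + 1) = sqrt (1 - p) *\<^sub>R u (2 * k + 1) - sqrt p *\<^sub>R v (2 * k + 1)) \<and>
           (\<forall>n. norm (u n) = 1 \<and> norm (v n) = 1) \<and>
           (\<lambda>n. norm (A (u n) - m *\<^sub>R u n)) \<longlonglongrightarrow> 0 \<and>
           (\<lambda>n. norm (A (v n) - M *\<^sub>R v n)) \<longlonglongrightarrow> 0"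
proof -
  interpret res: spectral_resolution A E
    by (rule spectral_family_resolution[OF A(1) E])
  \<comment> \<open>\<open>INF\<close> and \<open>SUP\<close> of reals are informative only for
    bounded sets, so the Rayleigh quotients are bounded first.\<close>
  have bound: "\<bar>A u \<bullet> u\<bar> \<le> norm A" if "norm u = 1" for u
    using Cauchy_Schwarz_ineq2[of "A u" u] norm_blinfun[of A u] that by simp
  have bdd: "bdd_below ((\<lambda>x. A x \<bullet> x) ` {x. norm x = 1})" "bdd_above ((\<lambda>x. A x \<bullet> x) ` {x. norm x = 1})"
    using bound by (force simp: abs_le_iff intro!: bdd_belowI2[of _ "- norm A"] bdd_aboveI2[of _ _ "norm A"])+
  have form: "m * (w \<bullet> w) \<le> A w \<bullet> w \<and> A w \<bullet> w \<le> M * (w \<bullet> w)" for w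
  proof (cases "w = 0")
    case False
    define u where "u = w /\<^sub>R norm w"
    have u: "u \<in> {x. norm x = 1}" using False by (simp add: u_def)
    have "m \<le> A u \<bullet> u" unfolding m by (rule cINF_lower[OF bdd(1) u])
    moreover have "A u \<bullet> u \<le> M" unfolding M by (rule cSUP_upper[OF u bdd(2)])
    moreover have "A u \<bullet> u = (A w \<bullet> w) / (w \<bullet> w)"
      by (simp add: u_def blinfun.scaleR_right dot_square_norm power2_eq_square divide_inverse)
    moreover have "0 < w \<bullet> w" using False by simp
    ultimately show ?thesis by (simp add: pos_le_divide_eq pos_divide_le_eq)
  qed (simp add: blinfun.zero_right)
  interpret H: hilbert_resolution A E m M
    by unfold_locales (use form mM in auto)
  define Q where "Q = laurent_op c A"
  define B where "B = op_sqrt (Q o\<^sub>L A)"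
  have Q: "H.calc P Q" unfolding Q_def by (rule H.calc_laurent_op[OF mM(1) P_laurent])
  have QA: "H.calc (\<lambda>t. P t * t) (Q o\<^sub>L A)" by (rule H.calc_mult[OF Q H.calc_id])
  have pos: "0 < P t * t" if "t \<in> {m..M}" for t using P_pos[OF that] that mM by simp
  have B: "H.calc (\<lambda>t. sqrt (P t * t)) B" unfolding B_def by (rule H.calc_op_sqrt(1)[OF QA pos])
  have "B o\<^sub>L B = Q o\<^sub>L A" unfolding B_def by (rule H.calc_op_sqrt(2)[OF QA pos])
  then have BB: "Q (A w) = B (B w)" for w by (metis blinfun_apply_blinfun_compose)
  have B_sym: "B v \<bullet> w = v \<bullet> B w" for v w by (rule H.calcD(2)[OF B])
  have BA: "B (A w) = A (B w)" for w by (rule H.calc_commute[OF B H.calc_id])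
  have Q_sym: "Q v \<bullet> w = v \<bullet> Q w" for v w by (rule H.calcD(2)[OF Q])
  have g_eq: "g w = A w - y" for w
  proof -
    have "(\<lambda>h. h \<bullet> g w) = (\<lambda>h. h \<bullet> (A w - y))"
      using g[of w] GDERIV_quadratic_objective[OF A(1), of y w] unfolding f gderiv_def
      by (rule has_derivative_unique)
    then show ?thesis by (metis vector_eq_ldot)
  qed
  define h where "h k = B (g (x k))" for k
  \<comment> \<open>Since B is self-adjoint with square P(A) A, the number (P(A) A g, g) is the
    squared norm of B g.\<close>
  have z_eq: "z k = h k /\<^sub>R norm (h k)" for k
    unfolding z renormalised_gradient_def Q_def[symmetric] B_def[symmetric] h_def BB
    by (simp add: B_sym norm_eq_sqrt_inner)
  obtain \<gamma> where \<gamma>: "\<And>k. is_arg_min (\<lambda>t. Q (g (x k - t *\<^sub>R g (x k))) \<bullet> g (x k - t *\<^sub>R g (x k))) (\<lambda>_. True) (\<gamma> k)"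
    and x_step: "\<And>k. x (Suc k) = x k - \<gamma> k *\<^sub>R g (x k)"
    using alg unfolding gradient_algorithm_def Q_def[symmetric] by blast
  define \<mu> where "\<mu> k = A (z k) \<bullet> z k" for k
  define d where "d k = norm (A (z k) - \<mu> k *\<^sub>R z k)" for k
  \<comment> \<open>The case d k = 0 is included: then h (Suc k) = 0, and division by 0 makes both
    sides 0.\<close>
  have z_step: "z (Suc k) = (\<mu> k *\<^sub>R z k - A (z k)) /\<^sub>R d k" if "z k \<noteq> 0" for k
  proof -
    let ?v = "g (x k)"
    let ?a = "h k \<bullet> h k" and ?b = "A (h k) \<bullet> h k"
    have h0: "h k \<noteq> 0" using that by (auto simp: z_eq)
    then have a: "0 < ?a" by simp
    have b: "0 < ?b" using form[of "h k"] mM(1) a by (meson less_le_trans mult_pos_pos)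
    have g_line: "g (x k - t *\<^sub>R ?v) = ?v - t *\<^sub>R A ?v" for t
      by (simp add: g_eq blinfun.diff_right blinfun.scaleR_right)
    \<comment> \<open>Along the search line the objective is a quadratic whose coefficients are (h,
      h) and (A h, h) for h = B g. Exact minimisation therefore gives the reciprocal of the Rayleigh
      quotient \<mu> k, and P has disappeared.\<close>
    have q: "Q (g (x k - t *\<^sub>R ?v)) \<bullet> g (x k - t *\<^sub>R ?v) = Q ?v \<bullet> ?v - 2 * t * ?a + t\<^sup>2 * ?b" for t
    proof -
      have "Q (A ?v) \<bullet> ?v = ?a" by (simp add: BB B_sym h_def)
      moreover from this have "Q ?v \<bullet> A ?v = ?a" by (metis Q_sym inner_commute)
      moreover have "Q (A ?v) \<bullet> A ?v = ?b" unfolding BB B_sym[of "B ?v"] BA h_def by (rule inner_commute)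
      ultimately show ?thesis unfolding g_line
        by (simp add: blinfun.diff_right blinfun.scaleR_right inner_diff_left inner_diff_right
            power2_eq_square algebra_simps)
    qed
    have "\<gamma> k = ?a / ?b"
    proof (rule quadratic_min[OF b])
      show "Q ?v \<bullet> ?v - 2 * \<gamma> k * ?a + (\<gamma> k)\<^sup>2 * ?b \<le> Q ?v \<bullet> ?v - 2 * t * ?a + t\<^sup>2 * ?b" for t
        using \<gamma>[of k] unfolding is_arg_min_def q by (simp add: not_less)
    qed
    moreover have mu: "\<mu> k = ?b / ?a"
      by (simp add: \<mu>_def z_eq blinfun.scaleR_right dot_square_norm power2_eq_square divide_inverse)
    ultimately have \<gamma>_eq: "\<gamma> k = inverse (\<mu> k)" by simp
    have \<mu>_pos: "0 < \<mu> k" using a b by (simp add: mu)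
    have "h (Suc k) = h k - \<gamma> k *\<^sub>R A (h k)"
      unfolding h_def x_step g_line by (simp add: blinfun.diff_right blinfun.scaleR_right BA)
    also have "\<dots> = (norm (h k) / \<mu> k) *\<^sub>R (\<mu> k *\<^sub>R z k - A (z k))"
    proof -
      have "norm (h k) * inverse (\<mu> k) * (\<mu> k * inverse (norm (h k))) = 1"
        "norm (h k) * inverse (\<mu> k) * inverse (norm (h k)) = inverse (\<mu> k)"
        using h0 \<mu>_pos by (simp_all add: field_simps)
      then show ?thesis
        by (simp add: \<gamma>_eq z_eq blinfun.scaleR_right scaleR_diff_right divide_inverse)
    qed
    finally have h_step: "h (Suc k) = (norm (h k) / \<mu> k) *\<^sub>R (\<mu> k *\<^sub>R z k - A (z k))" .
    have n: "norm (h (Suc k)) = norm (h k) / \<mu> k * d k"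
      unfolding h_step d_def using \<mu>_pos by (simp add: norm_minus_commute)
    show ?thesis unfolding z_eq[of "Suc k"] n unfolding h_step using h0 \<mu>_pos by (simp add: inverse_eq_divide)
  qed
  have low: "E s (z 0) \<noteq> 0" if "m < s" for s
  proof
    assume s: "E s (z 0) = 0"
    \<comment> \<open>The hypothesis \<open>z0\<close> covers only \<epsilon> below (M - m) / 2; a
      larger s is reached through a smaller threshold, as the projections increase.\<close>
    define \<epsilon> where "\<epsilon> = min (s - m) ((M - m) / 4)"
    have \<epsilon>: "0 < \<epsilon>" "\<epsilon> < (M - m) / 2" "m + \<epsilon> \<le> s"
      using that mM by (auto simp: \<epsilon>_def min_def field_simps)
    have "E (m + \<epsilon>) (z 0) = E (m + \<epsilon>) (E s (z 0))"
      using \<epsilon> by (simp add: res.F_F min_absorb1)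
    then show False using z0[OF \<epsilon>(1,2)] s by (simp add: blinfun.zero_right)
  qed
  have z0_unit: "norm (z 0) = 1"
  proof -
    have "z 0 \<noteq> 0" using low[OF mM(2)] by (auto simp: blinfun.zero_right)
    then show ?thesis by (auto simp: z_eq)
  qed
  have high: "E s (z 0) \<noteq> z 0" if "s < M" for s
  proof
    assume s: "E s (z 0) = z 0"
    define \<epsilon> where "\<epsilon> = min (M - s) ((M - m) / 4)"
    have \<epsilon>: "0 < \<epsilon>" "\<epsilon> < (M - m) / 2" "s \<le> M - \<epsilon>"
      using that mM by (auto simp: \<epsilon>_def min_def field_simps)
    have "E (M - \<epsilon>) (E s (z 0)) = E s (z 0)"
      using \<epsilon> by (simp add: res.F_F min_absorb2)
    then show False using z0[OF \<epsilon>(1,2)] s z0_unit by (simp add: dot_square_norm)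
  qed
  have d0: "0 < d 0"
  proof (rule ccontr)
    assume "\<not> 0 < d 0"
    then have eig: "A (z 0) = \<mu> 0 *\<^sub>R z 0" by (simp add: d_def)
    \<comment> \<open>If \<open>z 0\<close> were an eigenvector, its eigenvalue would be at most s
      because of \<open>low\<close> and at least t because of \<open>high\<close>; cutting [m, M]
      into thirds makes s < t.\<close>
    define s where "s = (2 * m + M) / 3"
    define t where "t = (m + 2 * M) / 3"
    have st: "m < s" "s < t" "t < M" using mM by (auto simp: s_def t_def)
    have "\<mu> 0 * (E s (z 0) \<bullet> E s (z 0)) \<le> s * (E s (z 0) \<bullet> E s (z 0))"
      using res.F_upper[of s "z 0"] by (simp add: res.F_T[symmetric] eig blinfun.scaleR_right)
    then have "\<mu> 0 \<le> s" using low[OF st(1)] by simp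
    moreover have "t * ((z 0 - E t (z 0)) \<bullet> (z 0 - E t (z 0))) \<le> \<mu> 0 * ((z 0 - E t (z 0)) \<bullet> (z 0 - E t (z 0)))"
    proof -
      have "A (z 0 - E t (z 0)) = \<mu> 0 *\<^sub>R (z 0 - E t (z 0))"
        by (simp add: blinfun.diff_right res.F_T[symmetric] eig blinfun.scaleR_right scaleR_diff_right)
      then show ?thesis using res.F_lower[of t "z 0"] by simp
    qed
    then have "t \<le> \<mu> 0" using high[OF st(3)] by simp
    ultimately show False using st by simp
  qed
  have all: "norm (z k) = 1 \<and> 0 < d k" for k
  proof (induction k)
    case 0
    show ?case using z0_unit d0 by simp
  next
    case (Suc k)
    then have zk: "z k \<noteq> 0" and dk: "0 < d k" by auto
    have u: "norm (z (Suc k)) = 1"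
      unfolding z_step[OF zk] using dk by (simp add: d_def norm_minus_commute)
    then have zk': "z (Suc k) \<noteq> 0" by auto
    have s1: "d k *\<^sub>R z (Suc k) = 1 *\<^sub>R (\<mu> k *\<^sub>R z k - A (z k))"
      using z_step[OF zk] dk by simp
    \<comment> \<open>Valid also when d (Suc k) = 0, both sides being 0; the monotonicity of d then
      excludes that case.\<close>
    have s2: "d (Suc k) *\<^sub>R z (Suc (Suc k)) = 1 *\<^sub>R (\<mu> (Suc k) *\<^sub>R z (Suc k) - A (z (Suc k)))"
    proof (cases "d (Suc k) = 0")
      case True
      then show ?thesis by (simp add: d_def)
    next
      case False
      then show ?thesis using z_step[OF zk'] by simp
    qed
    have "d k \<le> d (Suc k)"
      by (rule steepest_step(3)[OF res.T_sym _ _ u \<mu>_def \<mu>_def d_def d_def dk s1 s2]) (use Suc in auto)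
    then show ?case using u dk by simp
  qed
  interpret two_sided_steps A E m M z
  proof
    show "(1 :: real) * 1 = 1" by simp
    show "norm (z k) = 1" for k using all by simp
    show "0 < norm (A (z k) - (A (z k) \<bullet> z k) *\<^sub>R z k)" for k
      using all[of k] by (simp add: d_def \<mu>_def)
    show "norm (A (z k) - (A (z k) \<bullet> z k) *\<^sub>R z k) *\<^sub>R z (Suc k)
      = 1 *\<^sub>R ((A (z k) \<bullet> z k) *\<^sub>R z k - A (z k))" for k
    proof -
      have "z k \<noteq> 0" "d k \<noteq> 0" using all[of k] by auto
      then show ?thesis using z_step[of k] by (simp add: d_def \<mu>_def)
    qed
  qed (use low high in auto)
  show ?thesis by (rule two_point_limit)
qed

end
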